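(* Let $r$ and $\alpha$ be positive integers. Let $\boldsymbol{\alpha}=(\alpha,\dots,\alpha,\alpha_1,\dots,\alpha_r)\in\mathbb{N}^{k+r}$, where $k>0$ is the multiplicity of $\alpha$ (the first $k$ entries equal $\alpha$) and $\alpha<\alpha_i$ for all $1\le i\le r$. Put $\boldsymbol{\beta}=(\alpha_1,\dots,\alpha_r)\in\mathbb{N}^r$. Then, as $x\to\infty$, $$\sigma_{\boldsymbol{\alpha}}(x)\sim\sigma_k\left(x^{\frac1\alpha}\right)\sum_{n\in\mathcal{P}^{\sigma}_{\boldsymbol{\beta}}}n^{-\frac1\alpha}$$ and $$\pi_{\boldsymbol{\alpha}}(x)\sim\sigma_k\left(x^{\frac1\alpha}\right)\sum_{n\in\mathcal{P}^{\pi}_{\boldsymbol{\beta}}}n^{-\frac1\alpha}.$$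
   Context: $\mathbb{N}$ denotes the positive integers. For a vector $\boldsymbol{\gamma}=(\gamma_1,\dots,\gamma_s)\in\mathbb{N}^s$, let $\mathcal{P}^{\sigma}_{\boldsymbol{\gamma}}$ be the set of integers $n$ that can be written as $n=p_1^{\gamma_1}\cdots p_s^{\gamma_s}$ with $p_1,\dots,p_s$ primes, not necessarily distinct, and let $\mathcal{P}^{\pi}_{\boldsymbol{\gamma}}$ be the set of integers $n$ that can be written as $n=p_1^{\gamma_1}\cdots p_s^{\gamma_s}$ with $p_1,\dots,p_s$ pairwise distinct primes. These are sets of integers, so each integer is counted once regardless of how many such representations it has. For real $x$, $\sigma_{\boldsymbol{\gamma}}(x)$ is the number of $n\le x$ with $n\in\mathcal{P}^{\sigma}_{\boldsymbol{\gamma}}$, and $\pi_{\boldsymbol{\gamma}}(x)$ is the number of $n\le x$ with $n\in\mathcal{P}^{\pi}_{\boldsymbol{\gamma}}$. For a positive integer $k$, $\sigma_k(x)$ is the number of integers $n\le x$ of the form $n=p_1\cdots p_k$ with $p_1,\dots,p_k$ primes, not necessarily distinct. The notation $f(x)\sim g(x)$ means $\lim_{x\to\infty} f(x)/g(x)=1$; here $k$, $r$, $\alpha$ and the $\alpha_i$ are fixed. *)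

theory Defs
  imports
    "HOL-Analysis.Analysis"
    "HOL-Library.Landau_Symbols"
    "HOL-Computational_Algebra.Primes"
begin

text \<open>
  An exponent vector is a list of naturals; its positivity is left to the statements that use it.
\<close>

definition P_sigma :: "nat list \<Rightarrow> nat set" where
  "P_sigma \<gamma> = {n. \<exists>p :: nat \<Rightarrow> nat.
     (\<forall>i<length \<gamma>. prime (p i)) \<and> n = (\<Prod>i<length \<gamma>. p i ^ (\<gamma> ! i))}"

definition P_pi :: "nat list \<Rightarrow> nat set" where
  "P_pi \<gamma> = {n. \<exists>p :: nat \<Rightarrow> nat.
     (\<forall>i<length \<gamma>. prime (p i)) \<and> inj_on p {..<length \<gamma>} \<and>
     n = (\<Prod>i<length \<gamma>. p i ^ (\<gamma> ! i))}"

definition sigma_count :: "nat list \<Rightarrow> real \<Rightarrow> nat" where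
  "sigma_count \<gamma> x = card {n. real n \<le> x \<and> n \<in> P_sigma \<gamma>}"

definition pi_count :: "nat list \<Rightarrow> real \<Rightarrow> nat" where
  "pi_count \<gamma> x = card {n. real n \<le> x \<and> n \<in> P_pi \<gamma>}"

definition almost_prime_count :: "nat \<Rightarrow> real \<Rightarrow> nat" where
  "almost_prime_count k x = card {n. real n \<le> x \<and>
     (\<exists>p :: nat \<Rightarrow> nat. (\<forall>i<k. prime (p i)) \<and> n = (\<Prod>i<k. p i))}"

end

theory Submission
  imports Defs
    "HOL-Complex_Analysis.Complex_Analysis"
    "HOL-Number_Theory.Prime_Powers"
    "HOL-Computational_Algebra.Squarefree"
    "HOL-Real_Asymp.Real_Asymp"
begin

text \<open>
  Every number counted is \<open>m\<^sup>\<alpha> b\<close> with \<open>m\<close> a product of \<open>k\<close> primes and \<open>b\<close> from the set \<open>B\<close> belonging to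
  \<open>\<beta>\<close>; conversely all pairs with \<open>m\<close> squarefree and prime to \<open>b\<close> occur and give distinct numbers, because all
  exponents in \<open>b\<close> exceed \<open>\<alpha>\<close>. The excluded \<open>m\<close> have density zero among the products of \<open>k\<close> primes, so both
  counting functions are asymptotic to \<open>\<Sum>\<^sub>b \<sigma>\<^sub>k(b\<^sup>-\<^sup>1\<^sup>/\<^sup>\<alpha> x\<^sup>1\<^sup>/\<^sup>\<alpha>)\<close>. The claim follows by dominated convergence once
  \<open>\<sigma>\<^sub>k\<close> is known to vary regularly with index 1, that is, \<open>\<sigma>\<^sub>k(c y) \<sim> c \<sigma>\<^sub>k(y)\<close>; Potter's bound provides the
  majorant.

  For \<open>k = 1\<close> regular variation is a consequence of the prime number theorem, which is proved along the lines
  of Newman: the Dirichlet series of \<open>(\<psi>(n) - n)/n\<close> continues analytically across the line of convergence, so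
  \<open>\<Sum> (\<psi>(n) - n)/n\<^sup>2\<close> converges. The property passes from \<open>k\<close> to \<open>k + 1\<close> since \<open>(k + 1) \<sigma>\<^sub>k\<^sub>+\<^sub>1(x)\<close> equals
  \<open>\<Sum>\<^sub>p \<sigma>\<^sub>k(x/p)\<close> up to \<open>O(\<sigma>\<^sub>k(x))\<close>, which is negligible because the sum of the reciprocals of the primes
  diverges.
\<close>

section \<open>Newman's Tauberian theorem\<close>

text \<open>Two quantitative facts feed the dominated convergence. Every exponent in
  \<open>\<beta>\<close> is at least \<open>\<alpha> + 1\<close>, so the sum of b^(-s/\<alpha>) over
  \<open>B\<close> converges for every s > \<alpha>/(\<alpha>+1); and for every s < 1 Potter's bound
  dominates sigma_k(c y)/sigma_k(y), c <= 1, by a constant times c^s. The two ranges of s overlap.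
  Only ratios of sigma_k enter, which is why regular variation is the property carried through the
  induction.

  The obstacle in the step from k to k + 1 is that large primes p push x/p out of the range in which
  regular variation of sigma_k says anything. Each of them costs a bounded error and there are
  O(pi(x)) of them, so the induction also carries the inequality pi(x) <= sigma_k(x). The total
  error is then O(sigma_k(x)), negligible for the same reason as the error in the recursion.

  The Tauberian theorem needs two inputs: Chebyshev's bound, which makes (psi(n) - n)/n bounded, and
  the absence of zeros of zeta on Re s = 1, which gives the continuation across that line.\<close>

lemma powr_diff_mvt:
  fixes c :: real
  assumes "0 < u" "u < v"
  obtains t where "u < t" "t < v" "v powr c - u powr c = (v - u) * (c * t powr (c - 1))"
proof -
  have "\<exists>t>u. t < v \<and> v powr c - u powr c = (v - u) * (c * t powr (c - 1))"
    using assms by (intro MVT2) (auto intro!: derivative_eq_intros)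
  thus ?thesis using that by blast
qed

lemma powr_Suc_diff_mvt:
  assumes "n \<ge> 1"
  obtains t where "real n < t" "t < real (Suc n)"
    "real (Suc n) powr c - real n powr c = c * t powr (c - 1)"
  using powr_diff_mvt[of "real n" "real (Suc n)" c] assms by auto

text \<open>Mean value theorem for t^(-x). The right-hand side telescopes, so it replaces an
  integral comparison for tails of the series.\<close>

lemma powr_tail_term_le:
  fixes x :: real
  assumes "x > 0" "n \<ge> 1"
  shows "real (Suc n) powr (-1-x) \<le> (real n powr (-x) - real (Suc n) powr (-x)) / x"
proof -
  obtain t where t: "real n < t" "t < real (Suc n)"
    "real (Suc n) powr (-x) - real n powr (-x) = -x * t powr (-x-1)"
    using powr_Suc_diff_mvt[of n "-x"] assms by blast
  have e: "-1-x = -x-1" by simp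
  have "real (Suc n) powr (-x-1) \<le> t powr (-x-1)"
    using t(1,2) assms by (intro powr_mono2') auto
  hence "x * real (Suc n) powr (-x-1) \<le> x * t powr (-x-1)"
    using assms by (intro mult_left_mono) auto
  also have "x * t powr (-x-1) = real n powr (-x) - real (Suc n) powr (-x)"
    using t(3) by simp
  finally show ?thesis unfolding e using assms by (simp only: pos_le_divide_eq mult.commute)
qed

text \<open>Comparison with telescoping differences of n^y. For y <= 1 each summand is compared with
  the interval to its left. For y > 1 it is compared with the interval to its right, which would
  overshoot \<open>N\<close> at the last summand; that summand is split off and accounts for the
  1/N.\<close>

lemma sum_powr_le:
  fixes y :: real
  assumes "y > 0" "N \<ge> 1"
  shows "(\<Sum>n<N. real (Suc n) powr (y-1)) \<le> real N powr y * (1 / y + 1 / real N)"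
proof (cases "y \<le> 1")
  case True
  have *: "real (Suc n) powr (y-1) \<le> (real (Suc n) powr y - real n powr y) / y" for n
  proof (cases "n = 0")
    case False
    obtain t where t: "real n < t" "t < real (Suc n)"
      "real (Suc n) powr y - real n powr y = y * t powr (y-1)"
      using powr_Suc_diff_mvt[of n y] False by auto
    have "real (Suc n) powr (y-1) \<le> t powr (y-1)"
      using t(1,2) assms True False by (intro powr_mono2') auto
    hence "y * real (Suc n) powr (y-1) \<le> y * t powr (y-1)"
      using assms by (intro mult_left_mono) auto
    also have "y * t powr (y-1) = real (Suc n) powr y - real n powr y"
      using t(3) by simp
    finally show ?thesis using assms by (simp only: pos_le_divide_eq mult.commute)
  qed (use assms True in \<open>simp add: field_simps\<close>)
  have "(\<Sum>n<N. real (Suc n) powr (y-1)) \<le> (\<Sum>n<N. (real (Suc n) powr y - real n powr y) / y)"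
    by (intro sum_mono *)
  also have "\<dots> = (\<Sum>n<N. (real (Suc n) powr y - real n powr y)) / y"
    by (simp add: sum_divide_distrib)
  also have "(\<Sum>n<N. (real (Suc n) powr y - real n powr y)) = real N powr y"
    by (subst sum_lessThan_telescope[of "\<lambda>n. real n powr y"]) simp
  finally show ?thesis using assms by (simp add: algebra_simps add_increasing2)
next
  case False
  have *: "real (Suc n) powr (y-1) \<le> (real (Suc (Suc n)) powr y - real (Suc n) powr y) / y" for n
  proof -
    obtain t where t: "real (Suc n) < t" "t < real (Suc (Suc n))"
      "real (Suc (Suc n)) powr y - real (Suc n) powr y = y * t powr (y-1)"
      using powr_Suc_diff_mvt[of "Suc n" y] by auto
    have "real (Suc n) powr (y-1) \<le> t powr (y-1)"
      using t(1,2) assms False by (intro powr_mono2) auto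
    hence "y * real (Suc n) powr (y-1) \<le> y * t powr (y-1)"
      using assms by (intro mult_left_mono) auto
    also have "y * t powr (y-1) = real (Suc (Suc n)) powr y - real (Suc n) powr y"
      using t(3) by simp
    finally show ?thesis using assms by (simp only: pos_le_divide_eq mult.commute)
  qed
  obtain M where M: "N = Suc M" using assms by (cases N) auto
  have "(\<Sum>n<N. real (Suc n) powr (y-1)) = (\<Sum>n<M. real (Suc n) powr (y-1)) + real N powr (y-1)"
    by (simp add: M)
  also have "(\<Sum>n<M. real (Suc n) powr (y-1)) \<le> (\<Sum>n<M. (real (Suc (Suc n)) powr y - real (Suc n) powr y) / y)"
    by (intro sum_mono *)
  also have "\<dots> = (\<Sum>n<M. (real (Suc (Suc n)) powr y - real (Suc n) powr y)) / y"
    by (simp only: sum_divide_distrib)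
  also have "(\<Sum>n<M. (real (Suc (Suc n)) powr y - real (Suc n) powr y)) = real N powr y - 1"
    unfolding M by (subst sum_lessThan_telescope[of "\<lambda>n. real (Suc n) powr y"]) simp
  also have "(real N powr y - 1) / y \<le> real N powr y / y" using assms by (simp add: divide_right_mono)
  also have "real N powr (y - 1) = real N powr y / real N"
    using assms by (simp add: powr_diff)
  finally show ?thesis by (simp add: distrib_left)
qed

text \<open>Serves the right half of Newman's contour. The factor 1/Re z blows up at the imaginary
  axis and is compensated there by the kernel.\<close>

lemma norm_dirichlet_tail_le:
  fixes a :: "nat \<Rightarrow> complex"
  assumes "\<And>n. norm (a n) \<le> B" "Re z > 0" "N \<ge> 1"
    and "(\<lambda>n. a n * of_nat (Suc n) powr (-1-z)) sums G"
  shows "norm (G - (\<Sum>n<N. a n * of_nat (Suc n) powr (-1-z))) \<le> B * real N powr (- Re z) / Re z"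
proof -
  define x where "x = Re z"
  have x: "x > 0" using assms by (simp add: x_def)
  have B: "B \<ge> 0" using assms(1)[of 0] norm_ge_zero order_trans by blast
  define g where "g = (\<lambda>n. real (n + N) powr (-x))"
  have "(\<lambda>n. g n - g (Suc n)) sums (g 0 - 0)"
  proof (rule telescope_sums')
    have "(\<lambda>n. real n powr (-x)) \<longlonglongrightarrow> 0"
      using x by (intro tendsto_neg_powr filterlim_real_sequentially) auto
    thus "g \<longlonglongrightarrow> 0" unfolding g_def by (rule LIMSEQ_ignore_initial_segment)
  qed
  hence s1: "(\<lambda>n. B * ((g n - g (Suc n)) / x)) sums (B * (g 0 / x))"
    by (intro sums_mult sums_divide) simp
  define h where "h = (\<lambda>n. a (n + N) * of_nat (Suc (n + N)) powr (-1-z))"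
  have s2: "h sums (G - (\<Sum>n<N. a n * of_nat (Suc n) powr (-1-z)))"
    unfolding h_def using assms(4) by (subst sums_iff_shift) simp
  have le: "norm (h n) \<le> B * ((g n - g (Suc n)) / x)" for n
  proof -
    have "norm (h n) = norm (a (n+N)) * real (Suc (n+N)) powr (-1-x)"
      unfolding h_def norm_mult by (subst norm_powr_real_powr) (auto simp: x_def)
    also have "\<dots> \<le> B * ((g n - g (Suc n)) / x)"
      using powr_tail_term_le[of x "n + N"] assms x B
      unfolding g_def by (intro mult_mono) auto
    finally show ?thesis .
  qed
  have "norm (suminf h) \<le> (\<Sum>n. B * ((g n - g (Suc n)) / x))"
    using le s1 by (intro norm_suminf_le) (auto simp: sums_iff)
  thus ?thesis using s1 s2 by (simp add: sums_iff g_def x_def)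
qed

text \<open>Counterpart of the tail estimate for the left half of the contour, where the finite
  partial sum itself is estimated.\<close>

lemma norm_dirichlet_head_le:
  fixes a :: "nat \<Rightarrow> complex"
  assumes "\<And>n. norm (a n) \<le> B" "Re z < 0" "N \<ge> 1"
  shows "norm (\<Sum>n<N. a n * of_nat (Suc n) powr (-1-z))
          \<le> B * (real N powr (- Re z) * (1 / (- Re z) + 1 / real N))"
proof -
  have B: "B \<ge> 0" using assms(1)[of 0] norm_ge_zero order_trans by blast
  have "norm (\<Sum>n<N. a n * of_nat (Suc n) powr (-1-z)) \<le> (\<Sum>n<N. B * real (Suc n) powr (- Re z - 1))"
  proof (rule sum_norm_le)
    fix n assume "n \<in> {..<N}"
    have e: "- 1 - Re z = - Re z - 1" by simp
    have "norm (a n * of_nat (Suc n) powr (-1-z)) = norm (a n) * real (Suc n) powr (- Re z - 1)"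
      unfolding norm_mult by (subst norm_powr_real_powr) (simp_all add: e del: of_nat_Suc)
    also have "\<dots> \<le> B * real (Suc n) powr (- Re z - 1)"
      using assms by (intro mult_right_mono) auto
    finally show "norm (a n * of_nat (Suc n) powr (-1-z)) \<le> B * real (Suc n) powr (- Re z - 1)" .
  qed
  also have "\<dots> = B * (\<Sum>n<N. real (Suc n) powr (- Re z - 1))" by (simp add: sum_distrib_left)
  also have "\<dots> \<le> B * (real N powr (- Re z) * (1 / (- Re z) + 1 / real N))"
    using sum_powr_le[of "- Re z" N] assms B by (intro mult_left_mono) auto
  finally show ?thesis .
qed

section \<open>Contour integrals along three sides of a rectangle\<close>

definition cup_edges :: "real \<Rightarrow> real \<Rightarrow> complex set" where
  "cup_edges d R = {z. (Im z = R \<or> Im z = -R) \<and> Re z \<in> closed_segment 0 d} \<union> {z. Re z = d \<and> \<bar>Im z\<bar> \<le> R}"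

text \<open>The side on the imaginary axis is left out, and \<open>d\<close> may have either sign.
  The path always runs from iR to -iR, hence clockwise for d > 0 and counterclockwise for d < 0, so
  a left cup minus a right cup is a positively oriented rectangle around 0. The halves are kept
  apart because they need different estimates.\<close>

definition cup_integral :: "(complex \<Rightarrow> complex) \<Rightarrow> real \<Rightarrow> real \<Rightarrow> complex" where
  "cup_integral f d R = contour_integral (linepath (Complex 0 R) (Complex d R)) f
     + contour_integral (linepath (Complex d R) (Complex d (-R))) f
     + contour_integral (linepath (Complex d (-R)) (Complex 0 (-R))) f"

lemma closed_segment_cup_edges:
  assumes "R > 0"
  shows "closed_segment (Complex 0 R) (Complex d R) \<subseteq> cup_edges d R"
    "closed_segment (Complex d R) (Complex d (-R)) \<subseteq> cup_edges d R"
    "closed_segment (Complex d (-R)) (Complex 0 (-R)) \<subseteq> cup_edges d R"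
  using assms
  by (auto simp: cup_edges_def closed_segment_same_Im closed_segment_same_Re closed_segment_commute
      closed_segment_eq_real_ivl)

lemma norm_cup_integral_le:
  assumes "continuous_on (cup_edges d R) f" "R > 0" "\<And>z. z \<in> cup_edges d R \<Longrightarrow> norm (f z) \<le> c"
  shows "norm (cup_integral f d R) \<le> c * (2 * \<bar>d\<bar> + 2 * R)"
proof -
  note sub = closed_segment_cup_edges[OF assms(2), of d]
  have "norm (f (Complex d R)) \<le> c" using assms(2) by (intro assms(3)) (simp add: cup_edges_def)
  hence c: "c \<ge> 0" using norm_ge_zero order_trans by blast
  have *: "norm (contour_integral (linepath u v) f) \<le> c * norm (v - u)"
    if "closed_segment u v \<subseteq> cup_edges d R" for u v
    using that assms c
    by (intro has_contour_integral_bound_linepath[OF has_contour_integral_integral]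
          contour_integrable_continuous_linepath) (auto intro: continuous_on_subset)
  have n: "norm (Complex d R - Complex 0 R) = \<bar>d\<bar>" "norm (Complex d (-R) - Complex d R) = 2 * R"
     "norm (Complex 0 (-R) - Complex d (-R)) = \<bar>d\<bar>"
    using assms(2) by (auto simp: cmod_def real_sqrt_mult)
  show ?thesis
    unfolding cup_integral_def
    using *[OF sub(1)] *[OF sub(2)] *[OF sub(3)] unfolding n
    by (intro order.trans[OF norm_triangle_ineq] order.trans[OF add_right_mono[OF norm_triangle_ineq]])
       (simp add: algebra_simps)
qed

lemma cup_integral_diff:
  assumes "continuous_on (cup_edges d R) f" "continuous_on (cup_edges d R) g" "R > 0"
  shows "cup_integral (\<lambda>z. f z - g z) d R = cup_integral f d R - cup_integral g d R"
proof -
  note sub = closed_segment_cup_edges[OF assms(3), of d]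
  have *: "contour_integral (linepath u v) (\<lambda>z. f z - g z) =
     contour_integral (linepath u v) f - contour_integral (linepath u v) g"
    if "closed_segment u v \<subseteq> cup_edges d R" for u v
    using that assms
    by (intro contour_integral_diff contour_integrable_continuous_linepath)
       (auto intro: continuous_on_subset)
  show ?thesis unfolding cup_integral_def using sub by (simp add: *)
qed

text \<open>Cauchy's integral formula for the rectangle with corners -d - iR and R + iR, its
  horizontal sides being cut at the imaginary axis.\<close>

lemma cup_Cauchy_formula:
  assumes "d > 0" "R > 0" "convex S" "open S" "f holomorphic_on S"
    and "cbox (Complex (-d) (-R)) (Complex R R) \<subseteq> S"
  shows "cup_integral (\<lambda>z. f z / z) (-d) R - cup_integral (\<lambda>z. f z / z) R R = 2 * pi * \<i> * f 0"
proof -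
  let ?a = "Complex (-d) (-R)" and ?b = "Complex R R"
  let ?g = "\<lambda>z. f z / z"
  have z0: "0 \<in> box ?a ?b" using assms by (auto simp: in_box_complex_iff)
  have im: "path_image (rectpath ?a ?b) \<subseteq> S - {0}"
    using assms path_image_rectpath_cbox_minus_box[of ?a ?b] z0 by auto
  have "((\<lambda>w. f w / (w - 0)) has_contour_integral (2*pi * \<i> * winding_number (rectpath ?a ?b) 0 * f 0)) (rectpath ?a ?b)"
    using assms z0 im box_subset_cbox[of ?a ?b]
    by (intro Cauchy_integral_formula_convex_simple) (auto simp: interior_open)
  hence I: "contour_integral (rectpath ?a ?b) ?g = 2 * pi * \<i> * f 0"
    using winding_number_rectpath[OF z0] by (simp add: contour_integral_unique)
  have ci: "?g contour_integrable_on rectpath ?a ?b"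
    using \<open>((\<lambda>w. f w / (w - 0)) has_contour_integral _) _\<close> by (auto simp: contour_integrable_on_def)
  have cont: "continuous_on (S - {0}) ?g"
    using holomorphic_on_imp_continuous_on[OF assms(5)]
    by (intro continuous_intros) (auto intro: continuous_on_subset)
  have 1: "closed_segment (Complex (-d) (-R)) (Complex R (-R)) \<subseteq> S - {0}"
          "closed_segment (Complex R R) (Complex (-d) R) \<subseteq> S - {0}"
          "closed_segment (Complex R (-R)) (Complex R R) \<subseteq> S - {0}"
          "closed_segment (Complex (-d) R) (Complex (-d) (-R)) \<subseteq> S - {0}"
    using im assms(1,2)
    unfolding rectpath_def Let_def by (simp_all add: path_image_join)
  have c: "continuous_on (closed_segment (Complex (-d) (-R)) (Complex R (-R))) ?g"
          "continuous_on (closed_segment (Complex R R) (Complex (-d) R)) ?g"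
          "continuous_on (closed_segment (Complex R (-R)) (Complex R R)) ?g"
          "continuous_on (closed_segment (Complex (-d) R) (Complex (-d) (-R))) ?g"
    using 1 cont continuous_on_subset by blast+
  have m1: "Complex 0 (-R) \<in> closed_segment (Complex (-d) (-R)) (Complex R (-R))"
    using assms by (auto simp: closed_segment_same_Im closed_segment_eq_real_ivl)
  have m2: "Complex 0 R \<in> closed_segment (Complex R R) (Complex (-d) R)"
    using assms by (auto simp: closed_segment_same_Im closed_segment_eq_real_ivl)
  have r: "contour_integral (linepath (Complex 0 (-R)) (Complex R (-R))) ?g = - contour_integral (linepath (Complex R (-R)) (Complex 0 (-R))) ?g"
    "contour_integral (linepath (Complex R R) (Complex 0 R)) ?g = - contour_integral (linepath (Complex 0 R) (Complex R R)) ?g"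
    "contour_integral (linepath (Complex R (-R)) (Complex R R)) ?g = - contour_integral (linepath (Complex R R) (Complex R (-R))) ?g"
    by (metis contour_integral_reversepath reversepath_linepath valid_path_linepath add.inverse_inverse)+
  have "contour_integral (rectpath ?a ?b) ?g = 
       contour_integral (linepath (Complex (-d) (-R)) (Complex R (-R))) ?g
     + (contour_integral (linepath (Complex R (-R)) (Complex R R)) ?g
     + (contour_integral (linepath (Complex R R) (Complex (-d) R)) ?g
     + contour_integral (linepath (Complex (-d) R) (Complex (-d) (-R))) ?g))"
    using c unfolding rectpath_def Let_def
    by (simp add: contour_integral_join contour_integrable_continuous_linepath valid_path_join)
  also have "contour_integral (linepath (Complex (-d) (-R)) (Complex R (-R))) ?g
     = contour_integral (linepath (Complex (-d) (-R)) (Complex 0 (-R))) ?g + 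
       contour_integral (linepath (Complex 0 (-R)) (Complex R (-R))) ?g"
    by (rule contour_integral_split_linepath[OF c(1) m1])
  also have "contour_integral (linepath (Complex R R) (Complex (-d) R)) ?g
     = contour_integral (linepath (Complex R R) (Complex 0 R)) ?g + 
       contour_integral (linepath (Complex 0 R) (Complex (-d) R)) ?g"
    by (rule contour_integral_split_linepath[OF c(2) m2])
  finally show ?thesis using I r unfolding cup_integral_def by (simp add: algebra_simps)
qed

text \<open>On the boundary of the square with corners \<open>\<plusminus>R \<plusminus> \<i>R\<close>, the factor \<open>(1 + z\<^sup>2/R\<^sup>2) / z\<close> is small where the
  estimates for the Dirichlet series degenerate.\<close>
lemma norm_newman_kernel_le:
  assumes "R > 0" "\<bar>d\<bar> \<le> R" "z \<in> cup_edges d R" "\<bar>Re z\<bar> = R \<or> \<bar>Im z\<bar> = R" 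
  shows "norm ((1 + z\<^sup>2 / of_real (R\<^sup>2)) / z) \<le> 3 * \<bar>Re z\<bar> / R\<^sup>2"
proof -
  have le: "\<bar>Re z\<bar> \<le> R" "\<bar>Im z\<bar> \<le> R"
    using assms by (auto simp: cup_edges_def closed_segment_eq_real_ivl split: if_splits)
  have z: "z \<noteq> 0" using assms by auto
  have nz: "norm z \<ge> R" using assms(4) abs_Re_le_cmod[of z] abs_Im_le_cmod[of z] by linarith
  have nz2: "norm z \<le> \<bar>Re z\<bar> + \<bar>Im z\<bar>" by (rule cmod_le)
  have eq: "norm ((1 + z\<^sup>2 / of_real (R\<^sup>2)) / z) = norm (of_real (R\<^sup>2) + z\<^sup>2) / (R\<^sup>2 * norm z)"
  proof -
    have "(1 + z\<^sup>2 / of_real (R\<^sup>2)) / z = (of_real (R\<^sup>2) + z\<^sup>2) / (of_real (R\<^sup>2) * z)"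
      using assms(1) z by (simp add: field_simps)
    thus ?thesis by (simp only: norm_divide norm_mult norm_of_real) simp
  qed
  have "norm (of_real (R\<^sup>2) + z\<^sup>2) / norm z \<le> 3 * \<bar>Re z\<bar>"
  \<comment> \<open>On the horizontal sides R^2 = (Im z)^2, which makes R^2 + z^2 divisible by Re z.
    On the vertical sides |Re z| = R, and a crude bound already has the required form.\<close>
  proof (cases "\<bar>Im z\<bar> = R")
    case True
    hence R2: "R\<^sup>2 = (Im z)\<^sup>2" by auto
    have "of_real (R\<^sup>2) + z\<^sup>2 = of_real (Re z) * Complex (Re z) (2 * Im z)"
      unfolding R2 by (simp add: complex_eq_iff power2_eq_square)
    hence "norm (of_real (R\<^sup>2) + z\<^sup>2) = \<bar>Re z\<bar> * norm (Complex (Re z) (2 * Im z))"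
      by (simp add: norm_mult)
    also have "norm (Complex (Re z) (2 * Im z)) \<le> 3 * R"
      using cmod_le[of "Complex (Re z) (2 * Im z)"] le by simp
    finally have "norm (of_real (R\<^sup>2) + z\<^sup>2) \<le> \<bar>Re z\<bar> * (3 * R)" by (simp add: mult_left_mono)
    also have "\<dots> \<le> \<bar>Re z\<bar> * (3 * norm z)" using nz by (intro mult_left_mono) auto
    finally show ?thesis using z by (simp add: divide_le_eq)
  next
    case False
    hence R: "\<bar>Re z\<bar> = R" using assms by auto
    have "norm (of_real (R\<^sup>2) + z\<^sup>2) \<le> R\<^sup>2 + (norm z)\<^sup>2"
      by (rule order.trans[OF norm_triangle_ineq]) (simp add: norm_power)
    also have "\<dots> \<le> R * norm z + 2 * R * norm z"
    proof -
      have "R * R \<le> R * norm z" using nz assms(1) by (intro mult_left_mono) auto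
      moreover have "norm z * norm z \<le> (2 * R) * norm z"
        using nz2 le R by (intro mult_right_mono) auto
      ultimately show ?thesis by (simp add: power2_eq_square)
    qed
    finally show ?thesis using z R by (simp add: divide_le_eq)
  qed
  hence "norm (of_real (R\<^sup>2) + z\<^sup>2) / norm z / R\<^sup>2 \<le> 3 * \<bar>Re z\<bar> / R\<^sup>2"
    by (intro divide_right_mono) auto
  thus ?thesis unfolding eq by (simp add: mult.commute)
qed

text \<open>Newman's contour method, with N^z (1 + z^2/R^2)/z as kernel. On the right the difference
  of \<open>G\<close> and the partial sum is the tail, whose bound N^(-Re z)/Re z cancels against
  N^z and the kernel. On the left the two are separated: the partial sum is entire, so its contour
  can be the far side Re z = -R, whereas \<open>G\<close> is only available close to the axis and is
  made small there by the decay of N^z as N grows.\<close>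

lemma newman_tauberian:
  fixes a :: "nat \<Rightarrow> complex"
  assumes bd: "\<And>n. norm (a n) \<le> B"
    and U: "open U" "{z. Re z \<ge> 0} \<subseteq> U" "G holomorphic_on U"
    and sums: "\<And>z. Re z > 0 \<Longrightarrow> (\<lambda>n. a n * of_nat (Suc n) powr (-1-z)) sums G z"
  shows "(\<lambda>n. a n / of_nat (Suc n)) sums G 0"
proof -
  define S where "S = (\<lambda>N z. \<Sum>n<N. a n * of_nat (Suc n) powr (-1-z))"
  have B: "B \<ge> 0" using bd[of 0] norm_ge_zero order_trans by blast
  have key: "eventually (\<lambda>N. 2 * pi * norm (G 0 - S N 0) < \<epsilon>) sequentially" if "\<epsilon> > 0" for \<epsilon>
  proof -
    \<comment> \<open>The tail on the right and the partial sum on the left contribute 12 B/R each;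
      every other error tends to 0 with N for fixed \<open>R\<close>.\<close>
    define R where "R = 24 * B / \<epsilon> + 1"
    have R: "R \<ge> 1" using B that by (simp add: R_def)
    have R': "24 * B / R < \<epsilon>" using B that R by (simp add: R_def field_simps)
    \<comment> \<open>Compactness of this segment gives a uniform width \<open>e\<close> by which
      \<open>G\<close> extends to the left of the axis. The segment is longer than the contour by 1
      at each end, so that the open convex set \<open>V\<close> contains the closed
      rectangle.\<close>
    define L where "L = closed_segment (Complex 0 (-(R+1))) (Complex 0 (R+1))"
    have "L \<subseteq> U" using U by (auto simp: L_def closed_segment_same_Re)
    moreover have "compact L" by (simp add: L_def)
    ultimately obtain e where e: "e > 0" "(\<Union>x\<in>L. cball x e) \<subseteq> U"
      using U(1) compact_subset_open_imp_cball_epsilon_subset by blast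
    define V where "V = {z. Re z > -e} \<inter> {z. Im z < R+1} \<inter> {z. Im z > -(R+1)}"
    have V: "open V" "convex V"
      unfolding V_def
      by (intro open_Int convex_Int open_halfspace_Re_gt open_halfspace_Im_lt open_halfspace_Im_gt
            convex_halfspace_Re_gt convex_halfspace_Im_lt convex_halfspace_Im_gt)+
    have VU: "V \<subseteq> U"
    proof
      fix z assume z: "z \<in> V"
      show "z \<in> U"
      proof (cases "Re z \<ge> 0")
        case False
        have "Complex 0 (Im z) \<in> L" using z R
          by (auto simp: L_def V_def closed_segment_same_Re closed_segment_eq_real_ivl)
        moreover have "dist (Complex 0 (Im z)) z \<le> e"
          using z False by (auto simp: V_def dist_norm cmod_def)
        ultimately show ?thesis using e(2) by (meson UN_I mem_cball subsetD)
      qed (use U in auto)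
    qed
    \<comment> \<open>Less than \<open>e\<close> to stay inside \<open>V\<close>; at most 1, hence
      at most \<open>R\<close>, as the kernel estimate requires.\<close>
    define \<delta> where "\<delta> = min (e/2) 1"
    have \<delta>: "\<delta> > 0" "\<delta> < e" "\<delta> \<le> 1" using e by (auto simp: \<delta>_def)
    have box: "cbox (Complex (-\<delta>) (-R)) (Complex R R) \<subseteq> V"
      using \<delta> R by (auto simp: V_def in_cbox_complex_iff)
    have holV: "G holomorphic_on V" using U VU holomorphic_on_subset by blast
    hence "continuous_on (cbox (Complex (-\<delta>) (-R)) (Complex R R)) G"
      using box continuous_on_subset holomorphic_on_imp_continuous_on by blast
    hence "bounded (G ` cbox (Complex (-\<delta>) (-R)) (Complex R R))"
      by (intro compact_imp_bounded compact_continuous_image) auto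
    then obtain M where M: "M > 0" "\<And>z. z \<in> cbox (Complex (-\<delta>) (-R)) (Complex R R) \<Longrightarrow> norm (G z) \<le> M"
      unfolding bounded_pos by auto
    \<comment> \<open>Bound for the \<open>G\<close> part on the left: the first summand belongs to
      the horizontal sides, where t exp(-t) <= 1 turns N^(Re z) |Re z| into 1/ln N, the second to
      the vertical side Re z = -\<delta>.\<close>
    define c where "c = (\<lambda>N. 3 * M / (R\<^sup>2 * ln (real N)) + (3 * M / \<delta>) * real N powr (-\<delta>))"
    have main: "2 * pi * norm (G 0 - S N 0) \<le> 24 * B / R + 12 * B / real N + c N * (2 * \<delta> + 2 * R)"
      if N: "N \<ge> 2" for N
    proof -
      define P where "P = (\<lambda>z. of_nat N powr z :: complex)"
      define K where "K = (\<lambda>z::complex. (1 + z\<^sup>2 / of_real (R\<^sup>2)) / z)"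
      define fG where "fG = (\<lambda>z. G z * P z * (1 + z\<^sup>2 / of_real (R\<^sup>2)))"
      define fS where "fS = (\<lambda>z. S N z * P z * (1 + z\<^sup>2 / of_real (R\<^sup>2)))"
      have nP: "norm (P z) = real N powr Re z" for z
        using N unfolding P_def by (subst norm_powr_real_powr) auto
      have P0: "P 0 = 1" using N by (simp add: P_def)
      have holP: "P holomorphic_on A" for A
        unfolding P_def using N by (intro holomorphic_intros) auto
      have holS: "S N holomorphic_on A" for A
        unfolding S_def by (intro holomorphic_intros) (auto simp del: of_nat_Suc)
      have 1: "cup_integral (\<lambda>z. fG z / z) (-\<delta>) R - cup_integral (\<lambda>z. fG z / z) R R = 2 * pi * \<i> * fG 0"
        using \<delta> R V box unfolding fG_def
        by (intro cup_Cauchy_formula[where S = V] holomorphic_intros holV holP) auto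
      have 2: "cup_integral (\<lambda>z. fS z / z) (-R) R - cup_integral (\<lambda>z. fS z / z) R R = 2 * pi * \<i> * fS 0"
        using R unfolding fS_def
        by (intro cup_Cauchy_formula[where S = UNIV] holomorphic_intros holS holP) auto
      have sub: "cup_edges R R \<subseteq> V - {0}" "cup_edges (-\<delta>) R \<subseteq> V - {0}" "cup_edges (-R) R \<subseteq> - {0}"
         using \<delta> R by (auto simp: V_def cup_edges_def closed_segment_eq_real_ivl split: if_splits)
      have contG: "continuous_on (V - {0}) (\<lambda>z. fG z / z)"
        unfolding fG_def
        by (intro holomorphic_on_imp_continuous_on holomorphic_intros holP holomorphic_on_subset[OF holV]) auto
      have contS: "continuous_on (- {0}) (\<lambda>z. fS z / z)"
        unfolding fS_def
        by (intro holomorphic_on_imp_continuous_on holomorphic_intros holP holS) auto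
      have cr: "continuous_on (cup_edges R R) (\<lambda>z. fG z / z)" "continuous_on (cup_edges R R) (\<lambda>z. fS z / z)"
        using sub contG contS by (auto intro: continuous_on_subset)
      have "norm (cup_integral (\<lambda>z. fG z / z - fS z / z) R R) \<le> 3 * B / R\<^sup>2 * (2 * \<bar>R\<bar> + 2 * R)"
      proof (rule norm_cup_integral_le)
        fix z assume z: "z \<in> cup_edges R R"
        have x: "Re z \<ge> 0" using z R by (auto simp: cup_edges_def closed_segment_eq_real_ivl)
        have K: "norm (K z) \<le> 3 * \<bar>Re z\<bar> / R\<^sup>2"
          unfolding K_def using z R by (intro norm_newman_kernel_le[of R R]) (auto simp: cup_edges_def)
        have eq: "fG z / z - fS z / z = (G z - S N z) * P z * K z"
          by (simp add: fG_def fS_def K_def diff_divide_distrib algebra_simps)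
        show "norm (fG z / z - fS z / z) \<le> 3 * B / R\<^sup>2"
        \<comment> \<open>At the endpoints on the axis the tail bound is meaningless, but the kernel
          vanishes.\<close>
        proof (cases "Re z = 0")
          case True
          with K have "K z = 0" by simp
          thus ?thesis using B unfolding eq by simp
        next
          case False
          with x have x: "Re z > 0" by simp
          have "norm (fG z / z - fS z / z) = norm (G z - S N z) * (real N powr Re z * norm (K z))"
            unfolding eq by (simp add: norm_mult nP)
          also have "\<dots> \<le> (B * real N powr (- Re z) / Re z) * (real N powr Re z * (3 * \<bar>Re z\<bar> / R\<^sup>2))"
            unfolding S_def using x N B
            by (intro mult_mono norm_dirichlet_tail_le bd sums K) auto
          also have "\<dots> = 3 * B / R\<^sup>2 * (real N powr (- Re z) * real N powr Re z)"
            using x by (simp add: field_simps)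
          also have "\<dots> = 3 * B / R\<^sup>2" using N by (simp flip: powr_add)
          finally show ?thesis .
        qed
      qed (use cr R in \<open>auto intro: continuous_on_diff\<close>)
      also have "\<dots> = 12 * B / R" using R by (simp add: field_simps power2_eq_square)
      finally have b1: "norm (cup_integral (\<lambda>z. fG z / z) R R - cup_integral (\<lambda>z. fS z / z) R R) \<le> 12 * B / R"
        using cr R by (simp add: cup_integral_diff)
      have "norm (cup_integral (\<lambda>z. fS z / z) (-R) R) \<le> 3 * B / R\<^sup>2 * (1 + R / real N) * (2 * \<bar>-R\<bar> + 2 * R)"
      proof (rule norm_cup_integral_le)
        fix z assume z: "z \<in> cup_edges (-R) R"
        have x: "Re z \<le> 0" "\<bar>Re z\<bar> \<le> R" using z R by (auto simp: cup_edges_def closed_segment_eq_real_ivl)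
        have K: "norm (K z) \<le> 3 * \<bar>Re z\<bar> / R\<^sup>2"
          unfolding K_def using z R by (intro norm_newman_kernel_le[of R "-R"]) (auto simp: cup_edges_def)
        have eq: "fS z / z = S N z * P z * K z"
          by (simp add: fS_def K_def)
        show "norm (fS z / z) \<le> 3 * B / R\<^sup>2 * (1 + R / real N)"
        proof (cases "Re z = 0")
          case True
          with K have "K z = 0" by simp
          thus ?thesis using B R unfolding eq by simp
        next
          case False
          with x have x: "Re z < 0" "\<bar>Re z\<bar> \<le> R" by simp_all
          have nn: "0 \<le> B * (real N powr (- Re z) * (1 / (- Re z) + 1 / real N))"
            using x B by (intro mult_nonneg_nonneg add_nonneg_nonneg) auto
          have "norm (fS z / z) = norm (S N z) * (real N powr Re z * norm (K z))"
            unfolding eq by (simp add: norm_mult nP)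
          also have "\<dots> \<le> (B * (real N powr (- Re z) * (1 / (- Re z) + 1 / real N))) * (real N powr Re z * (3 * \<bar>Re z\<bar> / R\<^sup>2))"
            unfolding S_def using x N B
            by (intro mult_mono norm_dirichlet_head_le bd K nn) auto
          also have "\<dots> = 3 * B / R\<^sup>2 * (1 + \<bar>Re z\<bar> / real N) * (real N powr (- Re z) * real N powr Re z)"
            using x N by (simp add: field_simps)
          also have "\<dots> = 3 * B / R\<^sup>2 * (1 + \<bar>Re z\<bar> / real N)" using N by (simp flip: powr_add)
          also have "\<dots> \<le> 3 * B / R\<^sup>2 * (1 + R / real N)"
            using x B by (intro mult_left_mono add_left_mono divide_right_mono) auto
          finally show ?thesis .
        qed
      qed (use sub contS R in \<open>auto intro: continuous_on_subset\<close>)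
      also have "\<dots> = 12 * B / R + 12 * B / real N" using R N by (simp add: field_simps power2_eq_square)
      finally have b2: "norm (cup_integral (\<lambda>z. fS z / z) (-R) R) \<le> 12 * B / R + 12 * B / real N" .
      have b3: "norm (cup_integral (\<lambda>z. fG z / z) (-\<delta>) R) \<le> c N * (2 * \<bar>-\<delta>\<bar> + 2 * R)"
      proof (rule norm_cup_integral_le)
        fix z assume z: "z \<in> cup_edges (-\<delta>) R"
        have x: "Re z \<le> 0" "-\<delta> \<le> Re z" "\<bar>Im z\<bar> \<le> R"
          using z R \<delta> by (auto simp: cup_edges_def closed_segment_eq_real_ivl)
        have GM: "norm (G z) \<le> M"
          using x R by (intro M) (auto simp: in_cbox_complex_iff)
        have eq: "fG z / z = G z * P z * K z"
          by (simp add: fG_def K_def)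
        have lnN: "ln (real N) > 0" using N by simp
        show "norm (fG z / z) \<le> c N"
        proof (cases "\<bar>Im z\<bar> = R")
          case True
          have K: "norm (K z) \<le> 3 * \<bar>Re z\<bar> / R\<^sup>2"
            unfolding K_def using z R \<delta> True by (intro norm_newman_kernel_le[of R "-\<delta>"]) auto
          define t where "t = \<bar>Re z\<bar> * ln (real N)"
          have "t \<le> exp t" using exp_ge_add_one_self[of t] by linarith
          hence "t * exp (-t) \<le> 1" by (simp add: exp_minus field_simps)
          moreover have "real N powr Re z = exp (-t)"
            using N x by (simp add: powr_def t_def)
          ultimately have t: "real N powr Re z * \<bar>Re z\<bar> \<le> 1 / ln (real N)"
            using lnN by (simp add: t_def field_simps)
          have "norm (fG z / z) = norm (G z) * (real N powr Re z * norm (K z))"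
            unfolding eq by (simp add: norm_mult nP)
          also have "\<dots> \<le> M * (real N powr Re z * (3 * \<bar>Re z\<bar> / R\<^sup>2))"
            using M by (intro mult_mono GM K) auto
          also have "\<dots> = 3 * M / R\<^sup>2 * (real N powr Re z * \<bar>Re z\<bar>)" by simp
          also have "\<dots> \<le> 3 * M / R\<^sup>2 * (1 / ln (real N))"
            using M by (intro mult_left_mono t) auto
          also have "\<dots> \<le> c N" using M \<delta> by (simp add: c_def)
          finally show ?thesis .
        next
          case False
          hence x': "Re z = -\<delta>" using z R by (auto simp: cup_edges_def)
          have nz: "norm z \<ge> \<delta>" using abs_Re_le_cmod[of z] x' \<delta> by simp
          have "(norm z)\<^sup>2 \<le> R\<^sup>2 + R\<^sup>2"
            unfolding cmod_power2 using x x' \<delta> R by (intro add_mono power2_le_iff_abs_le[THEN iffD2]) auto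
          hence "norm (1 + z\<^sup>2 / of_real (R\<^sup>2)) \<le> 3"
            using R by (intro order.trans[OF norm_triangle_ineq]) (simp add: norm_divide norm_power field_simps)
          hence "norm (K z) \<le> 3 / \<delta>"
            unfolding K_def norm_divide using nz \<delta> by (intro frac_le) auto
          hence "norm (G z) * (real N powr Re z * norm (K z)) \<le> M * (real N powr Re z * (3 / \<delta>))"
            using M by (intro mult_mono GM) auto
          also have "\<dots> = c N - 3 * M / (R\<^sup>2 * ln (real N))" by (simp add: c_def x' mult_ac)
          also have "\<dots> \<le> c N" using M(1) lnN by simp
          finally show ?thesis unfolding eq by (simp add: norm_mult nP)
        qed
      qed (use sub contG R in \<open>auto intro: continuous_on_subset\<close>)
      have "2 * pi * \<i> * (G 0 - S N 0) = 2 * pi * \<i> * fG 0 - 2 * pi * \<i> * fS 0"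
        by (simp add: fG_def fS_def P0 algebra_simps)
      also have "\<dots> = cup_integral (\<lambda>z. fG z / z) (-\<delta>) R - cup_integral (\<lambda>z. fS z / z) (-R) R
         - (cup_integral (\<lambda>z. fG z / z) R R - cup_integral (\<lambda>z. fS z / z) R R)"
        unfolding 1[symmetric] 2[symmetric] by simp
      also have "norm \<dots> \<le> c N * (2 * \<bar>-\<delta>\<bar> + 2 * R) + (12 * B / R + 12 * B / real N) + 12 * B / R"
        by (rule order.trans[OF norm_triangle_ineq4 add_mono[OF order.trans[OF norm_triangle_ineq4 add_mono[OF b3 b2]] b1]])
      finally show ?thesis using \<delta> by (simp add: norm_mult)
    qed
    have lim: "(\<lambda>N. 24 * B / R + 12 * B / real N + c N * (2 * \<delta> + 2 * R)) \<longlonglongrightarrow> 24 * B / R + 0 + 0 * (2 * \<delta> + 2 * R)"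
    proof (intro tendsto_add tendsto_const tendsto_mult_right)
      show "(\<lambda>N. 12 * B / real N) \<longlonglongrightarrow> 0" by (rule lim_const_over_n)
      have "filterlim (\<lambda>N. R\<^sup>2 * ln (real N)) at_top sequentially"
        using R by (intro filterlim_tendsto_pos_mult_at_top[OF tendsto_const] filterlim_compose[OF ln_at_top] filterlim_real_sequentially) auto
      hence "(\<lambda>N. 3 * M / (R\<^sup>2 * ln (real N))) \<longlonglongrightarrow> 0"
        by (intro real_tendsto_divide_at_top[OF tendsto_const])
      moreover have "(\<lambda>N. real N powr (-\<delta>)) \<longlonglongrightarrow> 0"
        using \<delta> by (intro tendsto_neg_powr filterlim_real_sequentially) auto
      ultimately have "c \<longlonglongrightarrow> 0 + 3 * M / \<delta> * 0"
        unfolding c_def by (intro tendsto_add tendsto_mult tendsto_const)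
      thus "c \<longlonglongrightarrow> 0" by simp
    qed
    have "eventually (\<lambda>N. 24 * B / R + 12 * B / real N + c N * (2 * \<delta> + 2 * R) < \<epsilon>) sequentially"
      by (rule order_tendstoD(2)[OF lim]) (use R' in simp)
    thus ?thesis using eventually_ge_at_top[of 2]
      by eventually_elim (use main in fastforce)
  qed
  have "(\<lambda>N. S N 0) \<longlonglongrightarrow> G 0"
  proof (rule tendstoI)
    fix \<epsilon> :: real assume e: "\<epsilon> > 0"
    have "eventually (\<lambda>N. 2 * pi * norm (G 0 - S N 0) < 2 * pi * \<epsilon>) sequentially"
      using e by (intro key) auto
    thus "eventually (\<lambda>N. dist (S N 0) (G 0) < \<epsilon>) sequentially"
      by eventually_elim (simp add: dist_norm norm_minus_commute)
  qed
  moreover have "S N 0 = (\<Sum>n<N. a n / of_nat (Suc n))" for N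
    unfolding S_def by (intro sum.cong refl) (simp add: powr_minus field_simps del: of_nat_Suc)
  ultimately show ?thesis by (simp add: sums_def)
qed

section \<open>The zeta function on the line of convergence\<close>

text \<open>Weierstrass M-test on small balls. The factor (|s| + 1)^2 is locally bounded and has the
  growth of the Taylor remainders to which the lemma is applied.\<close>

lemma series_right_half_plane:
  fixes f f' :: "nat \<Rightarrow> complex \<Rightarrow> complex"
  assumes der: "\<And>n s. Re s > \<sigma> \<Longrightarrow> (f n has_field_derivative f' n s) (at s)"
    and bd: "\<And>c. c > \<sigma> \<Longrightarrow> \<exists>h. summable h \<and> (\<forall>n s. Re s \<ge> c \<longrightarrow> norm (f n s) \<le> (norm s + 1)\<^sup>2 * h n)"
    and s: "Re s > \<sigma>"
  shows "summable (\<lambda>n. f n s)" "summable (\<lambda>n. f' n s)"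
    "((\<lambda>s. \<Sum>n. f n s) has_field_derivative (\<Sum>n. f' n s)) (at s)"
proof -
  define S where "S = {s. Re s > \<sigma>}"
  have S: "open S" unfolding S_def by (rule open_halfspace_Re_gt)
  have "\<exists>g g'. \<forall>x\<in>S. (\<lambda>n. f n x) sums g x \<and> (\<lambda>n. f' n x) sums g' x \<and> (g has_field_derivative g' x) (at x)"
  proof (rule series_and_derivative_comparison_complex[OF S])
    fix x assume x: "x \<in> S"
    define d where "d = (Re x - \<sigma>) / 2"
    have d: "d > 0" using x by (simp add: d_def S_def)
    obtain h where h: "summable h" "\<And>n s. Re s \<ge> \<sigma> + d \<Longrightarrow> norm (f n s) \<le> (norm s + 1)\<^sup>2 * h n"
      using bd[of "\<sigma> + d"] d by auto
    \<comment> \<open>Not assumed: it follows by evaluating the bound at a real point of the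
      half-plane.\<close>
    have h0: "h n \<ge> 0" for n
    proof -
      have "0 \<le> (norm (complex_of_real (\<sigma> + d)) + 1)\<^sup>2 * h n"
        by (rule order.trans[OF norm_ge_zero h(2)]) simp
      moreover have "0 < (norm (complex_of_real (\<sigma> + d)) + 1)\<^sup>2"
        by (intro zero_less_power) (simp add: add_nonneg_pos)
      ultimately show ?thesis by (simp add: zero_le_mult_iff)
    qed
    define H where "H = (\<lambda>n. complex_of_real ((norm x + d + 1)\<^sup>2 * h n))"
    have "norm (f n y) \<le> norm (H n)" if "y \<in> ball x d" for n y
    proof -
      have "\<bar>Re (x - y)\<bar> < d" using that abs_Re_le_cmod[of "x - y"] by (simp add: dist_norm)
      hence "Re y \<ge> \<sigma> + d" by (simp add: d_def abs_if field_simps split: if_splits)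
      hence "norm (f n y) \<le> (norm y + 1)\<^sup>2 * h n" by (rule h)
      also have "norm y \<le> norm x + d"
        using that norm_triangle_sub[of y x] by (simp add: dist_norm norm_minus_commute)
      hence "(norm y + 1)\<^sup>2 * h n \<le> (norm x + d + 1)\<^sup>2 * h n"
        by (intro mult_right_mono power_mono h0) auto
      also have "\<dots> = norm (H n)" unfolding H_def norm_of_real using h0[of n] by (simp add: abs_mult)
      finally show ?thesis .
    qed
    moreover have "summable H" unfolding H_def by (intro summable_of_real summable_mult h)
    moreover have "range H \<subseteq> \<real>\<^sub>\<ge>\<^sub>0"
      unfolding H_def using h0 by (auto simp del: of_real_mult intro!: mult_nonneg_nonneg)
    ultimately show "\<exists>d H. 0 < d \<and> summable H \<and> range H \<subseteq> \<real>\<^sub>\<ge>\<^sub>0 \<and>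
         (\<forall>\<^sub>F n in sequentially. \<forall>y\<in>ball x d \<inter> S. cmod (f n y) \<le> cmod (H n))"
      using d by (intro exI[of _ d] exI[of _ H]) auto
  qed (use der in \<open>auto simp: S_def\<close>)
  then obtain g g' where g: "\<And>x. x \<in> S \<Longrightarrow> (\<lambda>n. f n x) sums g x" "\<And>x. x \<in> S \<Longrightarrow> (\<lambda>n. f' n x) sums g' x"
    "\<And>x. x \<in> S \<Longrightarrow> (g has_field_derivative g' x) (at x)" by blast
  have sS: "s \<in> S" using s by (simp add: S_def)
  show "summable (\<lambda>n. f n s)" "summable (\<lambda>n. f' n s)" using g sS by (auto simp: sums_iff)
  have "((\<lambda>s. \<Sum>n. f n s) has_field_derivative g' s) (at s)"
    by (rule has_field_derivative_transform_within_open[OF g(3)[OF sS] S sS]) (use g in \<open>auto simp: sums_iff\<close>)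
  thus "((\<lambda>s. \<Sum>n. f n s) has_field_derivative (\<Sum>n. f' n s)) (at s)"
    using g sS by (auto simp: sums_iff)
qed

section \<open>The function (s - 1) zeta(s) on the half-plane Re s > 0\<close>

lemma summable_Suc_powr: "c > 1 \<Longrightarrow> summable (\<lambda>n. real (Suc n) powr (-c))"
  using summable_Suc_iff[of "\<lambda>n. real n powr (-c)"] summable_real_powr_iff[of "-c"] by simp

lemma summable_ln_powr:
  assumes "c > 1"
  shows "summable (\<lambda>n. ln (real (Suc n)) * real (Suc n) powr (-c))"
proof (rule summable_comparison_test)
  define e where "e = (c - 1) / 2"
  have e: "e > 0" "-c + e < -1" using assms by (auto simp: e_def field_simps)
  show "summable (\<lambda>n. (1 / e) * real (Suc n) powr (-(c - e)))"
    using e by (intro summable_mult summable_Suc_powr) auto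
  have "ln (real (Suc n)) * real (Suc n) powr (-c) \<le> (1 / e) * real (Suc n) powr (-(c - e))" for n
  proof -
    have "ln (real (Suc n)) * real (Suc n) powr (-c) \<le> (real (Suc n) powr e / e) * real (Suc n) powr (-c)"
      using e by (intro mult_right_mono ln_powr_bound) auto
    also have "\<dots> = (1 / e) * (real (Suc n) powr e * real (Suc n) powr (-c))" by simp
    also have "real (Suc n) powr e * real (Suc n) powr (-c) = real (Suc n) powr (-(c-e))"
      by (simp flip: powr_add)
    finally show ?thesis .
  qed
  thus "\<exists>N. \<forall>n\<ge>N. norm (ln (real (Suc n)) * real (Suc n) powr (-c)) \<le> (1 / e) * real (Suc n) powr (-(c - e))"
    by (intro exI[of _ 0]) (auto simp: abs_mult)
qed

text \<open>Second-order Taylor remainder of t^(-w) on the interval from n + 1 to n + 2; the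
  hypothesis makes t^(-Re w - 2) decreasing. The gain of two powers of n is what moves convergence
  one unit to the left, for zeta with w = s - 1 and for the psi series with w = s.\<close>

lemma powr_Suc_Taylor_bound:
  fixes w :: complex
  assumes "Re w \<ge> -2"
  shows "norm (of_nat (Suc (Suc n)) powr (-w) - of_nat (Suc n) powr (-w) + w * of_nat (Suc n) powr (-w-1))
     \<le> norm w * norm (w + 1) * real (Suc n) powr (- Re w - 2)"
proof -
  define a b :: complex where "a = of_nat (Suc n)" and "b = of_nat (Suc (Suc n))"
  define f where "f = (\<lambda>i::nat. if i = 0 then (\<lambda>t::complex. t powr (-w))
       else if i = 1 then (\<lambda>t. -w * t powr (-w-1)) else (\<lambda>t. -w * (-w-1) * t powr (-w-1-1)))"
  have seg: "Im t = 0" "Re t \<ge> real (Suc n)" if t: "t \<in> closed_segment a b" for t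
  proof -
    obtain u where u: "0 \<le> u" "t = (1 - u) *\<^sub>R a + u *\<^sub>R b"
      using t by (auto simp: in_segment)
    show "Im t = 0" using u(2) by (simp add: a_def b_def)
    have "Re t = (1 - u) * real (Suc n) + u * real (Suc (Suc n))" unfolding u(2) a_def b_def by simp
    hence "Re t = real (Suc n) + u" by (simp add: algebra_simps)
    thus "Re t \<ge> real (Suc n)" using u(1) by simp
  qed
  have "norm (f 0 b - (\<Sum>i\<le>1. f i a * (b-a) ^ i / fact i))
     \<le> norm w * norm (w + 1) * real (Suc n) powr (- Re w - 2) * norm (b - a) ^ Suc 1 / fact 1"
  proof (rule complex_Taylor)
    fix i x assume x: "x \<in> closed_segment a b" and i: "i \<le> (1::nat)"
    have "x \<notin> \<real>\<^sub>\<le>\<^sub>0" using seg[OF x] by (auto simp: complex_nonpos_Reals_iff)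
    thus "(f i has_field_derivative f (Suc i) x) (at x within closed_segment a b)"
      using i by (cases "i = 0") (auto simp: f_def intro!: derivative_eq_intros)
  next
    fix x assume x: "x \<in> closed_segment a b"
    have e: "- 2 - Re w = - Re w - 2" by simp
    have "norm (x powr (-w-1-1)) = Re x powr (- Re w - 2)"
      using seg[OF x] by (subst norm_powr_real_powr) (auto simp: complex_is_Real_iff e)
    also have "\<dots> \<le> real (Suc n) powr (- Re w - 2)"
      using assms seg[OF x] by (intro powr_mono2') auto
    finally have "norm (-w * (-w-1)) * norm (x powr (-w-1-1)) \<le> norm (-w * (-w-1)) * real (Suc n) powr (- Re w - 2)"
      by (intro mult_left_mono) auto
    moreover have "norm (-w-1) = norm (w+1)"
    proof -
      have "-w-1 = -(w+1)" by simp
      thus ?thesis by (simp only: norm_minus_cancel)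
    qed
    ultimately show "norm (f (Suc 1) x) \<le> norm w * norm (w + 1) * real (Suc n) powr (- Re w - 2)"
      by (simp add: f_def norm_mult)
  qed auto
  moreover have "b - a = 1" by (simp add: a_def b_def)
  moreover from this have "f 0 b - (\<Sum>i\<le>1. f i a * (b - a) ^ i / fact i) = b powr (-w) - a powr (-w) + w * a powr (-w-1)"
    by (simp add: f_def)
  ultimately show ?thesis by (fold a_def b_def) simp
qed

text \<open>For Re s > 1 the last two summands telescope to -1, so the sum over n is (s - 1) zeta(s)
  - 1. Taken together the three summands form a Taylor remainder, and the series converges for Re s
  > 0.\<close>

definition zeta_term :: "nat \<Rightarrow> complex \<Rightarrow> complex" where
  "zeta_term n s = (s - 1) * of_nat (Suc n) powr (-s) - of_nat (Suc n) powr (1-s) + of_nat (Suc (Suc n)) powr (1-s)"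

text \<open>This is (s - 1) zeta(s), with the pole at 1 removed.\<close>

definition zeta_reg :: "complex \<Rightarrow> complex" where
  "zeta_reg s = 1 + (\<Sum>n. zeta_term n s)"

lemma norm_zeta_term_le:
  assumes "Re s > 0"
  shows "norm (zeta_term n s) \<le> norm (s - 1) * norm s * real (Suc n) powr (- Re s - 1)"
proof -
  have "zeta_term n s = of_nat (Suc (Suc n)) powr (-(s-1)) - of_nat (Suc n) powr (-(s-1)) + (s-1) * of_nat (Suc n) powr (-(s-1)-1)"
    by (simp add: zeta_term_def)
  moreover have e: "- Re (s - 1) - 2 = - Re s - 1" "s - 1 + 1 = s" by simp_all
  ultimately show ?thesis using powr_Suc_Taylor_bound[of "s-1" n, unfolded e] assms by (simp only:)
qed

lemma zeta_term_bound:
  assumes "c > 0"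
  shows "\<exists>h. summable h \<and> (\<forall>n s. Re s \<ge> c \<longrightarrow> norm (zeta_term n s) \<le> (norm s + 1)\<^sup>2 * h n)"
proof (intro exI conjI allI impI)
  show "summable (\<lambda>n. real (Suc n) powr (-(1 + c)))" using assms by (intro summable_Suc_powr) auto
  fix n s assume s: "Re s \<ge> c"
  have "norm (zeta_term n s) \<le> norm (s - 1) * norm s * real (Suc n) powr (- Re s - 1)"
    using s assms by (intro norm_zeta_term_le) auto
  also have "\<dots> \<le> ((norm s + 1) * (norm s + 1)) * real (Suc n) powr (-(1 + c))"
    using s norm_triangle_ineq4[of s 1] by (intro mult_mono powr_mono) auto
  finally show "norm (zeta_term n s) \<le> (norm s + 1)\<^sup>2 * real (Suc n) powr (-(1 + c))"
    by (simp add: power2_eq_square)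
qed

lemma zeta_reg_holomorphic: "zeta_reg holomorphic_on {s. Re s > 0}"
proof -
  have "((\<lambda>s. \<Sum>n. zeta_term n s) has_field_derivative (\<Sum>n. deriv (zeta_term n) s)) (at s)" if "Re s > 0" for s
  proof (rule series_right_half_plane[OF _ zeta_term_bound])
    show "(zeta_term n has_field_derivative deriv (zeta_term n) s) (at s)" for n s
    proof (rule holomorphic_derivI[OF _ open_UNIV])
      show "zeta_term n holomorphic_on UNIV" unfolding zeta_term_def
        by (intro holomorphic_intros) (auto simp del: of_nat_Suc)
    qed auto
  qed (use that in auto)
  hence "zeta_reg field_differentiable at s" if "Re s > 0" for s
    unfolding zeta_reg_def using that
    by (intro derivative_intros) (auto simp: field_differentiable_def)
  thus ?thesis by (auto simp: holomorphic_on_def field_differentiable_at_within)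
qed

lemma zeta_reg_1: "zeta_reg 1 = 1"
  by (simp add: zeta_reg_def zeta_term_def del: of_nat_Suc)

lemma norm_Suc_powr: "norm (of_nat (Suc n) powr s :: complex) = real (Suc n) powr Re s"
  by (subst norm_powr_real_powr) auto

lemma zeta_sums:
  assumes "Re s > 1"
  shows "(\<lambda>n. of_nat (Suc n) powr (-s)) sums (zeta_reg s / (s - 1))"
proof -
  have "summable (\<lambda>n. of_nat (Suc n) powr (-s) :: complex)"
    using assms summable_Suc_powr[of "Re s"]
    by (intro summable_norm_cancel[where f = "\<lambda>n. of_nat (Suc n) powr (-s) :: complex"]) (simp only: norm_Suc_powr uminus_complex.sel)
  then obtain Z where Z: "(\<lambda>n. of_nat (Suc n) powr (-s)) sums Z" by (auto simp: summable_def)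
  define g where "g = (\<lambda>n. of_nat (Suc n) powr (1-s) :: complex)"
  have "g \<longlonglongrightarrow> 0"
  proof (rule tendsto_norm_zero_cancel)
    have "(\<lambda>n. real n powr (1 - Re s)) \<longlonglongrightarrow> 0"
      using assms by (intro tendsto_neg_powr filterlim_real_sequentially) auto
    hence "(\<lambda>n. real (Suc n) powr (1 - Re s)) \<longlonglongrightarrow> 0" by (rule LIMSEQ_Suc)
    thus "(\<lambda>n. norm (g n)) \<longlonglongrightarrow> 0" unfolding g_def norm_Suc_powr by simp
  qed
  hence "(\<lambda>n. g n - g (Suc n)) sums (g 0 - 0)" by (rule telescope_sums')
  hence "(\<lambda>n. (s - 1) * of_nat (Suc n) powr (-s) - (g n - g (Suc n))) sums ((s - 1) * Z - (g 0 - 0))"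
    by (rule sums_diff[OF sums_mult[OF Z]])
  moreover have "(\<lambda>n. (s - 1) * of_nat (Suc n) powr (-s) - (g n - g (Suc n))) = (\<lambda>n. zeta_term n s)"
    by (auto simp: zeta_term_def g_def)
  ultimately have "zeta_reg s = (s - 1) * Z"
    by (simp add: zeta_reg_def sums_iff g_def)
  moreover have "s \<noteq> 1" using assms by auto
  ultimately show ?thesis using Z by simp
qed

section \<open>Dirichlet convolution and the von Mangoldt series\<close>

lemma has_sum_from_1:
  fixes f :: "nat \<Rightarrow> complex"
  assumes "(\<lambda>n. f (Suc n)) sums S" "summable (\<lambda>n. norm (f (Suc n)))"
  shows "(f has_sum S) {1..}" "(\<lambda>n. norm (f n)) summable_on {1..}"
proof -
  have b: "bij_betw Suc UNIV {1..}"
    by (rule bij_betwI[of _ _ _ "\<lambda>n. n - 1"]) auto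
  show "(f has_sum S) {1..}"
    using norm_summable_imp_has_sum[OF assms(2,1)] has_sum_reindex_bij_betw[OF b, of f] by simp
  show "(\<lambda>n. norm (f n)) summable_on {1..}"
    using norm_summable_imp_summable_on[of "\<lambda>n. norm (f (Suc n))"] assms(2)
      summable_on_reindex_bij_betw[OF b, of "\<lambda>n. norm (f n)"] by simp
qed

lemma sums_from_1:
  fixes f :: "nat \<Rightarrow> complex"
  assumes "(f has_sum S) {1..}"
  shows "(\<lambda>n. f (Suc n)) sums S"
proof -
  have b: "bij_betw Suc UNIV {1..}"
    by (rule bij_betwI[of _ _ _ "\<lambda>n. n - 1"]) auto
  show ?thesis using has_sum_reindex_bij_betw[OF b, of f] assms by (auto intro: has_sum_imp_sums)
qed

text \<open>Fubini for the absolutely convergent sum over pairs (d, m), regrouped by the product n =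
  d m.\<close>

lemma has_sum_Dirichlet_convolution:
  fixes f g :: "nat \<Rightarrow> complex"
  assumes f: "(f has_sum F) {1..}" "(\<lambda>n. norm (f n)) summable_on {1..}"
    and g: "(g has_sum G) {1..}" "(\<lambda>n. norm (g n)) summable_on {1..}"
  shows "((\<lambda>n. \<Sum>d | d dvd n. f d * g (n div d)) has_sum (F * G)) {1..}"
proof -
  define p where "p = (\<lambda>(d,m). f d * g m)"
  have "(\<lambda>x. norm (p x)) summable_on ({1..} \<times> {1..})"
    unfolding Infinite_Sum.abs_summable_on_Sigma_iff p_def using f g
    by (auto simp: norm_mult infsum_cmult_right abs_mult intro!: summable_on_cmult_right summable_on_cmult_left)
  hence "p summable_on ({1..} \<times> {1..})" by (rule Infinite_Sum.abs_summable_summable)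
  hence "(p has_sum (F * G)) ({1..} \<times> {1..})"
    by (intro has_sum_SigmaI[where g = "\<lambda>d. f d * G"])
       (simp_all only: p_def prod.case has_sum_cmult_right[OF g(1)] has_sum_cmult_left[OF f(1)])
  also have "?this \<longleftrightarrow> ((\<lambda>(n,d). f d * g (n div d)) has_sum (F * G)) (SIGMA n:{1..}. {d. d dvd n})"
    by (rule has_sum_reindex_bij_witness[where i = "\<lambda>(n,d). (d, n div d)" and j = "\<lambda>(d,m). (d * m, d)"])
       (auto simp: p_def Suc_le_eq elim!: dvdE)
  finally show ?thesis
    by (rule has_sum_SigmaD) (auto intro!: has_sum_finiteI)
qed

definition mangoldt_series :: "complex \<Rightarrow> complex" where
  "mangoldt_series s = (\<Sum>n. mangoldt (Suc n) * of_nat (Suc n) powr (-s))"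

lemma mangoldt_bound:
  assumes "c > 1"
  shows "\<exists>h. summable h \<and> (\<forall>n s. Re s \<ge> c \<longrightarrow> norm (mangoldt (Suc n) * of_nat (Suc n) powr (-s) :: complex) \<le> (norm s + 1)\<^sup>2 * h n)"
proof (intro exI conjI allI impI)
  show "summable (\<lambda>n. ln (real (Suc n)) * real (Suc n) powr (-c))" using assms by (intro summable_ln_powr) auto
  fix n s assume s: "Re s \<ge> c"
  have "norm (mangoldt (Suc n) * of_nat (Suc n) powr (-s) :: complex) = mangoldt (Suc n) * real (Suc n) powr (- Re s)"
    by (simp only: norm_mult norm_mangoldt norm_Suc_powr uminus_complex.sel)
  also have "\<dots> \<le> ln (real (Suc n)) * real (Suc n) powr (-c)"
    using s by (intro mult_mono powr_mono mangoldt_le) auto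
  also have "\<dots> \<le> (norm s + 1)\<^sup>2 * (ln (real (Suc n)) * real (Suc n) powr (-c))"
    using mult_right_mono[OF one_le_power[of "norm s + 1" 2], of "ln (real (Suc n)) * real (Suc n) powr (-c)"] by simp
  finally show "norm (mangoldt (Suc n) * of_nat (Suc n) powr (-s) :: complex) \<le> (norm s + 1)\<^sup>2 * (ln (real (Suc n)) * real (Suc n) powr (-c))" .
qed

lemma mangoldt_series:
  assumes "Re s > 1"
  shows "(\<lambda>n. mangoldt (Suc n) * of_nat (Suc n) powr (-s)) sums mangoldt_series s"
    "summable (\<lambda>n. norm (mangoldt (Suc n) * of_nat (Suc n) powr (-s) :: complex))"
    "mangoldt_series field_differentiable at s"
proof -
  have der: "((\<lambda>s. mangoldt (Suc n) * of_nat (Suc n) powr (-s)) has_field_derivative 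
    mangoldt (Suc n) * (Ln (of_nat (Suc n)) * of_nat (Suc n) powr (-s) * -1)) (at s)" for n and s :: complex
    by (intro DERIV_cmult DERIV_chain2[OF has_field_derivative_powr_right DERIV_minus[OF DERIV_ident]])
       (simp del: of_nat_Suc)
  note S = series_right_half_plane[where \<sigma> = 1, OF der mangoldt_bound assms]
  show "(\<lambda>n. mangoldt (Suc n) * of_nat (Suc n) powr (-s)) sums mangoldt_series s"
    unfolding mangoldt_series_def using S(1) by (rule summable_sums)
  show "mangoldt_series field_differentiable at s"
    using S(3) by (auto simp: field_differentiable_def mangoldt_series_def[abs_def])
  have c: "1 < Re s" "Re s \<le> Re s" using assms by auto
  from mangoldt_bound[OF c(1)] obtain h where h: "summable h"
    "\<forall>n s'. Re s \<le> Re s' \<longrightarrow> norm (mangoldt (Suc n) * of_nat (Suc n) powr (-s') :: complex) \<le> (norm s' + 1)\<^sup>2 * h n"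
    by blast
  have "norm (mangoldt (Suc n) * of_nat (Suc n) powr (-s) :: complex) \<le> (norm s + 1)\<^sup>2 * h n" for n
    using h(2) c(2) by blast
  thus "summable (\<lambda>n. norm (mangoldt (Suc n) * of_nat (Suc n) powr (-s) :: complex))"
    by (intro summable_comparison_test'[OF summable_mult[OF h(1)], of 0]) (simp only: real_norm_def abs_norm_cancel)
qed

text \<open>The identity -zeta' = zeta times the von Mangoldt series, from the fact that the values
  of \<open>mangoldt\<close> over the divisors of n add up to ln n, rewritten for zeta =
  \<open>zeta_reg\<close>/(s - 1). It is kept free of division by \<open>zeta_reg\<close>, whose
  non-vanishing is deduced from it.\<close>

lemma mangoldt_series_zeta_reg:
  assumes s: "Re s > 1"
  shows "mangoldt_series s * zeta_reg s = zeta_reg s / (s - 1) - deriv zeta_reg s"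
proof -
  define Z where "Z = (\<lambda>s. \<Sum>n. of_nat (Suc n) powr (-s) :: complex)"
  define L where "L = (\<lambda>n. Ln (of_nat n) * of_nat n powr (-s))"
  have Z: "Z s = zeta_reg s / (s - 1)" if "Re s > 1" for s
    using zeta_sums[OF that] by (simp add: Z_def sums_iff)
  have bound: "\<exists>h. summable h \<and> (\<forall>n s. Re s \<ge> c \<longrightarrow> norm (of_nat (Suc n) powr (-s) :: complex) \<le> (norm s + 1)\<^sup>2 * h n)"
    if "c > 1" for c
  proof (intro exI conjI allI impI)
    show "summable (\<lambda>n. real (Suc n) powr (-c))" using that by (intro summable_Suc_powr) auto
    fix n s assume s: "Re s \<ge> c"
    have "norm (of_nat (Suc n) powr (-s) :: complex) \<le> real (Suc n) powr (-c)"
      unfolding norm_Suc_powr using s by (intro powr_mono) auto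
    also have "\<dots> \<le> (norm s + 1)\<^sup>2 * real (Suc n) powr (-c)"
      using mult_right_mono[OF one_le_power[of "norm s + 1" 2], of "real (Suc n) powr (-c)"] by simp
    finally show "norm (of_nat (Suc n) powr (-s) :: complex) \<le> (norm s + 1)\<^sup>2 * real (Suc n) powr (-c)" .
  qed
  have der: "((\<lambda>s. of_nat (Suc n) powr (-s)) has_field_derivative 
    (Ln (of_nat (Suc n)) * of_nat (Suc n) powr (-s) * -1)) (at s)" for n and s :: complex
    by (intro DERIV_chain2[OF has_field_derivative_powr_right DERIV_minus[OF DERIV_ident]])
       (simp del: of_nat_Suc)
  note S = series_right_half_plane[where \<sigma> = 1, OF der bound s]
  have sm: "summable (\<lambda>n. norm (of_nat (Suc n) powr (-s) :: complex))"
    unfolding norm_Suc_powr using s summable_Suc_powr[of "Re s"] by (simp del: of_nat_Suc)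
  note a = has_sum_from_1[where f = "\<lambda>n. mangoldt n * of_nat n powr (-s)", OF mangoldt_series(1,2)[OF s]]
  note b = has_sum_from_1[where f = "\<lambda>n. of_nat n powr (-s)", OF zeta_sums[OF s] sm]
  have "((\<lambda>n. \<Sum>d | d dvd n. (mangoldt d * of_nat d powr (-s)) * of_nat (n div d) powr (-s))
     has_sum (mangoldt_series s * Z s)) {1..}"
    unfolding Z[OF s] by (rule has_sum_Dirichlet_convolution[OF a b])
  also have "?this \<longleftrightarrow> (L has_sum (mangoldt_series s * Z s)) {1..}"
  proof (rule has_sum_cong)
    fix n :: nat assume n: "n \<in> {1..}"
    have "(\<Sum>d | d dvd n. (mangoldt d * of_nat d powr (-s)) * of_nat (n div d) powr (-s))
      = (\<Sum>d | d dvd n. mangoldt d * of_nat n powr (-s))"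
    proof (intro sum.cong refl)
      fix d assume "d \<in> {d. d dvd n}"
      then obtain m where m: "n = d * m" by auto
      have "of_nat n powr (-s) = of_nat d powr (-s) * (of_nat m powr (-s) :: complex)"
        using powr_times_real[of "of_nat d" "of_nat m" "-s"] by (simp add: m)
      thus "(mangoldt d * of_nat d powr (-s)) * of_nat (n div d) powr (-s) = mangoldt d * of_nat n powr (-s)"
        using n m by auto
    qed
    also have "\<dots> = L n"
      using n mangoldt_sum[of n, where 'a = complex] by (simp add: L_def Ln_of_real flip: sum_distrib_right)
    finally show "(\<Sum>d | d dvd n. (mangoldt d * of_nat d powr (-s)) * of_nat (n div d) powr (-s)) = L n" .
  qed
  finally have "(\<lambda>n. L (Suc n)) sums (mangoldt_series s * Z s)" by (rule sums_from_1)
  hence "(\<lambda>n. L (Suc n) * -1) sums (mangoldt_series s * Z s * -1)" by (rule sums_mult2)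
  hence "(\<Sum>n. (Ln (of_nat (Suc n)) * of_nat (Suc n) powr (-s) * -1)) = - (mangoldt_series s * Z s)"
    by (simp add: L_def sums_iff)
  with S(3) have "(Z has_field_derivative - (mangoldt_series s * Z s)) (at s)" by (simp add: Z_def)
  moreover have s1: "s \<noteq> 1" using s by auto
  have "((\<lambda>s. zeta_reg s / (s - 1)) has_field_derivative 
    (deriv zeta_reg s * (s - 1) - zeta_reg s * 1) / ((s - 1) * (s - 1))) (at s)"
    using s s1
    by (intro DERIV_divide holomorphic_derivI[OF zeta_reg_holomorphic] derivative_eq_intros)
       (auto simp: open_halfspace_Re_gt)
  hence "(Z has_field_derivative (deriv zeta_reg s * (s - 1) - zeta_reg s * 1) / ((s - 1) * (s - 1))) (at s)"
    by (rule has_field_derivative_transform_within_open[where S = "{s. Re s > 1}"])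
       (use s Z in \<open>auto simp: open_halfspace_Re_gt\<close>)
  ultimately have "- (mangoldt_series s * Z s) = (deriv zeta_reg s * (s - 1) - zeta_reg s * 1) / ((s - 1) * (s - 1))"
    by (rule DERIV_unique)
  moreover define u where "u = s - 1"
  ultimately have u: "- (mangoldt_series s * (zeta_reg s / u)) = (deriv zeta_reg s * u - zeta_reg s) / (u * u)" "u \<noteq> 0"
    using s1 unfolding Z[OF s] by simp_all
  have "mangoldt_series s * zeta_reg s = - (- (mangoldt_series s * (zeta_reg s / u)) * u)" using u(2) by simp
  also have "\<dots> = zeta_reg s / u - deriv zeta_reg s" unfolding u(1) using u(2) by (simp add: divide_simps)
  finally show ?thesis by (simp add: u_def)
qed

section \<open>Non-vanishing of zeta for Re s >= 1\<close>

lemma isCont_zeta_reg: "Re s > 0 \<Longrightarrow> isCont zeta_reg s" and isCont_deriv_zeta_reg: "Re s > 0 \<Longrightarrow> isCont (deriv zeta_reg) s"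
proof -
  have o: "open {s. Re s > 0}" by (rule open_halfspace_Re_gt)
  have "deriv zeta_reg holomorphic_on {s. Re s > 0}"
    by (intro holomorphic_deriv zeta_reg_holomorphic o)
  thus "Re s > 0 \<Longrightarrow> isCont zeta_reg s" "Re s > 0 \<Longrightarrow> isCont (deriv zeta_reg) s"
    using zeta_reg_holomorphic o continuous_on_eq_continuous_at holomorphic_on_imp_continuous_on by blast+
qed

text \<open>On the convex set \<open>Re s > 1\<close> the function \<open>(s - 1) \<zeta>(s)\<close> solves a first-order linear differential equation,
  so that a single zero would force it to vanish identically.\<close>
lemma zeta_reg_nonzero_gt_1:
  assumes s: "Re s > 1"
  shows "zeta_reg s \<noteq> 0"
proof
  assume zero: "zeta_reg s = 0"
  define S where "S = {s. Re s > 1}"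
  have S: "open S" "convex S"
    by (auto simp: S_def open_halfspace_Re_gt convex_halfspace_Re_gt)
  define h where "h = (\<lambda>s. 1 / (s - 1) - mangoldt_series s)"
  have "mangoldt_series holomorphic_on S"
    using mangoldt_series(3) by (auto simp: S_def holomorphic_on_def field_differentiable_at_within)
  hence "h holomorphic_on S" unfolding h_def by (intro holomorphic_intros) (auto simp: S_def)
  then obtain H where H: "\<And>x. x \<in> S \<Longrightarrow> (H has_field_derivative h x) (at x within S)"
    using holomorphic_convex_primitive'[OF S(2,1)] by blast
  have dZ: "(zeta_reg has_field_derivative h x * zeta_reg x) (at x within S)" if "x \<in> S" for x
  proof -
    have "(zeta_reg has_field_derivative deriv zeta_reg x) (at x)"
      using that by (intro holomorphic_derivI[OF zeta_reg_holomorphic]) (auto simp: S_def open_halfspace_Re_gt)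
    moreover have "deriv zeta_reg x = h x * zeta_reg x"
      using mangoldt_series_zeta_reg[of x] that by (simp add: h_def S_def algebra_simps)
    ultimately show ?thesis by (simp add: has_field_derivative_at_within)
  qed
  have "((\<lambda>x. zeta_reg x * exp (- H x)) has_field_derivative 0) (at x within S)" if "x \<in> S" for x
    using that by (auto intro!: derivative_eq_intros dZ H)
  hence "\<exists>c. \<forall>x\<in>S. zeta_reg x * exp (- H x) = c"
    by (rule has_field_derivative_zero_constant[OF S(2)])
  then obtain c where c: "\<And>x. x \<in> S \<Longrightarrow> zeta_reg x * exp (- H x) = c"
    by blast
  have "c = 0" using c[of s] zero s by (simp add: S_def)
  hence Z0: "zeta_reg x = 0" if "x \<in> S" for x using c[OF that] by simp
  \<comment> \<open>The point 1 lies on the boundary of \<open>S\<close>; continuity carries the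
    zero value to it, against \<open>zeta_reg 1 = 1\<close>.\<close>
  have "(\<lambda>n. 1 + of_real (inverse (real (Suc n))) :: complex) \<longlonglongrightarrow> 1 + of_real 0"
    by (intro tendsto_intros LIMSEQ_inverse_real_of_nat)
  hence "(\<lambda>n. zeta_reg (1 + of_real (inverse (real (Suc n))))) \<longlonglongrightarrow> zeta_reg 1"
    by (intro isCont_tendsto_compose[OF isCont_zeta_reg]) simp_all
  moreover have "(\<lambda>n. zeta_reg (1 + of_real (inverse (real (Suc n))))) = (\<lambda>_. 0)"
    by (intro ext Z0) (simp add: S_def del: of_nat_Suc)
  ultimately show False by (simp add: zeta_reg_1 LIMSEQ_const_iff)
qed

text \<open>Here \<open>m\<close> is the order of the zero at \<open>s0\<close>, and 0 if there is
  none: near \<open>s0\<close> the function is (w - s0)^m g(w) with g nonzero, so its logarithmic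
  derivative is m/(w - s0) plus a bounded term.\<close>

lemma zeta_reg_logderiv_limit:
  assumes s0: "Re s0 > 0"
  obtains m :: nat where
    "((\<lambda>e. of_real e * (deriv zeta_reg (s0 + of_real e) / zeta_reg (s0 + of_real e))) \<longlongrightarrow> of_nat m) (at_right 0)"
    "zeta_reg s0 = 0 \<Longrightarrow> m > 0"
proof -
  have "\<exists>m::nat. ((\<lambda>w. (w - s0) * (deriv zeta_reg w / zeta_reg w)) \<longlongrightarrow> of_nat m) (at s0) \<and> (zeta_reg s0 = 0 \<longrightarrow> m > 0)"
  proof (cases "zeta_reg s0 = 0")
    case False
    have "((\<lambda>w. (w - s0) * (deriv zeta_reg w / zeta_reg w)) \<longlongrightarrow> (s0 - s0) * (deriv zeta_reg s0 / zeta_reg s0)) (at s0)"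
      using False isCont_zeta_reg[OF s0] isCont_deriv_zeta_reg[OF s0]
      by (intro tendsto_intros) (auto simp: isCont_def)
    thus ?thesis using False by (intro exI[of _ 0]) simp
  next
    case True
    define S where "S = {s. Re s > 0}"
    have S: "open S" "connected S"
      by (auto simp: S_def open_halfspace_Re_gt convex_halfspace_Re_gt intro: convex_connected)
    have sS: "s0 \<in> S" using s0 by (simp add: S_def)
    have nc: "\<not> zeta_reg constant_on S"
    proof
      assume "zeta_reg constant_on S"
      then obtain c where "\<And>x. x \<in> S \<Longrightarrow> zeta_reg x = c" by (auto simp: constant_on_def)
      from this[of 1] this[of s0] show False using True s0 by (simp add: S_def zeta_reg_1)
    qed
    obtain g r n where g: "0 < n" "0 < r" "ball s0 r \<subseteq> S" "g holomorphic_on ball s0 r"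
      "\<And>w. w \<in> ball s0 r \<Longrightarrow> zeta_reg w = (w - s0)^n * g w" "\<And>w. w \<in> ball s0 r \<Longrightarrow> g w \<noteq> 0"
      by (rule holomorphic_factor_zero_nonconstant[OF zeta_reg_holomorphic[folded S_def] S sS True nc])
         (rule that; assumption)
    have dg: "deriv g holomorphic_on ball s0 r" using g by (intro holomorphic_deriv) auto
    have "continuous_on (ball s0 r) (\<lambda>w. of_nat n + (w - s0) * (deriv g w / g w))"
      using g dg by (intro holomorphic_on_imp_continuous_on holomorphic_intros) auto
    hence "isCont (\<lambda>w. of_nat n + (w - s0) * (deriv g w / g w)) s0"
      using g by (simp add: continuous_on_eq_continuous_at)
    hence "((\<lambda>w. of_nat n + (w - s0) * (deriv g w / g w)) \<longlongrightarrow> of_nat n) (at s0)"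
      by (simp add: isCont_def)
    moreover have "eventually (\<lambda>w. (w - s0) * (deriv zeta_reg w / zeta_reg w) = of_nat n + (w - s0) * (deriv g w / g w)) (at s0)"
    proof -
      have "eventually (\<lambda>w. w \<in> ball s0 r - {s0}) (at s0)"
        using g by (intro eventually_at_in_open) auto
      thus ?thesis
      proof eventually_elim
        case (elim w)
        have "((\<lambda>w. (w - s0)^n * g w) has_field_derivative
           of_nat n * (w - s0)^(n-1) * g w + (w - s0)^n * deriv g w) (at w)"
          using elim by (auto intro!: derivative_eq_intros holomorphic_derivI[OF g(4)])
        hence "(zeta_reg has_field_derivative of_nat n * (w - s0)^(n-1) * g w + (w - s0)^n * deriv g w) (at w)"
          by (rule has_field_derivative_transform_within_open[where S = "ball s0 r"]) (use g elim in auto)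
        hence "deriv zeta_reg w = of_nat n * (w - s0)^(n-1) * g w + (w - s0)^n * deriv g w"
          by (rule DERIV_imp_deriv)
        moreover have "zeta_reg w = (w - s0)^n * g w" using g elim by auto
        moreover have "(w - s0)^n = (w - s0) * (w - s0)^(n-1)" using g(1) by (cases n) auto
        moreover have "u * ((N * P * G + u * P * G') / (u * P * G)) = N + u * (G' / G)"
          if "u \<noteq> 0" "P \<noteq> 0" "G \<noteq> 0" for u P G G' N :: complex
          using that by (simp add: divide_simps) (simp add: algebra_simps)
        moreover have "g w \<noteq> 0" "w - s0 \<noteq> 0" using g elim by auto
        ultimately show ?case by simp
      qed
    qed
    ultimately have "((\<lambda>w. (w - s0) * (deriv zeta_reg w / zeta_reg w)) \<longlongrightarrow> of_nat n) (at s0)"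
      by (simp add: tendsto_cong)
    thus ?thesis using g by blast
  qed
  then obtain m :: nat where m: "((\<lambda>w. (w - s0) * (deriv zeta_reg w / zeta_reg w)) \<longlongrightarrow> of_nat m) (at s0)"
    "zeta_reg s0 = 0 \<longrightarrow> m > 0" by blast
  have "filterlim (\<lambda>e. s0 + of_real e) (at s0) (at_right 0)"
  proof (rule filterlim_atI)
    have "((\<lambda>e. s0 + of_real e) \<longlongrightarrow> s0 + of_real 0) (at_right 0)" by (intro tendsto_intros)
    thus "((\<lambda>e. s0 + of_real e) \<longlongrightarrow> s0) (at_right 0)" by simp
    show "eventually (\<lambda>e. s0 + of_real e \<noteq> s0) (at_right (0::real))"
      using eventually_at_right_less[of 0] by eventually_elim auto
  qed
  from filterlim_compose[OF m(1) this] m(2) show ?thesis by (intro that[of m]) auto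
qed

text \<open>Mertens' inequality: each term is a nonnegative multiple of 3 + 4 cos x + cos 2x = 2 (1
  + cos x)^2.\<close>

lemma mangoldt_series_3_4_1:
  assumes "\<sigma> > 1"
  shows "Re (3 * mangoldt_series (of_real \<sigma>) + 4 * mangoldt_series (Complex \<sigma> t) + mangoldt_series (Complex \<sigma> (2 * t))) \<ge> 0"
proof -
  define f where "f = (\<lambda>n t. mangoldt (Suc n) * of_nat (Suc n) powr (- Complex \<sigma> t) :: complex)"
  have f: "(\<lambda>n. f n t) sums mangoldt_series (Complex \<sigma> t)" for t
    unfolding f_def using assms by (intro mangoldt_series) simp
  have A: "(\<lambda>n. Re (3 * f n 0 + 4 * f n t + f n (2 * t))) sums 
    Re (3 * mangoldt_series (Complex \<sigma> 0) + 4 * mangoldt_series (Complex \<sigma> t) + mangoldt_series (Complex \<sigma> (2 * t)))"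
    by (intro sums_Re sums_add sums_mult f)
  have B: "0 \<le> Re (3 * f n 0 + 4 * f n t + f n (2 * t))" for n
  proof -
    define x where "x = t * ln (real (Suc n))"
    have Re: "Re (f n u) = mangoldt (Suc n) * real (Suc n) powr (-\<sigma>) * cos (u * ln (real (Suc n)))" for u
    proof -
      have "of_nat (Suc n) powr (- Complex \<sigma> u) = exp (Complex (-\<sigma> * ln (real (Suc n))) (- u * ln (real (Suc n))))"
        by (simp add: powr_def Ln_of_nat complex_eq_iff Re_exp Im_exp del: of_nat_Suc)
      hence "f n u = of_real (mangoldt (Suc n)) * exp (Complex (-\<sigma> * ln (real (Suc n))) (- u * ln (real (Suc n))))"
        by (simp add: f_def)
      thus ?thesis by (simp add: Re_exp powr_def del: of_nat_Suc of_real_mangoldt)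
    qed
    have "Re (3 * f n 0 + 4 * f n t + f n (2 * t)) = mangoldt (Suc n) * real (Suc n) powr (-\<sigma>) * (3 + 4 * cos x + cos (2 * x))"
      by (simp add: Re x_def algebra_simps del: of_nat_Suc)
    also have "3 + 4 * cos x + cos (2 * x) = 2 * (1 + cos x)\<^sup>2"
      using cos_double_cos[of x] by (simp add: power2_eq_square algebra_simps)
    finally show ?thesis by (simp add: mangoldt_nonneg)
  qed
  have "Re (3 * mangoldt_series (Complex \<sigma> 0) + 4 * mangoldt_series (Complex \<sigma> t) + mangoldt_series (Complex \<sigma> (2 * t))) \<ge> 0"
    by (rule sums_le[OF B sums_zero A])
  thus ?thesis by (simp add: complex_of_real_def)
qed

text \<open>Approach 1 + it from the right by e. After multiplication by e the 3-4-1 combination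
  tends to 3 (1 - m0) - 4 m1 - m2, where the m's are orders of zeros at 1, 1 + it and 1 + 2it. A
  zero at 1 + it gives m1 >= 1 and a negative limit, contradicting Mertens' inequality.\<close>

lemma zeta_reg_nonzero:
  assumes "Re s \<ge> 1"
  shows "zeta_reg s \<noteq> 0"
proof (cases "Re s = 1")
  case False
  thus ?thesis using assms by (intro zeta_reg_nonzero_gt_1) auto
next
  case True
  define t where "t = Im s"
  have s: "s = Complex 1 t" using True by (simp add: t_def complex_eq_iff)
  show ?thesis
  proof
    assume zero: "zeta_reg s = 0"
    have t: "t \<noteq> 0"
    proof
      assume "t = 0"
      hence "s = 1" by (simp add: s complex_eq_iff)
      thus False using zero zeta_reg_1 by simp
    qed
    define D where "D = (\<lambda>\<tau> e. of_real e * mangoldt_series (Complex 1 \<tau> + of_real e))"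
    \<comment> \<open>The von Mangoldt series is 1/(s - 1) minus the logarithmic derivative of
      \<open>zeta_reg\<close>; the pole contributes to the limit only at height 0.\<close>
    have lim: "\<exists>m::nat. (D \<tau> \<longlongrightarrow> (if \<tau> = 0 then 1 else 0) - of_nat m) (at_right 0) \<and> (zeta_reg (Complex 1 \<tau>) = 0 \<longrightarrow> m > 0)" for \<tau>
    proof -
      let ?q = "\<lambda>e. deriv zeta_reg (Complex 1 \<tau> + of_real e) / zeta_reg (Complex 1 \<tau> + of_real e)"
      obtain m :: nat where m: "((\<lambda>e. of_real e * ?q e) \<longlongrightarrow> of_nat m) (at_right 0)"
        "zeta_reg (Complex 1 \<tau>) = 0 \<Longrightarrow> m > 0"
        using zeta_reg_logderiv_limit[of "Complex 1 \<tau>"] by auto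
      have "((\<lambda>e. of_real e / (of_real e + \<i> * of_real \<tau>)) \<longlongrightarrow> (if \<tau> = 0 then 1 else 0)) (at_right 0)"
      proof (cases "\<tau> = 0")
        case True
        have "eventually (\<lambda>e. of_real e / (of_real e + \<i> * of_real \<tau>) = (1::complex)) (at_right 0)"
          using eventually_at_right_less[of 0] by eventually_elim (simp add: True)
        thus ?thesis using True by (simp add: tendsto_eventually)
      next
        case False
        have "((\<lambda>e. of_real e / (of_real e + \<i> * of_real \<tau>)) \<longlongrightarrow> of_real 0 / (of_real 0 + \<i> * of_real \<tau>)) (at_right 0)"
          using False by (intro tendsto_intros) auto
        thus ?thesis using False by simp
      qed
      from tendsto_diff[OF this m(1)]
      have "(D \<tau> \<longlongrightarrow> (if \<tau> = 0 then 1 else 0) - of_nat m) (at_right 0)"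
      proof (rule Lim_transform_eventually)
        show "eventually (\<lambda>e. of_real e / (of_real e + \<i> * of_real \<tau>) - of_real e * ?q e = D \<tau> e) (at_right 0)"
          using eventually_at_right_less[of 0]
        proof eventually_elim
          case (elim e)
          define w where "w = Complex 1 \<tau> + of_real e"
          have w: "Re w > 1" using elim by (simp add: w_def)
          have w1: "w - 1 = of_real e + \<i> * of_real \<tau>" by (simp add: w_def complex_eq_iff)
          have "mangoldt_series w = 1 / (w - 1) - deriv zeta_reg w / zeta_reg w"
            using mangoldt_series_zeta_reg[OF w] zeta_reg_nonzero_gt_1[OF w] by (simp add: field_simps)
          hence "D \<tau> e = of_real e * (1 / (of_real e + \<i> * of_real \<tau>) - deriv zeta_reg w / zeta_reg w)"
            by (simp add: D_def w1 flip: w_def)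
          thus ?case by (simp add: right_diff_distrib flip: w_def)
        qed
      qed
      thus ?thesis using m(2) by blast
    qed
    obtain m0 :: nat where m0: "(D 0 \<longlongrightarrow> 1 - of_nat m0) (at_right 0)" using lim[of 0] by auto
    obtain m1 :: nat where m1: "(D t \<longlongrightarrow> 0 - of_nat m1) (at_right 0)" "m1 > 0" using lim[of t] t zero s by auto
    obtain m2 :: nat where m2: "(D (2 * t) \<longlongrightarrow> 0 - of_nat m2) (at_right 0)" using lim[of "2 * t"] t by auto
    have "((\<lambda>e. Re (3 * D 0 e + 4 * D t e + D (2 * t) e)) \<longlongrightarrow> Re (3 * (1 - of_nat m0) + 4 * (0 - of_nat m1) + (0 - of_nat m2))) (at_right 0)"
      by (intro tendsto_intros m0 m1 m2)
    moreover have "eventually (\<lambda>e. Re (3 * D 0 e + 4 * D t e + D (2 * t) e) \<ge> 0) (at_right 0)"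
      using eventually_at_right_less[of 0]
    proof eventually_elim
      case (elim e)
      have Re: "Re (of_real e * w) = e * Re w" for w by simp
      have eq: "Complex 1 \<tau> + of_real e = Complex (1 + e) \<tau>" for \<tau> by (simp add: complex_eq_iff)
      have "3 * D 0 e + 4 * D t e + D (2 * t) e = of_real e * (3 * mangoldt_series (of_real (1 + e)) + 4 * mangoldt_series (Complex (1 + e) t) + mangoldt_series (Complex (1 + e) (2 * t)))"
        unfolding D_def eq by (simp add: algebra_simps complex_of_real_def)
      thus ?case using mangoldt_series_3_4_1[of "1 + e" t] elim
        by (simp only: Re) (auto intro!: mult_nonneg_nonneg)
    qed
    ultimately have "Re (3 * (1 - of_nat m0) + 4 * (0 - of_nat m1) + (0 - of_nat m2)) \<ge> 0"
      by (intro tendsto_lowerbound[OF _ _ trivial_limit_at_right_real]) auto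
    thus False using m1(2) by simp
  qed
qed

lemma mangoldt_sums:
  assumes "Re s > 1"
  shows "(\<lambda>n. mangoldt (Suc n) * of_nat (Suc n) powr (-s)) sums (1 / (s - 1) - deriv zeta_reg s / zeta_reg s)"
proof -
  have "mangoldt_series s = 1 / (s - 1) - deriv zeta_reg s / zeta_reg s"
    using mangoldt_series_zeta_reg[OF assms] zeta_reg_nonzero[of s] assms by (simp add: field_simps)
  thus ?thesis using mangoldt_series(1)[OF assms] by simp
qed

section \<open>The prime number theorem\<close>

definition chebyshev_psi :: "nat \<Rightarrow> real" where
  "chebyshev_psi n = (\<Sum>k\<in>{1..n}. mangoldt k)"

lemma chebyshev_psi_0 [simp]: "chebyshev_psi 0 = 0"
  and chebyshev_psi_Suc: "chebyshev_psi (Suc n) = chebyshev_psi n + mangoldt (Suc n)"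
  by (simp_all add: chebyshev_psi_def)

lemma chebyshev_psi_nonneg: "chebyshev_psi n \<ge> 0"
  unfolding chebyshev_psi_def by (intro sum_nonneg mangoldt_nonneg)

lemma chebyshev_psi_mono: "m \<le> n \<Longrightarrow> chebyshev_psi m \<le> chebyshev_psi n"
  unfolding chebyshev_psi_def by (intro sum_mono2) (auto simp: mangoldt_nonneg)

section \<open>Chebyshev's upper bound for psi\<close>

lemma card_multiples:
  assumes "d > 0"
  shows "card {k\<in>{1..n}. d dvd k} = n div (d::nat)"
proof -
  have "{k\<in>{1..n}. d dvd k} = (\<lambda>j. d * j) ` {1..n div d}"
    using assms by (auto simp: dvd_def less_eq_div_iff_mult_less_eq mult.commute)
  moreover have "inj_on (\<lambda>j. d * j) {1..n div d}"
    using assms by (auto simp: inj_on_def)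
  ultimately show ?thesis by (simp add: card_image)
qed

text \<open>The range may go beyond \<open>n\<close>, where \<open>n div d = 0\<close>. This lets ln
  (2n)! and ln n! be compared term by term over a common range.\<close>

lemma ln_fact_eq_sum_mangoldt:
  assumes "n \<le> N"
  shows "ln (fact n :: real) = (\<Sum>d\<in>{1..N}. mangoldt d * real (n div d))"
proof -
  have "ln (fact n :: real) = (\<Sum>k\<in>{1..n}. ln (real k))"
    unfolding fact_prod by (simp only: of_nat_prod, subst ln_prod) auto
  also have "\<dots> = (\<Sum>k\<in>{1..n}. \<Sum>d\<in>{d\<in>{1..N}. d dvd k}. mangoldt d)"
  proof (rule sum.cong)
    fix k assume k: "k \<in> {1..n}"
    have "{d. d dvd k} = {d\<in>{1..N}. d dvd k}"
      using k assms by (auto dest: dvd_imp_le intro!: Suc_leI Nat.gr0I)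
    thus "ln (real k) = (\<Sum>d\<in>{d\<in>{1..N}. d dvd k}. mangoldt d)"
      using mangoldt_sum[of k, where 'a = real] k by simp
  qed simp
  also have "\<dots> = (\<Sum>d\<in>{1..N}. \<Sum>k\<in>{k\<in>{1..n}. d dvd k}. mangoldt d)"
    by (rule sum.swap_restrict) auto
  also have "\<dots> = (\<Sum>d\<in>{1..N}. mangoldt d * real (n div d))"
    using card_multiples[of _ n] by (intro sum.cong) (auto simp del: One_nat_def)
  finally show ?thesis .
qed

text \<open>Chebyshev's argument with the binomial coefficient (2n choose n) <= 2^(2n): its
  logarithm is a sum of \<open>mangoldt d\<close> weighted by \<open>2 * n div d\<close> minus twice
  \<open>n div d\<close>, a weight that is never negative and at least 1 for n < d <= 2n.\<close>

lemma chebyshev_psi_double_le: "chebyshev_psi (2 * n) - chebyshev_psi n \<le> 2 * real n * ln 2"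
proof -
  let ?N = "2 * n"
  have "chebyshev_psi (2 * n) - chebyshev_psi n = (\<Sum>d\<in>{1..?N} - {1..n}. mangoldt d)"
    unfolding chebyshev_psi_def by (subst sum_diff) auto
  also have "\<dots> = (\<Sum>d\<in>{1..?N}. if d \<in> {1..n} then 0 else mangoldt d)"
    by (intro sum.mono_neutral_cong_left) auto
  also have "\<dots> \<le> (\<Sum>d\<in>{1..?N}. mangoldt d * (real (?N div d) - 2 * real (n div d)))"
  proof (rule sum_mono)
    fix d assume d: "d \<in> {1..?N}"
    have "2 * (n div d) \<le> ?N div d"
      using d by (simp add: less_eq_div_iff_mult_less_eq)
    hence 1: "real (?N div d) - 2 * real (n div d) \<ge> 0" by linarith
    show "(if d \<in> {1..n} then 0 else mangoldt d) \<le> mangoldt d * (real (?N div d) - 2 * real (n div d))"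
    proof (cases "d \<le> n")
      case False
      hence "n div d = 0" "?N div d \<ge> 1" using d by (auto simp: div_greater_zero_iff Suc_le_eq)
      hence "real (?N div d) - 2 * real (n div d) \<ge> 1" by simp
      thus ?thesis using mult_left_mono[of 1 "real (?N div d) - 2 * real (n div d)" "mangoldt d"] False
        by (simp add: mangoldt_nonneg)
    qed (use d 1 in \<open>simp add: mangoldt_nonneg\<close>)
  qed
  also have "\<dots> = ln (fact ?N) - 2 * ln (fact n)"
    by (simp add: ln_fact_eq_sum_mangoldt[of _ ?N] algebra_simps sum_subtractf sum_distrib_left)
  also have "\<dots> = ln (real (?N choose n))"
    by (simp add: binomial_fact ln_div ln_mult)
  also have "real (?N choose n) \<le> 2 ^ ?N"
    using binomial_le_pow2[of ?N n] by (metis of_nat_le_iff of_nat_numeral of_nat_power)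
  hence "ln (real (?N choose n)) \<le> ln (2 ^ ?N)" by (subst ln_le_cancel_iff) auto
  also have "ln (2 ^ ?N) = 2 * real n * ln (2::real)" by (simp add: ln_realpow)
  finally show ?thesis .
qed

text \<open>Halving. With m = n div 2 and ln 2 <= 1 the doubling estimate gives psi(2m) <= 6m, which
  leaves room for the additional ln n <= n when n is odd.\<close>

lemma chebyshev_psi_le: "chebyshev_psi n \<le> 4 * real n"
proof (induction n rule: less_induct)
  case (less n)
  have ln2: "ln 2 \<le> (1::real)" using ln_add_one_self_le_self[of 1] by simp
  define m where "m = n div 2"
  show ?case
  proof (cases "n = 0")
    case False
    have IH: "chebyshev_psi m \<le> 4 * real m" using False by (intro less) (auto simp: m_def)
    have "2 * real m * ln 2 \<le> 2 * real m" using ln2 mult_left_mono[of "ln 2" 1 "2 * real m"] by simp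
    hence *: "chebyshev_psi (2 * m) \<le> 6 * real m" using IH chebyshev_psi_double_le[of m] by linarith
    show ?thesis
    proof (cases "even n")
      case True
      hence "n = 2 * m" by (simp add: m_def)
      thus ?thesis using * by simp
    next
      case False
      hence n: "n = Suc (2 * m)" by (simp add: m_def)
      have "mangoldt n \<le> ln (real n)" using n by (intro mangoldt_le) auto
      also have "\<dots> \<le> real n" using n by (intro order.trans[OF ln_le_minus_one]) auto
      finally show ?thesis using * n chebyshev_psi_Suc[of "2 * m"] by simp
    qed
  qed simp
qed

section \<open>Convergence of the sum of (psi(n) - n)/n^2\<close>

lemma sum_by_parts_partial_sums:
  fixes b u :: "nat \<Rightarrow> complex"
  shows "(\<Sum>n<N. b n * u n) = (\<Sum>n<N. (\<Sum>k<Suc n. b k) * (u n - u (Suc n))) + (\<Sum>k<N. b k) * u N"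
  by (induction N) (simp_all add: algebra_simps)

definition psi_err :: "nat \<Rightarrow> real" where
  "psi_err n = chebyshev_psi n - real n"

lemma abs_psi_err_le: "\<bar>psi_err n\<bar> \<le> 4 * real n"
  using chebyshev_psi_nonneg[of n] chebyshev_psi_le[of n] by (simp add: psi_err_def abs_if)

lemma sum_mangoldt_minus_1: "(\<Sum>k<n. mangoldt (Suc k) - 1 :: complex) = of_real (psi_err n)"
  by (induction n) (simp_all add: psi_err_def chebyshev_psi_Suc)

text \<open>What has to be added to the summand psi_err (u_n - u_(n+1)) of the summation by parts,
  with u_n = (n+1)^(-s), to obtain s psi_err (n+1)^(-s-1). It is a second-order remainder, so even
  with psi_err = O(n) its series is analytic for Re s > 0.\<close>

definition psi_rem :: "nat \<Rightarrow> complex \<Rightarrow> complex" where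
  "psi_rem n s = of_real (psi_err (Suc n)) * 
     (of_nat (Suc (Suc n)) powr (-s) - of_nat (Suc n) powr (-s) + s * of_nat (Suc n) powr (-s-1))"

lemma psi_rem_bound:
  assumes "c > 0"
  shows "\<exists>h. summable h \<and> (\<forall>n s. Re s \<ge> c \<longrightarrow> norm (psi_rem n s) \<le> (norm s + 1)\<^sup>2 * h n)"
proof (intro exI conjI allI impI)
  show "summable (\<lambda>n. 4 * real (Suc n) powr (-(1 + c)))" using assms by (intro summable_mult summable_Suc_powr) auto
  fix n s assume s: "Re s \<ge> c"
  have "norm (psi_rem n s) \<le> (4 * real (Suc n)) * (norm s * norm (s + 1) * real (Suc n) powr (- Re s - 2))"
    unfolding psi_rem_def norm_mult norm_of_real using s assms
    by (intro mult_mono abs_psi_err_le powr_Suc_Taylor_bound) auto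
  also have "\<dots> = 4 * norm s * norm (s + 1) * (real (Suc n) powr 1 * real (Suc n) powr (- Re s - 2))"
    by simp
  also have "real (Suc n) powr 1 * real (Suc n) powr (- Re s - 2) = real (Suc n) powr (- Re s - 1)"
  proof -
    have e: "- 1 - Re s = - Re s - 1" by simp
    show ?thesis by (subst powr_add[symmetric]) (simp add: e)
  qed
  also have "4 * norm s * norm (s + 1) * real (Suc n) powr (- Re s - 1) \<le> 4 * (norm s + 1) * (norm s + 1) * real (Suc n) powr (-(1 + c))"
    using s norm_triangle_ineq[of s 1] by (intro mult_mono powr_mono) auto
  also have "\<dots> = (norm s + 1)\<^sup>2 * (4 * real (Suc n) powr (-(1 + c)))"
    by (simp only: power2_eq_square mult_ac)
  finally show "norm (psi_rem n s) \<le> (norm s + 1)\<^sup>2 * (4 * real (Suc n) powr (-(1 + c)))" .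
qed

lemma psi_rem_series:
  assumes "Re s > 0"
  shows "summable (\<lambda>n. psi_rem n s)" "(\<lambda>s. \<Sum>n. psi_rem n s) field_differentiable at s"
proof -
  have der: "(psi_rem n has_field_derivative deriv (psi_rem n) s) (at s)" for n s
  proof (rule holomorphic_derivI[OF _ open_UNIV])
    show "psi_rem n holomorphic_on UNIV" unfolding psi_rem_def
      by (intro holomorphic_intros) (auto simp del: of_nat_Suc)
  qed auto
  note S = series_right_half_plane[where \<sigma> = 0, OF der psi_rem_bound assms]
  show "summable (\<lambda>n. psi_rem n s)" by (rule S(1))
  show "(\<lambda>s. \<Sum>n. psi_rem n s) field_differentiable at s"
    using S(3) by (auto simp: field_differentiable_def)
qed

text \<open>Summation by parts of the Dirichlet series with coefficients
  \<open>mangoldt n - 1\<close>. Subtracting 1 subtracts zeta, which cancels the pole at s = 1: it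
  survives only as the quotient (1 - \<open>zeta_reg\<close> s)/(s - 1), with a removable
  singularity.\<close>

lemma psi_err_Dirichlet_sums:
  assumes s: "Re s > 1"
  shows "(\<lambda>n. of_real (psi_err (Suc n)) * of_nat (Suc n) powr (-s-1)) sums
    (((1 - zeta_reg s) / (s - 1) - deriv zeta_reg s / zeta_reg s + (\<Sum>n. psi_rem n s)) / s)"
proof -
  define Q where "Q = (1 - zeta_reg s) / (s - 1) - deriv zeta_reg s / zeta_reg s"
  define u where "u = (\<lambda>n. of_nat (Suc n) powr (-s) :: complex)"
  define b where "b = (\<lambda>n. mangoldt (Suc n) - 1 :: complex)"
  have s1: "s - 1 \<noteq> 0" "s \<noteq> 0" using s by auto
  have "(\<lambda>n. mangoldt (Suc n) * u n - u n) sums (1 / (s - 1) - deriv zeta_reg s / zeta_reg s - zeta_reg s / (s - 1))"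
    unfolding u_def by (intro sums_diff mangoldt_sums zeta_sums s)
  moreover have "1 / (s - 1) - deriv zeta_reg s / zeta_reg s - zeta_reg s / (s - 1) = Q"
    by (simp add: Q_def diff_divide_distrib)
  moreover have "(\<lambda>n. mangoldt (Suc n) * u n - u n) = (\<lambda>n. b n * u n)"
    by (simp add: b_def left_diff_distrib)
  ultimately have "(\<lambda>n. b n * u n) sums Q" by simp
  hence "(\<lambda>N. \<Sum>n<N. b n * u n) \<longlonglongrightarrow> Q" by (simp only: sums_def)
  hence L1: "(\<lambda>N. (\<Sum>n<N. (\<Sum>k<Suc n. b k) * (u n - u (Suc n))) + (\<Sum>k<N. b k) * u N) \<longlonglongrightarrow> Q"
    by (subst (asm) sum_by_parts_partial_sums)
  have L2: "(\<lambda>N. (\<Sum>k<N. b k) * u N) \<longlonglongrightarrow> 0"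
  proof (rule Lim_null_comparison)
    show "eventually (\<lambda>N. norm ((\<Sum>k<N. b k) * u N) \<le> 4 * real (Suc N) powr (1 - Re s)) sequentially"
    proof (intro always_eventually allI)
      fix N
      have "norm ((\<Sum>k<N. b k) * u N) = \<bar>psi_err N\<bar> * real (Suc N) powr (- Re s)"
        unfolding b_def sum_mangoldt_minus_1 u_def norm_mult norm_Suc_powr by simp
      also have "\<dots> \<le> (4 * real (Suc N)) * real (Suc N) powr (- Re s)"
        using abs_psi_err_le[of N] by (intro mult_right_mono) auto
      also have "\<dots> = 4 * (real (Suc N) powr 1 * real (Suc N) powr (- Re s))" by simp
      also have "\<dots> = 4 * real (Suc N) powr (1 - Re s)" by (subst powr_add[symmetric]) simp
      finally show "norm ((\<Sum>k<N. b k) * u N) \<le> 4 * real (Suc N) powr (1 - Re s)" .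
    qed
    have "(\<lambda>n. real n powr (1 - Re s)) \<longlonglongrightarrow> 0"
      using s by (intro tendsto_neg_powr filterlim_real_sequentially) auto
    from tendsto_mult[OF tendsto_const[of 4] LIMSEQ_Suc[OF this]]
    show "(\<lambda>N. 4 * real (Suc N) powr (1 - Re s)) \<longlonglongrightarrow> 0" by simp
  qed
  have 1: "(\<lambda>n. (\<Sum>k<Suc n. b k) * (u n - u (Suc n))) sums Q"
    using tendsto_diff[OF L1 L2] unfolding sums_def by (simp only: add_diff_cancel_right' diff_zero)
  have 2: "(\<lambda>n. psi_rem n s) sums (\<Sum>n. psi_rem n s)"
    using psi_rem_series(1)[of s] s by (intro summable_sums) auto
  have "(\<lambda>n. ((\<Sum>k<Suc n. b k) * (u n - u (Suc n)) + psi_rem n s) / s) sums ((Q + (\<Sum>n. psi_rem n s)) / s)"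
    by (intro sums_divide sums_add 1 2)
  moreover have "((\<Sum>k<Suc n. b k) * (u n - u (Suc n)) + psi_rem n s) / s = of_real (psi_err (Suc n)) * of_nat (Suc n) powr (-s-1)" for n
  proof -
    have "(\<Sum>k<Suc n. b k) = of_real (psi_err (Suc n))" unfolding b_def by (rule sum_mangoldt_minus_1)
    hence "(\<Sum>k<Suc n. b k) * (u n - u (Suc n)) + psi_rem n s = s * (of_real (psi_err (Suc n)) * of_nat (Suc n) powr (-s-1))"
      unfolding psi_rem_def u_def by (simp add: algebra_simps del: of_nat_Suc sum.lessThan_Suc)
    thus ?thesis using s1 by simp
  qed
  ultimately show ?thesis by (simp add: Q_def)
qed

text \<open>Newman's theorem with coefficients psi_err(n)/n, bounded by 4, and G(z) = H(1 + z). The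
  domain of \<open>H\<close> is the part of Re s > 0 where \<open>zeta_reg\<close> does not vanish;
  it contains the closed half-plane Re s >= 1.\<close>

lemma summable_psi_err: "summable (\<lambda>n. psi_err n / (real n)\<^sup>2)"
proof -
  define a :: "nat \<Rightarrow> complex" where "a = (\<lambda>n. of_real (psi_err (Suc n)) / of_nat (Suc n))"
  \<comment> \<open>The quotient (1 - \<open>zeta_reg\<close> s)/(s - 1) with its singularity
    removed, in the shape of a difference quotient at 1; the subtracted value 1 -
    \<open>zeta_reg 1\<close> is 0.\<close>
  define q where "q = (\<lambda>s. if s = 1 then deriv (\<lambda>s. 1 - zeta_reg s) 1 else ((1 - zeta_reg s) - (1 - zeta_reg 1)) / (s - 1))"
  define H where "H = (\<lambda>s. (q s - deriv zeta_reg s / zeta_reg s + (\<Sum>n. psi_rem n s)) / s)"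
  define S where "S = {s. Re s > 0}"
  define T where "T = S \<inter> zeta_reg -` (- {0})"
  have S: "open S" by (simp add: S_def open_halfspace_Re_gt)
  have "continuous_on S zeta_reg"
    unfolding S_def by (intro holomorphic_on_imp_continuous_on zeta_reg_holomorphic)
  hence T: "open T" "T \<subseteq> S"
    unfolding T_def using S by (auto intro!: continuous_open_preimage)
  have q: "q holomorphic_on S"
    unfolding q_def S_def
    by (intro pole_lemma_open holomorphic_intros zeta_reg_holomorphic open_halfspace_Re_gt)
  have dz: "deriv zeta_reg holomorphic_on S"
    unfolding S_def by (intro holomorphic_deriv zeta_reg_holomorphic open_halfspace_Re_gt)
  have e: "(\<lambda>s. \<Sum>n. psi_rem n s) holomorphic_on S"
    using psi_rem_series(2) by (auto simp: S_def holomorphic_on_def field_differentiable_at_within)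
  have H: "H holomorphic_on T"
    unfolding H_def
    by (intro holomorphic_on_divide holomorphic_on_add holomorphic_on_diff holomorphic_on_ident
          holomorphic_on_subset[OF q T(2)] holomorphic_on_subset[OF dz T(2)] holomorphic_on_subset[OF e T(2)]
          holomorphic_on_subset[OF zeta_reg_holomorphic[folded S_def] T(2)])
       (auto simp: T_def S_def)
  define G where "G = (\<lambda>z. H (1 + z))"
  define U where "U = (\<lambda>z. 1 + z) -` T"
  have "(\<lambda>n. a n / of_nat (Suc n)) sums G 0"
  proof (rule newman_tauberian)
    show "norm (a n) \<le> 4" for n
      using abs_psi_err_le[of "Suc n"] by (simp add: a_def norm_divide divide_le_eq del: of_nat_Suc)
    show "open U" unfolding U_def by (intro open_vimage T continuous_intros)
    show "{z. Re z \<ge> 0} \<subseteq> U"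
      using zeta_reg_nonzero by (auto simp: U_def T_def S_def)
    show "G holomorphic_on U"
      unfolding G_def U_def
      by (rule holomorphic_on_compose_gen[OF _ H, unfolded o_def]) (auto intro!: holomorphic_intros)
    fix z :: complex assume z: "Re z > 0"
    define s where "s = 1 + z"
    have s: "Re s > 1" using z by (simp add: s_def)
    hence "q s = (1 - zeta_reg s) / (s - 1)" by (auto simp: q_def zeta_reg_1)
    hence "(\<lambda>n. of_real (psi_err (Suc n)) * of_nat (Suc n) powr (-s-1)) sums H s"
      using psi_err_Dirichlet_sums[OF s] by (simp add: H_def)
    moreover have "of_real (psi_err (Suc n)) * of_nat (Suc n) powr (-s-1) = a n * of_nat (Suc n) powr (-1-z)" for n
    proof -
      have "-s-1 = (-1-z) - 1" by (simp add: s_def)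
      hence "(of_nat (Suc n) :: complex) powr (-s-1) = of_nat (Suc n) powr (-1-z) / of_nat (Suc n)"
        by (simp only: powr_diff) (simp del: of_nat_Suc)
      thus ?thesis by (simp add: a_def)
    qed
    ultimately show "(\<lambda>n. a n * of_nat (Suc n) powr (-1-z)) sums G z" by (simp add: G_def s_def)
  qed
  hence "(\<lambda>n. Re (a n / of_nat (Suc n))) sums Re (G 0)" by (rule sums_Re)
  moreover have "Re (a n / of_nat (Suc n)) = psi_err (Suc n) / (real (Suc n))\<^sup>2" for n
  proof -
    have "a n / of_nat (Suc n) = of_real (psi_err (Suc n) / (real (Suc n))\<^sup>2)"
      by (simp add: a_def power2_eq_square)
    thus ?thesis by (simp only: Re_complex_of_real)
  qed
  ultimately have "summable (\<lambda>n. psi_err (Suc n) / (real (Suc n))\<^sup>2)" by (auto simp: summable_def)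
  thus ?thesis by (subst (asm) summable_Suc_iff)
qed

section \<open>From the convergent sum to psi(n) ~ n\<close>

lemma summable_psi_err_eventually_small:
  assumes "\<eta> > 0"
  obtains M where "\<And>m n. m \<ge> M \<Longrightarrow> \<bar>\<Sum>k\<in>{m..<n}. psi_err k / (real k)\<^sup>2\<bar> < \<eta>"
  using summable_psi_err assms unfolding summable_Cauchy real_norm_def by meson

text \<open>If psi(N) >= (1 + 2e) N, monotonicity of psi keeps psi(k) - k >= e N for N <= k < N + e
  N. This block has at least e N/2 terms, each at least e/(4N), so it exceeds the Cauchy bound
  e^2/8. The condition N >= 2/e ensures that rounding e N down loses at most half.\<close>

lemma psi_err_upper:
  assumes e: "0 < e" "e \<le> 1"
  shows "eventually (\<lambda>N. chebyshev_psi N < (1 + 2 * e) * real N) sequentially"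
proof -
  obtain M where M: "\<And>m n. m \<ge> M \<Longrightarrow> \<bar>\<Sum>k\<in>{m..<n}. psi_err k / (real k)\<^sup>2\<bar> < e\<^sup>2 / 8"
    using summable_psi_err_eventually_small[of "e\<^sup>2 / 8"] e by auto
  have ev: "eventually (\<lambda>N. real N \<ge> 2 / e) sequentially"
    using filterlim_real_sequentially by (auto simp: filterlim_at_top)
  show ?thesis using ev eventually_ge_at_top[of M] eventually_gt_at_top[of 0]
  proof eventually_elim
    case (elim N)
    show ?case
    proof (rule ccontr)
      assume "\<not> ?thesis"
      hence psi: "chebyshev_psi N \<ge> (1 + 2 * e) * real N" by simp
      define m where "m = nat \<lfloor>e * real N\<rfloor>"
      have eN: "e * real N \<ge> 2" using elim e by (simp add: field_simps)
      have m: "real m \<le> e * real N" "real m \<ge> e * real N / 2"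
        using eN unfolding m_def by linarith+
      have tb: "psi_err k / (real k)\<^sup>2 \<ge> e / (4 * real N)" if k: "k \<in> {N..<N+m}" for k
      proof -
        have k': "real N \<le> real k" "real k \<le> real N + e * real N" using k m by auto
        have "psi_err k \<ge> e * real N"
          using chebyshev_psi_mono[of N k] k k' psi by (simp add: psi_err_def algebra_simps)
        moreover have "real k \<le> 2 * real N" using k' e mult_right_mono[of e 1 "real N"] by simp
        hence "(real k)\<^sup>2 \<le> (2 * real N)\<^sup>2" by (intro power_mono) auto
        ultimately have "e * real N / (2 * real N)\<^sup>2 \<le> psi_err k / (real k)\<^sup>2"
          using e elim k' by (intro frac_le) auto
        thus ?thesis using elim by (simp add: power2_eq_square)
      qed
      have "e\<^sup>2 / 8 \<le> real m * (e / (4 * real N))"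
        using mult_right_mono[OF m(2), of "e / (4 * real N)"] e elim by (simp add: power2_eq_square)
      also have "\<dots> = (\<Sum>k\<in>{N..<N+m}. e / (4 * real N))" by simp
      also have "\<dots> \<le> (\<Sum>k\<in>{N..<N+m}. psi_err k / (real k)\<^sup>2)" by (intro sum_mono tb)
      also have "\<dots> < e\<^sup>2 / 8" using M[of N "N + m"] elim by simp
      finally show False by simp
    qed
  qed
qed

text \<open>Mirror image with a block to the left of N. Since e <= 1/2, the block stays above N/2,
  so N >= 2M places it in the Cauchy range.\<close>

lemma psi_err_lower:
  assumes e: "0 < e" "e \<le> 1 / 2"
  shows "eventually (\<lambda>N. chebyshev_psi N > (1 - 2 * e) * real N) sequentially"
proof -
  obtain M where M: "\<And>m n. m \<ge> M \<Longrightarrow> \<bar>\<Sum>k\<in>{m..<n}. psi_err k / (real k)\<^sup>2\<bar> < e\<^sup>2 / 8"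
    using summable_psi_err_eventually_small[of "e\<^sup>2 / 8"] e by auto
  have ev: "eventually (\<lambda>N. real N \<ge> 2 / e) sequentially"
    using filterlim_real_sequentially by (auto simp: filterlim_at_top)
  show ?thesis using ev eventually_ge_at_top[of "2 * M"] eventually_gt_at_top[of 0]
  proof eventually_elim
    case (elim N)
    show ?case
    proof (rule ccontr)
      assume "\<not> ?thesis"
      hence psi: "chebyshev_psi N \<le> (1 - 2 * e) * real N" by simp
      define m where "m = nat \<lfloor>e * real N\<rfloor>"
      have eN: "e * real N \<ge> 2" using elim e by (simp add: field_simps)
      have m: "real m \<le> e * real N" "real m \<ge> e * real N / 2"
        using eN unfolding m_def by linarith+
      have "e * real N \<le> real N / 2" using e mult_right_mono[of e "1/2" "real N"] by simp
      hence mN: "2 * m \<le> N" using m by linarith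
      have tb: "psi_err k / (real k)\<^sup>2 \<le> - (e / real N)" if k: "k \<in> {N-m..<N}" for k
      proof -
        have k': "real k \<le> real N" "real k \<ge> real N - e * real N" "0 < k" using k m mN by auto
        have err: "psi_err k \<le> - (e * real N)"
          using chebyshev_psi_mono[of k N] k k' psi by (simp add: psi_err_def algebra_simps)
        have "(real k)\<^sup>2 \<le> (real N)\<^sup>2" using k' by (intro power_mono) auto
        hence "e * real N / (real N)\<^sup>2 \<le> (- psi_err k) / (real k)\<^sup>2"
          using e elim k' err by (intro frac_le) auto
        thus ?thesis using elim by (simp add: power2_eq_square)
      qed
      have "e\<^sup>2 / 8 \<le> (e * real N / 2) * (e / real N)"
        using e elim by (simp add: power2_eq_square)
      also have "\<dots> \<le> real m * (e / real N)"
        using e m by (intro mult_right_mono) auto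
      also have "\<dots> = - (\<Sum>k\<in>{N-m..<N}. - (e / real N))" using mN by simp
      also have "\<dots> \<le> - (\<Sum>k\<in>{N-m..<N}. psi_err k / (real k)\<^sup>2)" by (intro le_imp_neg_le sum_mono tb)
      also have "\<dots> < e\<^sup>2 / 8" using M[of "N - m" N] elim mN by linarith
      finally show False by simp
    qed
  qed
qed

lemma chebyshev_psi_asymp: "(\<lambda>n. chebyshev_psi n / real n) \<longlonglongrightarrow> 1"
proof (rule LIMSEQ_I)
  fix r :: real assume r: "r > 0"
  define e where "e = min (r / 2) (1 / 2)"
  have e: "0 < e" "e \<le> 1/2" "e \<le> 1" "2 * e \<le> r" using r by (auto simp: e_def)
  have "eventually (\<lambda>n. norm (chebyshev_psi n / real n - 1) < r) sequentially"
    using psi_err_upper[OF e(1,3)] psi_err_lower[OF e(1,2)] eventually_gt_at_top[of 0]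
  proof eventually_elim
    case (elim n)
    have "chebyshev_psi n / real n < 1 + 2 * e" "chebyshev_psi n / real n > 1 - 2 * e"
      using elim by (simp_all add: field_simps)
    thus ?case using e by (simp add: abs_less_iff)
  qed
  thus "\<exists>no. \<forall>n\<ge>no. norm (chebyshev_psi n / real n - 1) < r" by (simp add: eventually_sequentially)
qed

section \<open>From psi to the number of primes\<close>

definition prime_count :: "real \<Rightarrow> real" where
  "prime_count x = real (card {p::nat. prime p \<and> real p \<le> x})"

lemma finite_nat_le_real: "finite {n::nat. real n \<le> x \<and> P n}"
  by (rule finite_subset[of _ "{..nat \<lfloor>x\<rfloor>}"]) (auto simp: le_nat_floor)

lemma prime_count_mono: "x \<le> y \<Longrightarrow> prime_count x \<le> prime_count y"
  unfolding prime_count_def using finite_nat_le_real[of y prime]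
  by (auto intro!: card_mono simp: conj_commute)

lemma prime_count_le: "x \<ge> 0 \<Longrightarrow> prime_count x \<le> x"
proof -
  assume x: "x \<ge> 0"
  have "card {p::nat. prime p \<and> real p \<le> x} \<le> card {1..nat \<lfloor>x\<rfloor>}"
    by (intro card_mono) (auto simp: le_nat_floor Suc_le_eq prime_gt_0_nat)
  thus ?thesis using x unfolding prime_count_def by (simp; linarith)
qed

text \<open>Every prime \<open>p \<le> n\<close> has at most \<open>ln n / ln p\<close> powers up to \<open>n\<close>, so its contribution to
  \<open>\<psi>(n)\<close> is at most \<open>ln n\<close>.\<close>
lemma chebyshev_psi_le_prime_count:
  assumes "n \<ge> 1"
  shows "chebyshev_psi n \<le> prime_count (real n) * ln (real n)"
proof -
  define P where "P = {p. prime p \<and> p \<le> n}"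
  define Q where "Q = {q\<in>{1..n}. primepow q}"
  have fin: "finite P" "finite Q" by (auto simp: P_def Q_def)
  have "chebyshev_psi n = (\<Sum>q\<in>Q. mangoldt q)"
    unfolding chebyshev_psi_def Q_def by (intro sum.mono_neutral_right) (auto simp: mangoldt_def)
  also have "\<dots> = (\<Sum>p\<in>P. \<Sum>q\<in>{q\<in>Q. aprimedivisor q = p}. mangoldt q)"
  proof (rule sum.group[symmetric, OF fin(2,1)])
    show "aprimedivisor ` Q \<subseteq> P"
    proof safe
      fix q assume q: "q \<in> Q"
      hence "q > 1" using primepow_gt_Suc_0[of q] by (auto simp: Q_def)
      thus "aprimedivisor q \<in> P"
        using q prime_aprimedivisor'[of q] aprimedivisor_le_nat[of q] by (auto simp: Q_def P_def)
    qed
  qed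
  also have "\<dots> \<le> (\<Sum>p\<in>P. ln (real n))"
  proof (rule sum_mono)
    fix p assume p: "p \<in> P"
    have p1: "real p > 1" using p prime_gt_1_nat[of p] by (auto simp: P_def)
    define j where "j = nat \<lfloor>ln (real n) / ln (real p)\<rfloor>"
    have "{q\<in>Q. aprimedivisor q = p} \<subseteq> (\<lambda>k. p ^ k) ` {1..j}"
    proof (rule subsetI)
      fix q assume "q \<in> {q\<in>Q. aprimedivisor q = p}"
      hence q: "q \<in> Q" "aprimedivisor q = p" by auto
      obtain p' k where k: "prime p'" "k > 0" "q = p' ^ k" using q(1) by (auto simp: Q_def primepow_def)
      have p': "p' = p" using k q(2) by (simp add: aprimedivisor_prime_power)
      have "real k * ln (real p) = ln (real q)" using k p' p1 by (simp add: ln_realpow)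
      also have "\<dots> \<le> ln (real n)" using q by (auto simp: Q_def)
      finally have "real k \<le> ln (real n) / ln (real p)" using p1 by (simp add: field_simps)
      hence "k \<le> j" by (simp add: j_def le_nat_floor)
      thus "q \<in> (\<lambda>k. p ^ k) ` {1..j}" using k(2,3) p' by (intro image_eqI[of _ _ k]) auto
    qed
    hence "card {q\<in>Q. aprimedivisor q = p} \<le> card ((\<lambda>k. p ^ k) ` {1..j})" by (intro card_mono) auto
    also have "\<dots> \<le> j" using card_image_le[of "{1..j}" "\<lambda>k. p ^ k"] by simp
    finally have c: "card {q\<in>Q. aprimedivisor q = p} \<le> j" .
    have "(\<Sum>q\<in>{q\<in>Q. aprimedivisor q = p}. mangoldt q) = (\<Sum>q\<in>{q\<in>Q. aprimedivisor q = p}. ln (real p))"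
      by (intro sum.cong) (auto simp: mangoldt_def Q_def)
    also have "\<dots> \<le> real j * ln (real p)" using c p1 by (simp add: mult_right_mono)
    also have "real j \<le> ln (real n) / ln (real p)"
      using p1 assms unfolding j_def by (intro of_nat_floor) auto
    hence "real j * ln (real p) \<le> ln (real n)" using p1 by (simp add: field_simps)
    finally show "(\<Sum>q\<in>{q\<in>Q. aprimedivisor q = p}. mangoldt q) \<le> ln (real n)" .
  qed
  also have "\<dots> = prime_count (real n) * ln (real n)"
    by (simp add: prime_count_def P_def)
  finally show ?thesis .
qed

text \<open>Primes up to x^(1-d) are counted trivially; each larger one contributes at least (1 - d)
  ln x to psi.\<close>

lemma prime_count_le_chebyshev_psi:
  assumes x: "x > 1" and d: "0 < d" "d < 1"
  shows "prime_count x \<le> x powr (1 - d) + chebyshev_psi (nat \<lfloor>x\<rfloor>) / ((1 - d) * ln x)"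
proof -
  define P where "P = {p::nat. prime p \<and> real p \<le> x \<and> real p > x powr (1 - d)}"
  have fin: "finite P" using finite_nat_le_real[of x "\<lambda>p. prime p \<and> real p > x powr (1 - d)"]
    by (simp add: P_def conj_ac)
  have "{p::nat. prime p \<and> real p \<le> x} \<subseteq> {p. prime p \<and> real p \<le> x powr (1 - d)} \<union> P"
    by (auto simp: P_def)
  hence "card {p::nat. prime p \<and> real p \<le> x} \<le> card ({p. prime p \<and> real p \<le> x powr (1 - d)} \<union> P)"
    using fin finite_nat_le_real[of "x powr (1 - d)" prime] by (intro card_mono) (auto simp: conj_commute)
  also have "\<dots> \<le> card {p::nat. prime p \<and> real p \<le> x powr (1 - d)} + card P" by (rule card_Un_le)
  finally have "prime_count x \<le> prime_count (x powr (1 - d)) + real (card P)"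
    by (simp add: prime_count_def)
  also have "prime_count (x powr (1 - d)) \<le> x powr (1 - d)" by (intro prime_count_le) auto
  also have "real (card P) * ((1 - d) * ln x) \<le> chebyshev_psi (nat \<lfloor>x\<rfloor>)"
  proof -
    have "real (card P) * ((1 - d) * ln x) = (\<Sum>p\<in>P. (1 - d) * ln x)" by simp
    also have "\<dots> \<le> (\<Sum>p\<in>P. mangoldt p)"
    proof (rule sum_mono)
      fix p assume p: "p \<in> P"
      have "(1 - d) * ln x = ln (x powr (1 - d))" using x by (simp add: ln_powr)
      also have "\<dots> \<le> ln (real p)" using p x prime_gt_0_nat[of p] by (subst ln_le_cancel_iff) (auto simp: P_def)
      finally show "(1 - d) * ln x \<le> mangoldt p" using p by (simp add: P_def)
    qed
    also have "\<dots> \<le> chebyshev_psi (nat \<lfloor>x\<rfloor>)"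
      unfolding chebyshev_psi_def
      by (intro sum_mono2) (auto simp: P_def le_nat_floor mangoldt_nonneg Suc_le_eq prime_gt_0_nat)
    finally show ?thesis .
  qed
  hence "real (card P) \<le> chebyshev_psi (nat \<lfloor>x\<rfloor>) / ((1 - d) * ln x)"
    using x d by (simp add: pos_le_divide_eq)
  finally show ?thesis by simp
qed

theorem prime_number_theorem: "((\<lambda>x. prime_count x * ln x / x) \<longlongrightarrow> 1) at_top"
proof -
  define f where "f = (\<lambda>x. chebyshev_psi (nat \<lfloor>x\<rfloor>) / x)"
  have f: "(f \<longlongrightarrow> 1) at_top"
  proof -
    have fl: "filterlim (\<lambda>x::real. nat \<lfloor>x\<rfloor>) sequentially at_top" by real_asymp
    have "((\<lambda>x::real. real (nat \<lfloor>x\<rfloor>) / x) \<longlongrightarrow> 1) at_top" by real_asymp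
    from tendsto_mult[OF filterlim_compose[OF chebyshev_psi_asymp fl] this]
    have "((\<lambda>x. chebyshev_psi (nat \<lfloor>x\<rfloor>) / real (nat \<lfloor>x\<rfloor>) * (real (nat \<lfloor>x\<rfloor>) / x)) \<longlongrightarrow> 1) at_top"
      by simp
    moreover have "eventually (\<lambda>x::real. chebyshev_psi (nat \<lfloor>x\<rfloor>) / real (nat \<lfloor>x\<rfloor>) * (real (nat \<lfloor>x\<rfloor>) / x) = f x) at_top"
      using eventually_ge_at_top[of 1] by eventually_elim (simp add: f_def)
    ultimately show ?thesis by (rule Lim_transform_eventually)
  qed
  have lower: "eventually (\<lambda>x. f x \<le> prime_count x * ln x / x) at_top"
    using eventually_ge_at_top[of 1]
  proof eventually_elim
    case (elim x)
    define n where "n = nat \<lfloor>x\<rfloor>"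
    have n: "n \<ge> 1" "real n \<le> x" using elim by (auto simp: n_def le_nat_floor)
    have "chebyshev_psi n \<le> prime_count (real n) * ln (real n)" by (rule chebyshev_psi_le_prime_count) fact
    also have "\<dots> \<le> prime_count x * ln x"
      using n elim by (intro mult_mono prime_count_mono) (auto simp: prime_count_def)
    finally show ?case using elim by (simp add: f_def n_def divide_right_mono)
  qed
  show ?thesis
  proof (rule tendstoI)
    fix \<epsilon> :: real assume e: "\<epsilon> > 0"
    \<comment> \<open>For d <= 1/2 one has 1/(1 - d) <= 1 + 2d, which is below 1 +
      \<epsilon>.\<close>
    define d where "d = min (1/2) (\<epsilon> / 4)"
    have d: "0 < d" "d < 1" "1 / (1 - d) < 1 + \<epsilon>"
      using e by (auto simp: d_def min_def field_simps)
    have "((\<lambda>x. x powr (-d) * ln x + f x / (1 - d)) \<longlongrightarrow> 0 + 1 / (1 - d)) at_top"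
    proof (intro tendsto_add tendsto_divide f tendsto_const)
      show "((\<lambda>x. x powr (-d) * ln x) \<longlongrightarrow> 0) at_top" using d by real_asymp
    qed (use d in auto)
    from order_tendstoD(2)[OF this, of "1 + \<epsilon>"] d
    have 1: "eventually (\<lambda>x. x powr (-d) * ln x + f x / (1 - d) < 1 + \<epsilon>) at_top" by simp
    have 2: "eventually (\<lambda>x. f x > 1 - \<epsilon>) at_top" using order_tendstoD(1)[OF f, of "1 - \<epsilon>"] e by simp
    show "eventually (\<lambda>x. dist (prime_count x * ln x / x) 1 < \<epsilon>) at_top"
      using 1 2 lower eventually_gt_at_top[of 1]
    proof eventually_elim
      case (elim x)
      have "prime_count x * ln x / x \<le> (x powr (1 - d) + chebyshev_psi (nat \<lfloor>x\<rfloor>) / ((1 - d) * ln x)) * ln x / x"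
        using elim d by (intro divide_right_mono mult_right_mono prime_count_le_chebyshev_psi) auto
      also have "\<dots> = x powr (1 - d) / x * ln x + f x / (1 - d)"
        using elim d by (simp add: f_def field_simps)
      also have "x powr (1 - d) / x = x powr (-d)"
        using elim by (simp add: powr_diff powr_minus field_simps)
      finally show ?case using elim by (simp add: dist_real_def abs_less_iff)
    qed
  qed
qed

section \<open>Products of a fixed number of primes\<close>

definition regularly_varying :: "(real \<Rightarrow> real) \<Rightarrow> bool" where
  "regularly_varying f \<longleftrightarrow> eventually (\<lambda>x. f x > 0) at_top \<and>
     (\<forall>c>0. ((\<lambda>x. f (c * x) / f x) \<longlongrightarrow> c) at_top)"

lemma filterlim_mult_const_at_top: "c > 0 \<Longrightarrow> filterlim (\<lambda>x::real. c * x) at_top at_top"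
  by (intro filterlim_tendsto_pos_mult_at_top[OF tendsto_const] filterlim_ident)

lemma regularly_varying_asymp:
  assumes "regularly_varying f" "((\<lambda>x. g x / f x) \<longlongrightarrow> a) at_top" "a > 0"
  shows "regularly_varying g"
  unfolding regularly_varying_def
proof (intro conjI allI impI)
  have f: "eventually (\<lambda>x. f x > 0) at_top" using assms(1) by (simp add: regularly_varying_def)
  have r: "eventually (\<lambda>x. g x / f x > 0) at_top" using order_tendstoD(1)[OF assms(2), of 0] assms(3) by simp
  show g: "eventually (\<lambda>x. g x > 0) at_top"
    using f r by eventually_elim (simp add: zero_less_divide_iff)
  fix c :: real assume c: "c > 0"
  note lim = filterlim_mult_const_at_top[OF c]
  have 1: "((\<lambda>x. f (c * x) / f x) \<longlongrightarrow> c) at_top" using assms(1) c by (simp add: regularly_varying_def)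
  have "((\<lambda>x. (g (c * x) / f (c * x)) / (g x / f x) * (f (c * x) / f x)) \<longlongrightarrow> (a / a) * c) at_top"
    using assms(3) by (intro tendsto_mult tendsto_divide filterlim_compose[OF assms(2) lim] assms(2) 1) auto
  moreover have "eventually (\<lambda>x. (g (c * x) / f (c * x)) / (g x / f x) * (f (c * x) / f x) = g (c * x) / g x) at_top"
    using f eventually_compose_filterlim[OF f lim] by eventually_elim (simp add: field_simps)
  ultimately show "((\<lambda>x. g (c * x) / g x) \<longlongrightarrow> c) at_top"
    using assms(3) by (auto intro: Lim_transform_eventually)
qed

lemma regularly_varying_prime_count: "regularly_varying prime_count"
  unfolding regularly_varying_def
proof (intro conjI allI impI)
  define f where "f = (\<lambda>x. prime_count x * ln x / x)"
  have f: "(f \<longlongrightarrow> 1) at_top" unfolding f_def by (rule prime_number_theorem)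
  have r: "eventually (\<lambda>x. f x > 0) at_top" using order_tendstoD(1)[OF f, of 0] by simp
  show pos: "eventually (\<lambda>x. prime_count x > 0) at_top"
    using r eventually_gt_at_top[of 1]
  proof eventually_elim
    case (elim x)
    have "prime_count x \<noteq> 0" using elim by (auto simp: f_def)
    moreover have "prime_count x \<ge> 0" by (simp add: prime_count_def)
    ultimately show ?case by simp
  qed
  fix c :: real assume c: "c > 0"
  note lim = filterlim_mult_const_at_top[OF c]
  have l: "((\<lambda>x. ln x / ln (c * x)) \<longlongrightarrow> 1) at_top" using c by real_asymp
  have "((\<lambda>x. f (c * x) / f x * (c * (ln x / ln (c * x)))) \<longlongrightarrow> 1 / 1 * (c * 1)) at_top"
    by (intro tendsto_mult tendsto_divide filterlim_compose[OF f lim] f l tendsto_const) auto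
  moreover have "eventually (\<lambda>x. f (c * x) / f x * (c * (ln x / ln (c * x))) = prime_count (c * x) / prime_count x) at_top"
    using eventually_gt_at_top[of 1] eventually_compose_filterlim[OF eventually_gt_at_top[of 1] lim]
    by eventually_elim (use c in \<open>simp add: f_def field_simps\<close>)
  ultimately show "((\<lambda>x. prime_count (c * x) / prime_count x) \<longlongrightarrow> c) at_top"
    by (auto intro: Lim_transform_eventually)
qed

lemma prime_count_at_top: "filterlim prime_count at_top at_top"
proof -
  have "filterlim (\<lambda>x::real. x / ln x) at_top at_top" by real_asymp
  from filterlim_tendsto_pos_mult_at_top[OF prime_number_theorem _ this]
  have "filterlim (\<lambda>x. prime_count x * ln x / x * (x / ln x)) at_top at_top" by simp
  moreover have "eventually (\<lambda>x. prime_count x * ln x / x * (x / ln x) = prime_count x) at_top"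
    using eventually_gt_at_top[of 1] by eventually_elim simp
  ultimately show ?thesis by (simp cong: filterlim_cong)
qed

text \<open>Regular variation and the prime number theorem give pi(2x) - pi(x) >= x/(4 ln x). The
  dyadic block from 2^j to 2^(j+1) therefore contributes at least 1/(8 j ln 2), and the harmonic
  series diverges.\<close>

lemma not_summable_prime_reciprocals:
  "\<not> summable (\<lambda>n. if prime n then 1 / real n else 0)"
proof
  define f :: "nat \<Rightarrow> real" where "f = (\<lambda>n. if prime n then 1 / real n else 0)"
  assume "summable (\<lambda>n. if prime n then 1 / real n else 0)"
  hence f: "summable f" by (simp add: f_def)
  have f0: "f n \<ge> 0" for n by (simp add: f_def)
  define b where "b = (\<lambda>j::nat. \<Sum>n\<in>{2^j<..2^Suc j}. f n)"
  have "summable b"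
  proof (rule summableI_nonneg_bounded)
    show "b j \<ge> 0" for j unfolding b_def by (intro sum_nonneg f0)
    fix J
    have "(\<Sum>j<J. b j) = (\<Sum>n\<in>{1<..2^J}. f n)"
    proof (induction J)
      case (Suc J)
      have "{1<..(2::nat)^Suc J} = {1<..2^J} \<union> {2^J<..2^Suc J}" by auto
      moreover have "{1<..(2::nat)^J} \<inter> {2^J<..2^Suc J} = {}" by auto
      ultimately show ?case using Suc by (simp add: sum.union_disjoint b_def)
    qed simp
    also have "\<dots> \<le> suminf f" by (intro sum_le_suminf f f0) auto
    finally show "(\<Sum>j<J. b j) \<le> suminf f" .
  qed
  have lim: "filterlim (\<lambda>j::nat. (2::real) ^ j) at_top sequentially" by real_asymp
  have "((\<lambda>x. prime_count (2 * x) / prime_count x) \<longlongrightarrow> 2) at_top"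
    using regularly_varying_prime_count by (simp add: regularly_varying_def)
  hence "eventually (\<lambda>x. prime_count (2 * x) / prime_count x > 3 / 2) at_top"
    by (rule order_tendstoD) simp
  moreover have "eventually (\<lambda>x. prime_count x * ln x / x > 1 / 2) at_top"
    by (rule order_tendstoD(1)[OF prime_number_theorem]) simp
  ultimately have "eventually (\<lambda>x. prime_count (2 * x) - prime_count x \<ge> x / (4 * ln x)) at_top"
    using eventually_gt_at_top[of 1]
  proof eventually_elim
    case (elim x)
    have "prime_count x > x / (2 * ln x)" using elim by (simp add: field_simps)
    moreover have "x / (2 * ln x) > 0" using elim by simp
    ultimately have pos: "prime_count x > 0" by linarith
    have "prime_count (2 * x) > 3 / 2 * prime_count x" using elim pos by (simp add: field_simps)
    with \<open>prime_count x > x / (2 * ln x)\<close> show ?case by simp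
  qed
  from eventually_compose_filterlim[OF this lim]
  have "eventually (\<lambda>j. norm (inverse (real j) * (1 / (8 * ln 2))) \<le> b j) sequentially"
    using eventually_gt_at_top[of 0]
  proof eventually_elim
    case (elim j)
    let ?Q = "{p\<in>{2^j<..2^Suc j::nat}. prime p}"
    let ?P = "\<lambda>y::real. {p::nat. prime p \<and> real p \<le> y}"
    have "(2::real)^j \<le> 2 * 2^j" by simp
    hence "?P (2^j) \<subseteq> ?P (2 * 2^j)" by (blast intro: order_trans)
    hence "prime_count (2 * 2^j) - prime_count (2^j) = real (card (?P (2 * 2^j) - ?P (2^j)))"
      unfolding prime_count_def using finite_nat_le_real[of "2 * 2^j" prime] finite_nat_le_real[of "2^j" prime]
      by (subst card_Diff_subset) (auto simp: conj_commute of_nat_diff card_mono)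
    also have "?P (2 * 2^j) - ?P (2^j) = ?Q"
    proof -
      have "real p \<le> 2^i \<longleftrightarrow> p \<le> 2^i" for p i :: nat by (rule of_nat_le_numeral_power_cancel_iff)
      from this[of _ j] this[of _ "Suc j"] show ?thesis by (auto simp: not_le)
    qed
    finally have "(2^j / (4 * ln (2^j))) / 2^Suc j \<le> real (card ?Q) / 2^Suc j"
      using elim by (intro divide_right_mono) auto
    also have "\<dots> = (\<Sum>p\<in>?Q. 1 / 2^Suc j)" by simp
    also have "\<dots> \<le> (\<Sum>p\<in>?Q. f p)"
    proof (rule sum_mono)
      fix p assume p: "p \<in> ?Q"
      hence "real p \<le> 2 ^ Suc j" by (subst of_nat_le_numeral_power_cancel_iff) simp
      thus "1 / 2 ^ Suc j \<le> f p" using p prime_gt_0_nat[of p] by (auto simp: f_def intro!: divide_left_mono)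
    qed
    also have "\<dots> \<le> b j" unfolding b_def by (intro sum_mono2) (auto simp: f0)
    also have "(2^j / (4 * ln (2^j))) / 2^Suc j = inverse (real j) * (1 / (8 * ln (2::real)))"
      using elim by (simp add: ln_realpow field_simps)
    finally show ?case using elim by simp
  qed
  from summable_comparison_test_ev[OF this \<open>summable b\<close>]
  have "summable (\<lambda>j. inverse (real j) * (1 / (8 * ln 2)))" .
  hence "summable (\<lambda>j. inverse (real j) * (1 / (8 * ln 2)) * (8 * ln 2))" by (rule summable_mult2)
  hence "summable (\<lambda>j. inverse (real j))" by simp
  thus False using not_summable_harmonic[where 'a = real] by simp
qed

lemma prime_reciprocals_unbounded:
  obtains P :: "nat set" where "finite P" "\<And>p. p \<in> P \<Longrightarrow> prime p" "(\<Sum>p\<in>P. 1 / real p) > K"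
proof -
  define f :: "nat \<Rightarrow> real" where "f = (\<lambda>n. if prime n then 1 / real n else 0)"
  have "\<exists>N. (\<Sum>n<N. f n) > K"
  proof (rule ccontr)
    assume "\<not> ?thesis"
    hence "summable f" by (intro summableI_nonneg_bounded[of f K]) (auto simp: f_def not_less)
    thus False using not_summable_prime_reciprocals by (simp add: f_def)
  qed
  then obtain N where N: "(\<Sum>n<N. f n) > K" by blast
  moreover have "(\<Sum>n<N. f n) = (\<Sum>p\<in>{p\<in>{..<N}. prime p}. 1 / real p)"
    unfolding f_def by (intro sum.mono_neutral_cong_right) auto
  ultimately show ?thesis by (intro that[of "{p\<in>{..<N}. prime p}"]) auto
qed

section \<open>Products of k primes and the recursion in k\<close>

definition almost_primes :: "nat \<Rightarrow> nat set" where
  "almost_primes k = {n. n > 0 \<and> size (prime_factorization n) = k}"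

lemma almost_primes_Suc_iff:
  "n \<in> almost_primes (Suc k) \<longleftrightarrow> (\<exists>p m. prime p \<and> m \<in> almost_primes k \<and> n = p * m)"
proof safe
  fix p m :: nat assume "prime p" "m \<in> almost_primes k"
  thus "p * m \<in> almost_primes (Suc k)"
    by (auto simp: almost_primes_def prime_factorization_mult prime_factorization_prime prime_gt_0_nat)
next
  assume n: "n \<in> almost_primes (Suc k)"
  hence "prime_factorization n \<noteq> {#}" by (auto simp: almost_primes_def)
  then obtain p where p: "p \<in> prime_factors n" by blast
  hence pr: "prime p" "p dvd n" by (auto simp: in_prime_factors_iff)
  then obtain m where m: "n = p * m" by auto
  hence "m > 0" using n by (auto simp: almost_primes_def intro!: Nat.gr0I)
  hence "m \<in> almost_primes k"
    using n pr by (auto simp: almost_primes_def m prime_factorization_mult prime_factorization_prime prime_gt_0_nat)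
  thus "\<exists>p m. prime p \<and> m \<in> almost_primes k \<and> n = p * m" using pr m by blast
qed

lemma almost_primes_altdef:
  "n \<in> almost_primes k \<longleftrightarrow> (\<exists>p :: nat \<Rightarrow> nat. (\<forall>i<k. prime (p i)) \<and> n = (\<Prod>i<k. p i))"
proof (induction k arbitrary: n)
  case 0
  show ?case by (auto simp: almost_primes_def prime_factorization_empty_iff)
next
  case (Suc k)
  show ?case
  proof
    assume "n \<in> almost_primes (Suc k)"
    then obtain q m where q: "prime q" "m \<in> almost_primes k" "n = q * m"
      by (auto simp: almost_primes_Suc_iff)
    with Suc obtain p :: "nat \<Rightarrow> nat" where p: "\<forall>i<k. prime (p i)" "m = (\<Prod>i<k. p i)" by auto
    have "\<forall>i<Suc k. prime ((p(k := q)) i)" using p q by (auto simp: less_Suc_eq)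
    moreover have "n = (\<Prod>i<Suc k. (p(k := q)) i)" using p q by simp
    ultimately show "\<exists>p :: nat \<Rightarrow> nat. (\<forall>i<Suc k. prime (p i)) \<and> n = (\<Prod>i<Suc k. p i)" by blast
  next
    assume "\<exists>p :: nat \<Rightarrow> nat. (\<forall>i<Suc k. prime (p i)) \<and> n = (\<Prod>i<Suc k. p i)"
    then obtain p :: "nat \<Rightarrow> nat" where p: "\<forall>i<Suc k. prime (p i)" "n = (\<Prod>i<Suc k. p i)" by blast
    have "(\<Prod>i<k. p i) \<in> almost_primes k" using p by (subst Suc) (auto intro!: exI[of _ p])
    thus "n \<in> almost_primes (Suc k)" unfolding almost_primes_Suc_iff using p
      by (intro exI[of _ "p k"] exI[of _ "\<Prod>i<k. p i"]) (auto simp: mult.commute)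
  qed
qed

lemma almost_prime_count_altdef:
  "almost_prime_count k x = card {n. real n \<le> x \<and> n \<in> almost_primes k}"
  by (simp add: almost_prime_count_def almost_primes_altdef)

lemma almost_prime_count_mono: "x \<le> y \<Longrightarrow> almost_prime_count k x \<le> almost_prime_count k y"
  unfolding almost_prime_count_altdef
  by (intro card_mono finite_nat_le_real) auto

lemma almost_prime_count_less_1: "x < 1 \<Longrightarrow> almost_prime_count k x = 0"
proof -
  assume "x < 1"
  hence "{n. real n \<le> x \<and> n \<in> almost_primes k} = {}" by (auto simp: almost_primes_def)
  thus ?thesis by (simp only: almost_prime_count_altdef card.empty)
qed

lemma almost_prime_count_0: "x \<ge> 1 \<Longrightarrow> almost_prime_count 0 x = 1"
proof -
  assume "x \<ge> 1"
  hence "{n. real n \<le> x \<and> n \<in> almost_primes 0} = {1}"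
    by (auto simp: almost_primes_def prime_factorization_empty_iff)
  thus ?thesis by (simp add: almost_prime_count_altdef)
qed

lemma almost_prime_count_1: "real (almost_prime_count (Suc 0) x) = prime_count x"
proof -
  have "almost_primes (Suc 0) = {p. prime p}"
    by (auto simp: almost_primes_altdef intro: exI[of _ "\<lambda>_. p" for p])
  thus ?thesis by (simp add: almost_prime_count_altdef prime_count_def conj_commute)
qed

definition prime_times_count :: "nat \<Rightarrow> real \<Rightarrow> real" where
  "prime_times_count k x = (\<Sum>p\<in>{p. prime p \<and> real p \<le> x}. real (almost_prime_count k (x / real p)))"

text \<open>Both sides count pairs of a prime p and a product m of k primes with p m <= x; a given n
  = p m arises once for each distinct prime divisor.\<close>

lemma prime_times_count_eq:
  "prime_times_count k x = (\<Sum>n\<in>{n. real n \<le> x \<and> n \<in> almost_primes (Suc k)}. real (card (prime_factors n)))"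
proof -
  define P where "P = {p::nat. prime p \<and> real p \<le> x}"
  define N where "N = {n. real n \<le> x \<and> n \<in> almost_primes (Suc k)}"
  define M where "M = (\<lambda>p. {m. real m \<le> x / real p \<and> m \<in> almost_primes k})"
  have finP: "finite P" unfolding P_def conj_commute[of "prime _"] by (rule finite_nat_le_real)
  have finN: "finite N" unfolding N_def by (rule finite_nat_le_real)
  have finM: "finite (M p)" for p unfolding M_def by (rule finite_nat_le_real)
  note fin = finP finN finM
  have "bij_betw (\<lambda>(p,m). (p * m, p)) (Sigma P M) (Sigma N prime_factors)"
  proof (rule bij_betwI[where g = "\<lambda>(n,p). (p, n div p)"])
    show "(\<lambda>(p,m). (p * m, p)) \<in> Sigma P M \<rightarrow> Sigma N prime_factors"
    proof safe
      fix p m assume p: "p \<in> P" and m: "m \<in> M p"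
      have p0: "prime p" "real p > 0" using p by (auto simp: P_def prime_gt_0_nat)
      have "real (p * m) \<le> x" using m p0 by (simp add: M_def field_simps)
      thus "p * m \<in> N" using m p0 by (auto simp: N_def M_def almost_primes_Suc_iff)
      have "m > 0" using m by (auto simp: M_def almost_primes_def)
      thus "p \<in> prime_factors (p * m)" using p0 by (auto simp: in_prime_factors_iff)
    qed
    show "(\<lambda>(n,p). (p, n div p)) \<in> Sigma N prime_factors \<rightarrow> Sigma P M"
    proof safe
      fix n p assume n: "n \<in> N" and p: "p \<in> prime_factors n"
      have pr: "prime p" "p dvd n" using p by (auto simp: in_prime_factors_iff)
      have n0: "n > 0" using n by (auto simp: N_def almost_primes_def)
      have "p \<le> n" using pr n0 by (intro dvd_imp_le) auto
      hence "real p \<le> x" using n by (auto simp: N_def)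
      thus "p \<in> P" using pr by (simp add: P_def)
      obtain m where m: "n = p * m" using pr by auto
      have p0: "p > 0" using pr by (simp add: prime_gt_0_nat)
      have "m \<in> almost_primes k" using n pr n0 m
        by (auto simp: N_def almost_primes_def prime_factorization_mult prime_factorization_prime)
      moreover have "real m \<le> x / real p" using n m p0 by (simp add: N_def field_simps)
      ultimately show "n div p \<in> M p" using m p0 by (simp add: M_def)
    qed
  qed (auto simp: P_def in_prime_factors_iff prime_gt_0_nat)
  hence "card (Sigma P M) = card (Sigma N prime_factors)" by (rule bij_betw_same_card)
  moreover have "card (Sigma P M) = (\<Sum>p\<in>P. card (M p))" using fin by (intro card_SigmaI) auto
  moreover have "card (Sigma N prime_factors) = (\<Sum>n\<in>N. card (prime_factors n))" using fin by (intro card_SigmaI) auto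
  ultimately have "(\<Sum>p\<in>P. card (M p)) = (\<Sum>n\<in>N. card (prime_factors n))" by simp
  hence "real (\<Sum>p\<in>P. card (M p)) = real (\<Sum>n\<in>N. card (prime_factors n))" by (simp only:)
  thus ?thesis unfolding prime_times_count_def almost_prime_count_altdef P_def N_def M_def by (simp only: of_nat_sum)
qed

text \<open>These are the \<open>m\<close> for which m^\<alpha> b can be decoded. With
  \<open>b = 1\<close> only squarefreeness is imposed; that case serves the recursion in k.\<close>

definition coprime_almost_primes :: "nat \<Rightarrow> nat \<Rightarrow> nat set" where
  "coprime_almost_primes k b = {n \<in> almost_primes k. squarefree n \<and> coprime n b}"

lemma card_prime_factors_le_size: "card (prime_factors n) \<le> size (prime_factorization n)"
proof -
  have "(\<Sum>p\<in>prime_factors n. 1) \<le> (\<Sum>p\<in>prime_factors n. count (prime_factorization n) p)"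
    by (intro sum_mono) (simp add: Suc_le_eq)
  thus ?thesis by (simp add: size_multiset_overloaded_eq)
qed

text \<open>Dividing an exceptional \<open>n\<close> by a prime \<open>p\<close> with \<open>p\<^sup>2\<close> dividing \<open>n\<close> or \<open>p\<close> dividing \<open>b\<close> leaves an
  element of \<^term>\<open>almost_primes k\<close>, and \<open>n\<close> is determined by this element \<open>m\<close> and by the prime divisor \<open>p\<close>
  of \<open>m b\<close>.\<close>
lemma card_exceptional_almost_primes_le:
  assumes b: "b > 0"
  shows "card {n. real n \<le> x \<and> n \<in> almost_primes (Suc k) - coprime_almost_primes (Suc k) b}
    \<le> (k + card (prime_factors b)) * almost_prime_count k x"
proof -
  define E where "E = {n. real n \<le> x \<and> n \<in> almost_primes (Suc k) - coprime_almost_primes (Suc k) b}"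
  define M where "M = {m. real m \<le> x \<and> m \<in> almost_primes k}"
  have finM: "finite M" unfolding M_def by (rule finite_nat_le_real)
  have "E \<subseteq> (\<lambda>(m,p). m * p) ` (SIGMA m:M. prime_factors m \<union> prime_factors b)"
  proof
    fix n assume n: "n \<in> E"
    hence n0: "n > 0" by (auto simp: E_def almost_primes_def)
    have "\<exists>p. prime p \<and> p dvd n \<and> (p ^ 2 dvd n \<or> p dvd b)"
    proof (cases "squarefree n")
      case True
      hence "\<not> coprime n b" using n by (auto simp: E_def coprime_almost_primes_def)
      hence "gcd n b \<noteq> 1" using coprime_iff_gcd_eq_1[of n b] by blast
      then obtain p where "prime p" "p dvd gcd n b" using prime_factor_nat by blast
      thus ?thesis by (intro exI[of _ p]) simp
    next
      case False
      then obtain p where p: "prime p" "p ^ 2 dvd n"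
        using n0 by (auto simp: squarefree_factorial_semiring)
      moreover have "p dvd n" using p(2) by (rule dvd_trans[rotated]) (simp add: power2_eq_square)
      ultimately show ?thesis by (intro exI[of _ p]) simp
    qed
    then obtain p where p: "prime p" "p dvd n" "p ^ 2 dvd n \<or> p dvd b" by blast
    obtain m where m: "n = p * m" using p(2) by auto
    have p0: "p > 0" using p by (simp add: prime_gt_0_nat)
    have m0: "m > 0" using m n0 by auto
    have "m \<in> almost_primes k" using n p n0 m m0
      by (auto simp: E_def almost_primes_def prime_factorization_mult prime_factorization_prime)
    moreover have "m \<le> n" using m p0 by simp
    hence "real m \<le> x" using n unfolding E_def by simp
    ultimately have "m \<in> M" by (simp add: M_def)
    moreover have "p \<in> prime_factors m \<union> prime_factors b"
      using p m m0 b p0 by (auto simp: in_prime_factors_iff power2_eq_square)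
    ultimately show "n \<in> (\<lambda>(m,p). m * p) ` (SIGMA m:M. prime_factors m \<union> prime_factors b)"
      using m by (intro image_eqI[of _ _ "(m,p)"]) (auto simp: mult.commute)
  qed
  hence "card E \<le> card ((\<lambda>(m,p). m * p) ` (SIGMA m:M. prime_factors m \<union> prime_factors b))"
    using finM by (intro card_mono finite_imageI finite_SigmaI) auto
  also have "\<dots> \<le> card (SIGMA m:M. prime_factors m \<union> prime_factors b)"
    using finM by (intro card_image_le finite_SigmaI) auto
  also have "\<dots> = (\<Sum>m\<in>M. card (prime_factors m \<union> prime_factors b))"
    using finM by (intro card_SigmaI) auto
  also have "\<dots> \<le> (\<Sum>m\<in>M. k + card (prime_factors b))"
  proof (rule sum_mono)
    fix m assume "m \<in> M"
    hence "card (prime_factors m) \<le> k"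
      using card_prime_factors_le_size[of m] by (auto simp: M_def almost_primes_def)
    thus "card (prime_factors m \<union> prime_factors b) \<le> k + card (prime_factors b)"
      using card_Un_le[of "prime_factors m" "prime_factors b"] by linarith
  qed
  also have "\<dots> = (k + card (prime_factors b)) * almost_prime_count k x"
    by (simp add: almost_prime_count_altdef M_def mult.commute)
  finally show ?thesis by (simp add: E_def)
qed

lemma card_prime_factors_squarefree:
  assumes "squarefree n" "n > 0"
  shows "card (prime_factors (n::nat)) = size (prime_factorization n)"
proof -
  have "size (prime_factorization n) = (\<Sum>p\<in>prime_factors n. count (prime_factorization n) p)"
    by (simp add: size_multiset_overloaded_eq)
  also have "\<dots> = (\<Sum>p\<in>prime_factors n. 1)"
    using assms by (intro sum.cong refl)
      (auto simp: count_prime_factorization squarefree_factorial_semiring' in_prime_factors_iff)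
  finally show ?thesis by simp
qed

text \<open>A squarefree product of k + 1 primes has exactly k + 1 distinct prime divisors. The
  other products number at most k sigma_k(x), by the exceptional count for b = 1, and each falls
  short by at most k + 1.\<close>

lemma prime_times_count_bounds:
  shows "prime_times_count k x \<le> real (Suc k) * real (almost_prime_count (Suc k) x)"
    "real (Suc k) * real (almost_prime_count (Suc k) x) \<le> prime_times_count k x + real (Suc k) * real k * real (almost_prime_count k x)"
proof -
  define N where "N = {n. real n \<le> x \<and> n \<in> almost_primes (Suc k)}"
  define E where "E = {n. real n \<le> x \<and> n \<in> almost_primes (Suc k) - coprime_almost_primes (Suc k) 1}"
  have finN: "finite N" unfolding N_def by (rule finite_nat_le_real)
  have EN: "E \<subseteq> N" by (auto simp: E_def N_def)
  have A: "real (Suc k) * real (almost_prime_count (Suc k) x) = (\<Sum>n\<in>N. real (Suc k))"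
    by (simp add: almost_prime_count_altdef N_def mult.commute)
  show "prime_times_count k x \<le> real (Suc k) * real (almost_prime_count (Suc k) x)"
    unfolding A prime_times_count_eq N_def[symmetric]
  proof (rule sum_mono)
    fix n assume "n \<in> N"
    thus "real (card (prime_factors n)) \<le> real (Suc k)"
      using card_prime_factors_le_size[of n] by (auto simp: N_def almost_primes_def)
  qed
  have "(\<Sum>n\<in>N. real (Suc k)) \<le> (\<Sum>n\<in>N. real (card (prime_factors n)) + (if n \<in> E then real (Suc k) else 0))"
  proof (rule sum_mono)
    fix n assume n: "n \<in> N"
    show "real (Suc k) \<le> real (card (prime_factors n)) + (if n \<in> E then real (Suc k) else 0)"
      using n card_prime_factors_squarefree[of n]
      by (auto simp: N_def E_def coprime_almost_primes_def almost_primes_def)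
  qed
  also have "\<dots> = (\<Sum>n\<in>N. real (card (prime_factors n))) + (\<Sum>n\<in>N. if n \<in> E then real (Suc k) else 0)"
    by (rule sum.distrib)
  also have "(\<Sum>n\<in>N. if n \<in> E then real (Suc k) else 0) = (\<Sum>n\<in>E. real (Suc k))"
    using EN finN by (intro sum.mono_neutral_cong_right) auto
  also have "\<dots> = real (Suc k) * real (card E)" by simp
  also have "card E \<le> k * almost_prime_count k x"
    using card_exceptional_almost_primes_le[of 1 x k] by (simp add: E_def)
  hence "real (card E) \<le> real k * real (almost_prime_count k x)" by (simp only: of_nat_le_iff flip: of_nat_mult)
  hence "real (Suc k) * real (card E) \<le> real (Suc k) * (real k * real (almost_prime_count k x))"
    by (intro mult_left_mono) auto
  finally show "real (Suc k) * real (almost_prime_count (Suc k) x) \<le> prime_times_count k x + real (Suc k) * real k * real (almost_prime_count k x)"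
    unfolding A prime_times_count_eq N_def[symmetric] by (simp add: mult.assoc)
qed

text \<open>For p > x the argument x/p is below 1 and the count vanishes. This allows the sums for x
  and for c x to run over the same primes.\<close>

lemma prime_times_count_extend:
  assumes "x \<le> X"
  shows "prime_times_count k x = (\<Sum>p\<in>{p. prime p \<and> real p \<le> X}. real (almost_prime_count k (x / real p)))"
  unfolding prime_times_count_def
proof (rule sum.mono_neutral_left)
  show "finite {p. prime p \<and> real p \<le> X}"
    unfolding conj_commute[of "prime _"] by (rule finite_nat_le_real)
  show "\<forall>p\<in>{p. prime p \<and> real p \<le> X} - {p. prime p \<and> real p \<le> x}. real (almost_prime_count k (x / real p)) = 0"
    by (auto simp: prime_gt_0_nat field_simps intro!: almost_prime_count_less_1)
qed (use assms in auto)

text \<open>Finitely many primes with reciprocal sum above \<open>K\<close> suffice: by regular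
  variation their terms alone, divided by sigma_k(x), tend to that sum.\<close>

lemma prime_times_count_dominates:
  assumes rv: "regularly_varying (\<lambda>x. real (almost_prime_count k x))"
  shows "eventually (\<lambda>x. prime_times_count k x > K * real (almost_prime_count k x)) at_top"
proof -
  define F where "F = (\<lambda>x. real (almost_prime_count k x))"
  obtain P :: "nat set" where P: "finite P" "\<And>p. p \<in> P \<Longrightarrow> prime p" "(\<Sum>p\<in>P. 1 / real p) > K"
    by (rule prime_reciprocals_unbounded[of K]) (rule that)
  have "((\<lambda>x. \<Sum>p\<in>P. F (1 / real p * x) / F x) \<longlongrightarrow> (\<Sum>p\<in>P. 1 / real p)) at_top"
  proof (rule tendsto_sum)
    fix p assume "p \<in> P"
    hence "1 / real p > 0" using P(2) by (simp add: prime_gt_0_nat)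
    thus "((\<lambda>x. F (1 / real p * x) / F x) \<longlongrightarrow> 1 / real p) at_top"
      using rv unfolding regularly_varying_def F_def by blast
  qed
  hence "eventually (\<lambda>x. (\<Sum>p\<in>P. F (1 / real p * x) / F x) > K) at_top"
    by (rule order_tendstoD) (rule P)
  moreover have "eventually (\<lambda>x. F x > 0) at_top" using rv by (simp add: regularly_varying_def F_def)
  moreover have "eventually (\<lambda>x. \<forall>p\<in>P. real p \<le> x) at_top"
    using P(1) by (intro eventually_ball_finite ballI eventually_ge_at_top)
  ultimately show ?thesis
  proof eventually_elim
    case (elim x)
    have "K * F x < (\<Sum>p\<in>P. F (1 / real p * x) / F x) * F x"
      using elim by (intro mult_strict_right_mono) auto
    also have "\<dots> = (\<Sum>p\<in>P. F (x / real p))" using elim by (simp add: sum_distrib_right)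
    also have "\<dots> \<le> (\<Sum>p\<in>{p. prime p \<and> real p \<le> x}. F (x / real p))"
      using elim P finite_nat_le_real[of x prime] by (intro sum_mono2) (auto simp: F_def conj_commute)
    also have "\<dots> = prime_times_count k x" by (simp add: prime_times_count_def F_def)
    finally show ?case by (simp add: F_def)
  qed
qed

text \<open>Term by term, F(c x/p) differs from c F(x/p) by at most r/2 F(x/p) if x/p is large and
  by at most a constant otherwise. The constants add up to O(pi(d x)) = O(pi(x)) = O(F(x)), using
  the hypothesis on \<open>prime_count\<close>, and this is o(T(x)) by
  \<open>prime_times_count_dominates\<close>.\<close>

lemma regularly_varying_prime_times_count:
  assumes rv: "regularly_varying (\<lambda>x. real (almost_prime_count k x))"
    and pc: "eventually (\<lambda>x. prime_count x \<le> real (almost_prime_count k x)) at_top"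
  shows "regularly_varying (prime_times_count k)"
  unfolding regularly_varying_def
proof (intro conjI allI impI)
  define F where "F = (\<lambda>x. real (almost_prime_count k x))"
  define T where "T = prime_times_count k"
  have dom: "eventually (\<lambda>x. T x > K * F x) at_top" for K
    unfolding F_def T_def by (rule prime_times_count_dominates[OF rv])
  from dom[of 0] show pos: "eventually (\<lambda>x. prime_times_count k x > 0) at_top" by (simp add: T_def)
  fix c :: real assume c: "c > 0"
  show "((\<lambda>x. prime_times_count k (c * x) / prime_times_count k x) \<longlongrightarrow> c) at_top"
    unfolding T_def[symmetric]
  proof (rule tendstoI)
    fix r :: real assume e: "r > 0"
    have Fpos: "eventually (\<lambda>x. F x > 0) at_top" using rv by (simp add: regularly_varying_def F_def)
    have "((\<lambda>x. F (c * x) / F x) \<longlongrightarrow> c) at_top" using rv c by (simp add: regularly_varying_def F_def)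
    from tendstoD[OF this, of "r / 2"] e have "eventually (\<lambda>x. dist (F (c * x) / F x) c < r / 2) at_top" by simp
    with Fpos have "eventually (\<lambda>x. \<bar>F (c * x) - c * F x\<bar> \<le> r / 2 * F x) at_top"
    proof eventually_elim
      case (elim x)
      have "\<bar>F (c * x) - c * F x\<bar> = \<bar>F (c * x) / F x - c\<bar> * F x"
        using elim(1) by (subst abs_mult_pos) (auto simp: left_diff_distrib)
      also have "\<dots> \<le> r / 2 * F x" using elim by (intro mult_right_mono) (auto simp: dist_real_def)
      finally show ?case .
    qed
    then obtain Y where Y: "\<And>y. y \<ge> Y \<Longrightarrow> \<bar>F (c * y) - c * F y\<bar> \<le> r / 2 * F y"
      by (auto simp: eventually_at_top_linorder)
    \<comment> \<open>Bounds the difference for all y < Y, by monotonicity of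
      \<open>F\<close>.\<close>
    define C where "C = F (c * Y) + c * F Y"
    have F0: "F y \<ge> 0" for y by (simp add: F_def)
    have Fm: "F y \<le> F z" if "y \<le> z" for y z using that by (simp add: F_def almost_prime_count_mono)
    have C0: "C \<ge> 0" using c by (simp add: C_def F0)
    have bd: "\<bar>F (c * y) - c * F y\<bar> \<le> r / 2 * F y + C" for y
    proof (cases "y \<ge> Y")
      case True
      thus ?thesis using Y[of y] C0 by simp
    next
      case False
      have "F (c * y) \<le> F (c * Y)" "c * F y \<le> c * F Y"
        using False c by (auto intro!: Fm mult_left_mono)
      moreover have "c * F y \<ge> 0" "F (c * y) \<ge> 0" using c F0 by auto
      moreover have "r / 2 * F y \<ge> 0" using e F0[of y] by simp
      ultimately show ?thesis unfolding C_def by linarith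
    qed
    \<comment> \<open>The primes up to d x cover both sums, the one for x and the one for c
      x.\<close>
    define d where "d = max 1 c"
    have d: "d \<ge> 1" "d \<ge> c" by (auto simp: d_def)
    have "((\<lambda>x. prime_count (d * x) / prime_count x) \<longlongrightarrow> d) at_top"
      using regularly_varying_prime_count d by (auto simp: regularly_varying_def)
    hence ev1: "eventually (\<lambda>x. prime_count (d * x) / prime_count x < d + 1) at_top"
      by (rule order_tendstoD) simp
    have ev2: "eventually (\<lambda>x. prime_count x > 0) at_top"
      using regularly_varying_prime_count by (simp add: regularly_varying_def)
    \<comment> \<open>The constant 2 C (d + 1)/r in the domination is what makes the accumulated
      error C (d + 1) F(x) smaller than r/2 T(x).\<close>
    show "eventually (\<lambda>x. dist (T (c * x) / T x) c < r) at_top"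
      using ev1 ev2 dom[of "2 * C * (d + 1) / r"] pc pos eventually_gt_at_top[of 0]
    proof eventually_elim
      case (elim x)
      define Q where "Q = {p::nat. prime p \<and> real p \<le> d * x}"
      have T1: "T (c * x) = (\<Sum>p\<in>Q. F (c * (x / real p)))"
        unfolding T_def Q_def using d elim
        by (subst prime_times_count_extend[of _ "d * x"]) (auto simp: F_def mult_right_mono)
      have T2: "T x = (\<Sum>p\<in>Q. F (x / real p))"
        unfolding T_def Q_def using d elim mult_right_mono[of 1 d x]
        by (subst prime_times_count_extend[of _ "d * x"]) (auto simp: F_def)
      have "\<bar>T (c * x) - c * T x\<bar> = \<bar>\<Sum>p\<in>Q. F (c * (x / real p)) - c * F (x / real p)\<bar>"
        unfolding T1 T2 by (simp add: sum_subtractf sum_distrib_left)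
      also have "\<dots> \<le> (\<Sum>p\<in>Q. r / 2 * F (x / real p) + C)"
        by (rule order.trans[OF sum_abs]) (intro sum_mono bd)
      also have "\<dots> = r / 2 * T x + C * prime_count (d * x)"
        unfolding T2 by (simp add: sum.distrib sum_distrib_left prime_count_def Q_def)
      also have "prime_count (d * x) \<le> (d + 1) * F x"
      proof -
        have "prime_count (d * x) \<le> (d + 1) * prime_count x" using elim by (simp add: field_simps)
        also have "\<dots> \<le> (d + 1) * F x" using elim d by (intro mult_left_mono) (auto simp: F_def)
        finally show ?thesis .
      qed
      hence "C * prime_count (d * x) \<le> C * ((d + 1) * F x)" using C0 by (intro mult_left_mono)
      also have "C * ((d + 1) * F x) = r / 2 * (2 * C * (d + 1) / r * F x)"
        using e by (simp add: field_simps)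
      also have "\<dots> < r / 2 * T x" using elim e by (intro mult_strict_left_mono) (auto simp: T_def)
      finally have less: "\<bar>T (c * x) - c * T x\<bar> < r * T x" by simp
      have Tp: "T x > 0" using elim by (simp add: T_def)
      have "\<bar>T (c * x) / T x - c\<bar> * T x = \<bar>T (c * x) - c * T x\<bar>"
        using Tp by (subst abs_mult_pos) (auto simp: left_diff_distrib)
      hence "\<bar>T (c * x) / T x - c\<bar> * T x < r * T x" using less by simp
      thus ?case using Tp by (simp add: dist_real_def)
    qed
  qed
qed

text \<open>With T the sum of sigma_(k+1)(x/p) over p, domination gives sigma_(k+1)/T -> 0, and the
  bounds for T then give sigma_(k+2)/T -> 1/(k+2). Regular variation passes from T to sigma_(k+2),
  and dividing the two limits gives the third claim. That one makes exceptional products negligible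
  later; the second claim is needed for the next step of the induction.\<close>

theorem almost_prime_count_regularly_varying:
  shows "regularly_varying (\<lambda>x. real (almost_prime_count (Suc k) x))"
    and "eventually (\<lambda>x. prime_count x \<le> real (almost_prime_count (Suc k) x)) at_top"
    and "((\<lambda>x. real (almost_prime_count k x) / real (almost_prime_count (Suc k) x)) \<longlongrightarrow> 0) at_top"
proof (induction k)
  case 0
  have "eventually (\<lambda>x. 1 / prime_count x = real (almost_prime_count 0 x) / real (almost_prime_count (Suc 0) x)) at_top"
    using eventually_ge_at_top[of 1] by eventually_elim (simp add: almost_prime_count_0 almost_prime_count_1)
  moreover have "((\<lambda>x. 1 / prime_count x) \<longlongrightarrow> 0) at_top"
    by (rule real_tendsto_divide_at_top[OF tendsto_const prime_count_at_top])
  ultimately have lim: "((\<lambda>x. real (almost_prime_count 0 x) / real (almost_prime_count (Suc 0) x)) \<longlongrightarrow> 0) at_top"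
    by (rule Lim_transform_eventually[rotated])
  {
    case 1 show ?case using regularly_varying_prime_count by (simp add: almost_prime_count_1)
  next
    case 2 show ?case by (simp add: almost_prime_count_1)
  next
    case 3 show ?case by (rule lim)
  }
next
  case (Suc k)
  define F where "F = (\<lambda>x. real (almost_prime_count (Suc k) x))"
  define G where "G = (\<lambda>x. real (almost_prime_count (Suc (Suc k)) x))"
  define T where "T = prime_times_count (Suc k)"
  have T: "regularly_varying T"
    unfolding T_def by (rule regularly_varying_prime_times_count[OF Suc.IH(1,2)])
  have Tpos: "eventually (\<lambda>x. T x > 0) at_top" using T by (simp add: regularly_varying_def)
  have dom: "eventually (\<lambda>x. T x > K * F x) at_top" for K
    unfolding F_def T_def by (rule prime_times_count_dominates[OF Suc.IH(1)])
  have F0: "F x \<ge> 0" for x by (simp add: F_def)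
  have FT: "((\<lambda>x. F x / T x) \<longlongrightarrow> 0) at_top"
  proof (rule tendstoI)
    fix e :: real assume e: "e > 0"
    show "eventually (\<lambda>x. dist (F x / T x) 0 < e) at_top"
      using dom[of "1 / e"] Tpos by eventually_elim (use e F0 in \<open>simp add: field_simps\<close>)
  qed
  define K where "K = real (Suc (Suc k))"
  have K: "K > 0" by (simp add: K_def)
  have GT: "((\<lambda>x. G x / T x) \<longlongrightarrow> 1 / K) at_top"
  proof (rule tendsto_sandwich)
    show "eventually (\<lambda>x. 1 / K \<le> G x / T x) at_top"
      using Tpos
    proof eventually_elim
      case (elim x)
      have "T x \<le> K * G x" unfolding T_def K_def G_def by (rule prime_times_count_bounds)
      thus ?case using elim K by (simp add: field_simps)
    qed
    show "eventually (\<lambda>x. G x / T x \<le> 1 / K + real (Suc k) * (F x / T x)) at_top"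
      using Tpos
    proof eventually_elim
      case (elim x)
      have "K * G x \<le> T x + K * real (Suc k) * F x"
        unfolding T_def K_def G_def F_def by (rule prime_times_count_bounds)
      thus ?case using elim K by (simp add: field_simps del: of_nat_Suc)
    qed
    have "((\<lambda>x. 1 / K + real (Suc k) * (F x / T x)) \<longlongrightarrow> 1 / K + real (Suc k) * 0) at_top"
      by (intro tendsto_add tendsto_mult FT tendsto_const)
    thus "((\<lambda>x. 1 / K + real (Suc k) * (F x / T x)) \<longlongrightarrow> 1 / K) at_top" by simp
  qed (rule tendsto_const)
  have rv: "regularly_varying G" using K by (intro regularly_varying_asymp[OF T GT]) simp
  have "((\<lambda>x. (F x / T x) / (G x / T x)) \<longlongrightarrow> 0 / (1 / K)) at_top"
    using K by (intro tendsto_divide FT GT) auto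
  moreover have "eventually (\<lambda>x. (F x / T x) / (G x / T x) = F x / G x) at_top"
    using Tpos by eventually_elim simp
  ultimately have FG: "((\<lambda>x. F x / G x) \<longlongrightarrow> 0) at_top"
    by (auto intro: Lim_transform_eventually)
  have "eventually (\<lambda>x. F x / G x < 1) at_top" by (rule order_tendstoD(2)[OF FG]) simp
  moreover have "eventually (\<lambda>x. G x > 0) at_top" using rv by (simp add: regularly_varying_def)
  ultimately have "eventually (\<lambda>x. prime_count x \<le> G x) at_top"
    using Suc.IH(2) by eventually_elim (simp add: F_def)
  note pc = this
  {
    case 1 show ?case using rv by (simp add: G_def)
  next
    case 2 show ?case using pc by (simp add: G_def)
  next
    case 3 show ?case using FG by (simp add: F_def G_def)
  }
qed

section \<open>Products with prescribed exponents\<close>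

text \<open>Potter's bound, obtained by iterating the estimate \<open>f (y/2) \<le> 2\<^sup>-\<^sup>s f y\<close>.\<close>
lemma potter_bound:
  assumes rv: "regularly_varying f" and mono: "\<And>x y. x \<le> y \<Longrightarrow> f x \<le> f y"
    and zero: "\<And>x. x < 1 \<Longrightarrow> f x = 0" and s: "0 < s" "s < 1"
  obtains C Y where "C \<ge> 1" "\<And>y w. y \<ge> Y \<Longrightarrow> 0 < w \<Longrightarrow> w \<le> 1 \<Longrightarrow> f (w * y) \<le> C * w powr s * f y"
proof -
  have "(1/2::real) > 0" by simp
  hence "((\<lambda>y. f (1/2 * y) / f y) \<longlongrightarrow> 1/2) at_top" using rv unfolding regularly_varying_def by blast
  moreover have "1/2 < 2 powr (-s)" using powr_less_mono[of "-1" "-s" 2] s by (simp add: powr_minus)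
  ultimately have "eventually (\<lambda>y. f (1/2 * y) / f y < 2 powr (-s)) at_top" by (rule order_tendstoD)
  moreover have "eventually (\<lambda>y. f y > 0) at_top" using rv by (simp add: regularly_varying_def)
  ultimately have "eventually (\<lambda>y. f (1/2 * y) \<le> 2 powr (-s) * f y \<and> f y > 0) at_top"
    by eventually_elim (simp add: field_simps)
  then obtain Y0 where Y0: "\<And>y. y \<ge> Y0 \<Longrightarrow> f (1/2 * y) \<le> 2 powr (-s) * f y \<and> f y > 0"
    by (auto simp: eventually_at_top_linorder)
  define Y where "Y = max 1 Y0"
  have Y: "Y \<ge> 1" "\<And>y. y \<ge> Y \<Longrightarrow> f (1/2 * y) \<le> 2 powr (-s) * f y" "\<And>y. y \<ge> Y \<Longrightarrow> f y > 0"
    using Y0 by (auto simp: Y_def)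
  have iter: "f (y / 2 ^ j) \<le> (2 powr (-s)) ^ j * f y" if "y \<ge> Y * 2 ^ j" for y j
    using that
  proof (induction j)
    case (Suc j)
    have "Y * 2 ^ j \<le> Y * 2 ^ Suc j" using Y(1) by (intro mult_left_mono) auto
    with Suc.prems have "Y * 2 ^ j \<le> y" by linarith
    hence IH: "f (y / 2 ^ j) \<le> (2 powr (-s)) ^ j * f y" by (rule Suc.IH)
    have "f (y / 2 ^ Suc j) = f (1/2 * (y / 2 ^ j))" by simp
    also have "\<dots> \<le> 2 powr (-s) * f (y / 2 ^ j)"
      using \<open>Y * 2 ^ j \<le> y\<close> by (intro Y(2)) (simp add: pos_le_divide_eq)
    also have "\<dots> \<le> 2 powr (-s) * ((2 powr (-s)) ^ j * f y)" using IH by (intro mult_left_mono) auto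
    finally show ?case by simp
  qed simp
  have large: "f (w * y) \<le> 2 powr s * w powr s * f y" if w: "0 < w" "w \<le> 1" "w * y \<ge> Y" for w y
  proof -
    obtain n where "(1/2) ^ n < w" using real_arch_pow_inv[of w "1/2"] w(1) by auto
    moreover have "1 / 2 ^ Suc n \<le> (1/2::real) ^ n" by (simp add: power_one_over field_simps)
    ultimately have ex: "\<exists>j. 1 / 2 ^ Suc j < w" by (intro exI[of _ n]) simp
    \<comment> \<open>Rounds w to a power of 1/2: it lies above 2^(-j-1) and is at most 2^(-j),
      which costs the factor 2^s.\<close>
    define j where "j = (LEAST j. 1 / 2 ^ Suc j < w)"
    have j1: "1 / 2 ^ Suc j < w" unfolding j_def by (rule LeastI_ex[OF ex])
    have j2: "w \<le> 1 / 2 ^ j"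
    proof (cases j)
      case (Suc i)
      hence "\<not> 1 / 2 ^ Suc i < w" unfolding j_def using not_less_Least[of i "\<lambda>j. 1 / 2 ^ Suc j < w"] by auto
      thus ?thesis by (simp add: Suc)
    qed (use w in simp)
    have y0: "y > 0" using w Y(1) by (metis less_le_trans zero_less_mult_pos zero_less_one)
    have "w * y \<le> 1 / 2 ^ j * y" using j2 y0 by (intro mult_right_mono) auto
    hence yj: "w * y \<le> y / 2 ^ j" by simp
    hence "Y \<le> y / 2 ^ j" using w(3) by linarith
    hence "f (y / 2 ^ j) \<le> (2 powr (-s)) ^ j * f y" by (intro iter) (simp add: pos_le_divide_eq)
    with mono[OF yj] have "f (w * y) \<le> (2 powr (-s)) ^ j * f y" by linarith
    also have "\<dots> \<le> (2 powr s * w powr s) * f y"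
    proof (rule mult_right_mono)
      have "(2 powr (-s)) ^ j = (1 / 2 ^ j) powr s"
      proof -
        have "(2 powr (-s)) ^ j = (2 powr (-s)) powr real j" by (simp add: powr_realpow)
        also have "\<dots> = (2 powr (- real j)) powr s" by (simp add: powr_powr mult.commute)
        also have "2 powr (- real j) = 1 / (2::real) ^ j" by (simp add: powr_minus powr_realpow inverse_eq_divide)
        finally show ?thesis .
      qed
      also have "\<dots> \<le> (2 * w) powr s" using j1 s by (intro powr_mono2) (auto simp: field_simps)
      also have "\<dots> = 2 powr s * w powr s" using w by (simp add: powr_mult)
      finally show "(2 powr (-s)) ^ j \<le> 2 powr s * w powr s" .
      have "w * y \<le> 1 * y" using w y0 by (intro mult_right_mono) auto
      hence "y \<ge> Y" using w(3) by linarith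
      thus "f y \<ge> 0" using Y(3)[of y] by simp
    qed
    finally show ?thesis .
  qed
  show ?thesis
  proof (rule that[of "2 powr s * Y powr s" Y])
    show "2 powr s * Y powr s \<ge> 1"
      using s Y(1) mult_mono[of 1 "2 powr s" 1 "Y powr s"] by (simp add: ge_one_powr_ge_zero)
    fix y w assume y: "y \<ge> Y" and w: "0 < w" "w \<le> (1::real)"
    have y0: "y > 0" using y Y(1) by simp
    show "f (w * y) \<le> 2 powr s * Y powr s * w powr s * f y"
    proof (cases "w * y < 1")
      case True
      thus ?thesis using zero[of "w * y"] Y(3)[OF y] by simp
    next
      case False
      \<comment> \<open>Lifts the argument to at least Y. Because w y >= 1, this enlarges w at most
        by the factor Y.\<close>
      define v where "v = max w (Y / y)"
      have v: "0 < v" "v \<le> 1" "v * y \<ge> Y" "w \<le> v"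
        using w y y0 Y(1) by (auto simp: v_def max_def field_simps)
      have "Y / y \<le> Y * w" using False Y(1) y0 mult_left_mono[of 1 "w * y" Y] by (simp add: field_simps)
      moreover have "w \<le> Y * w" using Y(1) w by simp
      ultimately have vY: "v \<le> Y * w" by (simp add: v_def)
      have "f (w * y) \<le> f (v * y)" using v y0 by (intro mono mult_right_mono) auto
      also have "\<dots> \<le> 2 powr s * v powr s * f y" by (rule large) (use v in auto)
      also have "\<dots> \<le> 2 powr s * (Y * w) powr s * f y"
        using vY v s Y(3)[OF y] by (intro mult_right_mono mult_left_mono powr_mono2) auto
      also have "(Y * w) powr s = Y powr s * w powr s" using Y(1) w by (simp add: powr_mult)
      finally show ?thesis by (simp add: mult_ac)
    qed
  qed
qed

section \<open>Counting the numbers m^alpha b\<close>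

lemma squarefree_nat_eqI:
  fixes m n :: nat
  assumes "squarefree m" "squarefree n" "m > 0" "n > 0" "\<And>p. prime p \<Longrightarrow> p dvd m \<longleftrightarrow> p dvd n"
  shows "m = n"
proof (rule multiplicity_eq_nat)
  fix p :: nat assume p: "prime p"
  have *: "multiplicity p k = (if p dvd k then 1 else 0)" if "squarefree k" "k > 0" for k :: nat
  proof -
    have "multiplicity p k \<le> 1" using that p by (auto simp: squarefree_factorial_semiring'')
    moreover have "multiplicity p k > 0 \<longleftrightarrow> p dvd k"
      using that p by (simp add: prime_multiplicity_gt_zero_iff)
    ultimately show ?thesis by auto
  qed
  show "multiplicity p m = multiplicity p n" using assms p by (simp add: *)
qed (use assms in auto)

text \<open>If all multiplicities in \<open>b\<close> exceed \<open>\<alpha>\<close>, then \<open>m\<close> is recovered from \<open>m\<^sup>\<alpha> b\<close> as the product of the primes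
  occurring with multiplicity exactly \<open>\<alpha>\<close>.\<close>
lemma power_mult_representation_unique:
  fixes m m' b b' :: nat
  assumes a: "\<alpha> > 0" and m: "squarefree m" "coprime m b" "m > 0" and m': "squarefree m'" "coprime m' b'" "m' > 0"
    and b: "b > 0" "\<And>p. prime p \<Longrightarrow> p dvd b \<Longrightarrow> multiplicity p b > \<alpha>"
    and b': "b' > 0" "\<And>p. prime p \<Longrightarrow> p dvd b' \<Longrightarrow> multiplicity p b' > \<alpha>"
    and eq: "m ^ \<alpha> * b = m' ^ \<alpha> * b'"
  shows "m = m'" "b = b'"
proof -
  have *: "multiplicity p (m ^ \<alpha> * b) = \<alpha> \<longleftrightarrow> p dvd m"
    if p: "prime p" and m: "squarefree m" "coprime m b" "m > 0"
      and b: "b > 0" "\<And>p. prime p \<Longrightarrow> p dvd b \<Longrightarrow> multiplicity p b > \<alpha>" for p m b :: nat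
  proof -
    have mult: "multiplicity p (m ^ \<alpha> * b) = \<alpha> * multiplicity p m + multiplicity p b"
      using p m b by (simp add: prime_elem_multiplicity_mult_distrib prime_elem_multiplicity_power_distrib)
    show ?thesis
    proof (cases "p dvd m")
      case True
      hence "\<not> p dvd b" using m p by (meson coprime_common_divisor not_prime_unit)
      hence "multiplicity p b = 0" by (simp add: not_dvd_imp_multiplicity_0)
      moreover have "multiplicity p m \<le> 1" using m p by (auto simp: squarefree_factorial_semiring'')
      moreover have "multiplicity p m > 0" using True p m by (simp add: prime_multiplicity_gt_zero_iff)
      ultimately show ?thesis using True mult by (simp add: le_antisym Suc_leI)
    next
      case False
      hence "multiplicity p m = 0" by (simp add: not_dvd_imp_multiplicity_0)
      moreover have "multiplicity p b \<noteq> \<alpha>"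
        using b(2)[OF p] a not_dvd_imp_multiplicity_0[of p b] by (cases "p dvd b") auto
      ultimately show ?thesis using False mult by simp
    qed
  qed
  show "m = m'"
  proof (rule squarefree_nat_eqI)
    fix p :: nat assume p: "prime p"
    show "p dvd m \<longleftrightarrow> p dvd m'"
      using *[OF p m b] *[OF p m' b'] eq by simp
  qed (use m m' in auto)
  with eq m show "b = b'" by simp
qed

text \<open>For fixed b the exceptional products of k + 1 primes number at most a constant times
  sigma_k(z), which is o(sigma_(k+1)(z)).\<close>

lemma coprime_almost_primes_asymp:
  fixes k b :: nat
  assumes b: "b > 0"
  defines "L \<equiv> (\<lambda>z. real (card {m. real m \<le> z \<and> m \<in> coprime_almost_primes (Suc k) b}))"
  shows "((\<lambda>z. L z / real (almost_prime_count (Suc k) z)) \<longlongrightarrow> 1) at_top"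
proof -
  define F where "F = (\<lambda>z. real (almost_prime_count (Suc k) z))"
  define G where "G = (\<lambda>z. real (almost_prime_count k z))"
  define K where "K = real (k + card (prime_factors b))"
  have bounds: "L z \<le> F z" "F z \<le> L z + K * G z" for z
  proof -
    let ?A = "{n. real n \<le> z \<and> n \<in> almost_primes (Suc k)}"
    let ?C = "{n. real n \<le> z \<and> n \<in> coprime_almost_primes (Suc k) b}"
    let ?E = "{n. real n \<le> z \<and> n \<in> almost_primes (Suc k) - coprime_almost_primes (Suc k) b}"
    have "card ?C \<le> card ?A"
      by (intro card_mono finite_nat_le_real) (auto simp: coprime_almost_primes_def)
    thus "L z \<le> F z" by (simp add: L_def F_def almost_prime_count_altdef)
    have "card ?A \<le> card (?C \<union> ?E)"
      by (intro card_mono finite_UnI finite_nat_le_real) auto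
    also have "\<dots> \<le> card ?C + card ?E" by (rule card_Un_le)
    also have "\<dots> \<le> card ?C + (k + card (prime_factors b)) * almost_prime_count k z"
      by (intro add_left_mono card_exceptional_almost_primes_le b)
    finally have "real (card ?A) \<le> real (card ?C + (k + card (prime_factors b)) * almost_prime_count k z)"
      by (simp only: of_nat_le_iff)
    thus "F z \<le> L z + K * G z" by (simp add: L_def F_def G_def K_def almost_prime_count_altdef[of "Suc k"])
  qed
  have pos: "eventually (\<lambda>z. F z > 0) at_top"
    using almost_prime_count_regularly_varying(1)[of k] by (simp add: regularly_varying_def F_def)
  have "((\<lambda>z. L z / F z) \<longlongrightarrow> 1) at_top"
  proof (rule tendsto_sandwich)
    show "eventually (\<lambda>z. 1 - K * (G z / F z) \<le> L z / F z) at_top"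
      using pos
    proof eventually_elim
      case (elim z)
      have "F z / F z \<le> (L z + K * G z) / F z" using elim bounds(2)[of z] by (intro divide_right_mono) auto
      thus ?case using elim by (simp add: add_divide_distrib)
    qed
    show "eventually (\<lambda>z. L z / F z \<le> 1) at_top"
      using pos by eventually_elim (use bounds(1) in \<open>simp add: field_simps\<close>)
    have "((\<lambda>z. 1 - K * (G z / F z)) \<longlongrightarrow> 1 - K * 0) at_top"
      unfolding F_def G_def
      by (intro tendsto_diff tendsto_mult tendsto_const almost_prime_count_regularly_varying)
    thus "((\<lambda>z. 1 - K * (G z / F z)) \<longlongrightarrow> 1) at_top" by simp
  qed (rule tendsto_const)
  thus ?thesis by (simp only: F_def)
qed

lemma powr_inverse_of_power_le_iff:
  fixes m b \<alpha> :: nat and x :: real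
  assumes "\<alpha> > 0" "b > 0" "x > 0"
  shows "real (m ^ \<alpha> * b) \<le> x \<longleftrightarrow> real m \<le> real b powr (- 1 / real \<alpha>) * x powr (1 / real \<alpha>)"
proof -
  have "real (m ^ \<alpha> * b) \<le> x \<longleftrightarrow> real m ^ \<alpha> \<le> x / real b"
    using assms by (simp add: pos_le_divide_eq)
  also have "x / real b = ((x / real b) powr (1 / real \<alpha>)) ^ \<alpha>"
    using assms by (simp add: powr_powr flip: powr_realpow')
  also have "real m ^ \<alpha> \<le> \<dots> \<longleftrightarrow> real m \<le> (x / real b) powr (1 / real \<alpha>)"
    using assms by (intro power_mono_iff) auto
  also have "(x / real b) powr (1 / real \<alpha>) = real b powr (- 1 / real \<alpha>) * x powr (1 / real \<alpha>)"
  proof -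
    have "- 1 / real \<alpha> = - (1 / real \<alpha>)" by simp
    thus ?thesis using assms by (simp only: powr_minus) (simp add: powr_divide divide_inverse[of _ "real b powr _"])
  qed
  finally show ?thesis .
qed

text \<open>The set \<open>S\<close> is only confined between two conditions, so the same statement
  serves both counting functions. The upper bound is a union bound over b, indifferent to repeated
  representations. The lower bound uses finitely many b, for which the decodable pairs give distinct
  numbers.\<close>

lemma power_product_count_asymp:
  fixes \<alpha> k :: nat and B S :: "nat set" and s :: real
  assumes a: "\<alpha> > 0" and s: "0 < s" "s < 1"
    and B: "\<And>b. b \<in> B \<Longrightarrow> b > 0" "\<And>b p. b \<in> B \<Longrightarrow> prime p \<Longrightarrow> p dvd b \<Longrightarrow> multiplicity p b > \<alpha>"
    and summ: "(\<lambda>b. real b powr (- s / real \<alpha>)) summable_on B"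
    and upper: "\<And>n. n \<in> S \<Longrightarrow> \<exists>m\<in>almost_primes (Suc k). \<exists>b\<in>B. n = m ^ \<alpha> * b"
    and lower: "\<And>m b. b \<in> B \<Longrightarrow> m \<in> coprime_almost_primes (Suc k) b \<Longrightarrow> m ^ \<alpha> * b \<in> S"
  defines "w \<equiv> (\<lambda>b. real b powr (- 1 / real \<alpha>))"
  shows "w summable_on B"
    "((\<lambda>x. real (card {n. real n \<le> x \<and> n \<in> S}) / real (almost_prime_count (Suc k) (x powr (1 / real \<alpha>))))
       \<longlongrightarrow> infsum w B) at_top"
proof -
  define F where "F = (\<lambda>z. real (almost_prime_count (Suc k) z))"
  define N where "N = (\<lambda>x. real (card {n. real n \<le> x \<and> n \<in> S}))"
  define Y where "Y = (\<lambda>x::real. x powr (1 / real \<alpha>))"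
  define g where "g = (\<lambda>b. real b powr (- s / real \<alpha>))"
  have rv: "regularly_varying F" unfolding F_def by (rule almost_prime_count_regularly_varying)
  have Fpos: "eventually (\<lambda>z. F z > 0) at_top" using rv by (simp add: regularly_varying_def)
  have Fm: "F x \<le> F y" if "x \<le> y" for x y using that by (simp add: F_def almost_prime_count_mono)
  have w: "0 < w b" "w b \<le> 1" "w b powr s = g b" "w b \<le> g b" if "b \<in> B" for b
  proof -
    have b: "real b \<ge> 1" using B(1)[OF that] by simp
    show "0 < w b" using b by (simp add: w_def)
    have "real b powr (-1 / real \<alpha>) \<le> real b powr 0" using b a by (intro powr_mono) auto
    thus "w b \<le> 1" using b by (simp add: w_def)
    show "w b powr s = g b" by (simp add: w_def g_def powr_powr)
    show "w b \<le> g b" unfolding w_def g_def using b a s by (intro powr_mono divide_right_mono) auto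
  qed
  have gs: "g summable_on B" using summ by (simp add: g_def)
  show ws: "w summable_on B"
    by (rule summable_on_comparison_test[OF gs]) (use w in \<open>auto intro: less_imp_le\<close>)
  obtain C Y0 where C: "C \<ge> 1" "\<And>y v. y \<ge> Y0 \<Longrightarrow> 0 < v \<Longrightarrow> v \<le> 1 \<Longrightarrow> F (v * y) \<le> C * v powr s * F y"
    by (rule potter_bound[OF rv Fm _ s]) (auto simp: F_def almost_prime_count_less_1)
  have Ylim: "filterlim Y at_top at_top"
    unfolding Y_def using a by (intro real_powr_at_top) simp
  have "((\<lambda>x. N x / F (Y x)) \<longlongrightarrow> infsum w B) at_top"
  proof (rule tendstoI)
    fix r :: real assume e: "r > 0"
    \<comment> \<open>The part of the series allowed outside \<open>B0\<close>: after multiplication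
      by the Potter constant it costs r/3, and it is itself at most r/3 because C >= 1.\<close>
    define q where "q = r / (3 * C)"
    have d: "q > 0" "C * q = r / 3" "q \<le> r / 3" using e C(1) by (auto simp: q_def field_simps)
    have "(g has_sum infsum g B) B" using gs by simp
    hence "eventually (\<lambda>X. dist (sum g X) (infsum g B) < q) (finite_subsets_at_top B)"
      unfolding has_sum_def using d(1) by (rule tendstoD)
    \<comment> \<open>Chosen by the majorant \<open>g\<close>; since w <= g on \<open>B\<close>, the
      tail of the sum of \<open>w\<close> is below \<open>q\<close> as well.\<close>
    then obtain B0 where B0: "finite B0" "B0 \<subseteq> B" "dist (sum g B0) (infsum g B) < q"
      by (auto simp: eventually_finite_subsets_at_top)
    have gs0: "g summable_on (B - B0)" by (rule summable_on_subset[OF gs]) auto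
    have gB0: "infsum g (B - B0) < q"
      using infsum_Diff[OF gs _ B0(2)] B0 by (simp add: dist_real_def)
    have ws0: "w summable_on (B - B0)" by (rule summable_on_subset[OF ws]) auto
    have "infsum w (B - B0) \<le> infsum g (B - B0)"
      by (rule infsum_mono[OF ws0 gs0]) (use w in auto)
    moreover have "infsum w (B - B0) \<ge> 0"
      by (rule infsum_nonneg) (use w in \<open>auto intro: less_imp_le\<close>)
    moreover have "infsum w (B - B0) = infsum w B - sum w B0"
      using infsum_Diff[OF ws _ B0(2)] B0(1) by simp
    ultimately have W: "infsum w B < sum w B0 + q" "sum w B0 \<le> infsum w B" using gB0 by linarith+
    define M where "M = (\<lambda>b z. {m. real m \<le> z \<and> m \<in> coprime_almost_primes (Suc k) b})"
    have up: "eventually (\<lambda>y. (\<Sum>b\<in>B0. F (w b * y) / F y) < sum w B0 + r / 3) at_top"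
    proof (rule order_tendstoD)
      show "((\<lambda>y. \<Sum>b\<in>B0. F (w b * y) / F y) \<longlongrightarrow> sum w B0) at_top"
        using rv w(1) B0(2) unfolding regularly_varying_def by (intro tendsto_sum) blast
    qed (use e in simp)
    have lo: "eventually (\<lambda>y. (\<Sum>b\<in>B0. real (card (M b (w b * y))) / F y) > sum w B0 - r / 3) at_top"
    proof (rule order_tendstoD)
      show "((\<lambda>y. \<Sum>b\<in>B0. real (card (M b (w b * y))) / F y) \<longlongrightarrow> sum w B0) at_top"
      proof (rule tendsto_sum)
        fix b assume "b \<in> B0"
        hence b: "b \<in> B" using B0 by auto
        note lim = filterlim_mult_const_at_top[OF w(1)[OF b]]
        have "((\<lambda>y. real (card (M b (w b * y))) / F (w b * y)) \<longlongrightarrow> 1) at_top"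
          using filterlim_compose[OF coprime_almost_primes_asymp[OF B(1)[OF b], of k] lim]
          by (simp add: M_def F_def)
        moreover have "((\<lambda>y. F (w b * y) / F y) \<longlongrightarrow> w b) at_top"
          using rv w(1)[OF b] unfolding regularly_varying_def by blast
        ultimately have "((\<lambda>y. real (card (M b (w b * y))) / F (w b * y) * (F (w b * y) / F y)) \<longlongrightarrow> 1 * w b) at_top"
          by (rule tendsto_mult)
        moreover have "eventually (\<lambda>y. real (card (M b (w b * y))) / F (w b * y) * (F (w b * y) / F y) = real (card (M b (w b * y))) / F y) at_top"
          using eventually_compose_filterlim[OF Fpos lim] by eventually_elim simp
        ultimately show "((\<lambda>y. real (card (M b (w b * y))) / F y) \<longlongrightarrow> w b) at_top"
          by (auto intro: Lim_transform_eventually)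
      qed
    qed (use e in simp)
    show "eventually (\<lambda>x. dist (N x / F (Y x)) (infsum w B) < r) at_top"
      using eventually_compose_filterlim[OF up Ylim] eventually_compose_filterlim[OF lo Ylim]
        eventually_compose_filterlim[OF Fpos Ylim] eventually_compose_filterlim[OF eventually_ge_at_top[of Y0] Ylim]
        eventually_gt_at_top[of 0]
    proof eventually_elim
      case (elim x)
      define y where "y = Y x"
      have y: "F y > 0" "y \<ge> Y0" using elim by (simp_all add: y_def)
      have le_iff: "real (m ^ \<alpha> * b) \<le> x \<longleftrightarrow> real m \<le> w b * y" if "b \<in> B" for m b
        unfolding w_def y_def Y_def using powr_inverse_of_power_le_iff[OF a B(1)[OF that]] elim by simp
      let ?N = "{n. real n \<le> x \<and> n \<in> S}"
      have finS: "finite ?N" by (rule finite_nat_le_real)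
      have "N x / F y < sum w B0 + r / 3 + C * q"
      proof -
        \<comment> \<open>Since m >= 1, only b <= x can occur, which makes the union finite. Inside
          \<open>B0\<close> the limits are used, outside it Potter's bound.\<close>
        define Bx where "Bx = {b. real b \<le> x \<and> b \<in> B}"
        define A where "A = (\<lambda>b. {m. real m \<le> w b * y \<and> m \<in> almost_primes (Suc k)})"
        have finBx: "finite Bx" unfolding Bx_def by (rule finite_nat_le_real)
        have "?N \<subseteq> (\<Union>b\<in>Bx. (\<lambda>m. m ^ \<alpha> * b) ` A b)"
        proof
          fix n assume n: "n \<in> ?N"
          then obtain m b where mb: "m \<in> almost_primes (Suc k)" "b \<in> B" "n = m ^ \<alpha> * b"
            using upper[of n] by auto
          have "m > 0" using mb by (simp add: almost_primes_def)
          hence "b \<le> n" using mb by simp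
          hence "real b \<le> x" using n by auto
          moreover have "real m \<le> w b * y" using le_iff[OF mb(2), of m] n mb by simp
          ultimately show "n \<in> (\<Union>b\<in>Bx. (\<lambda>m. m ^ \<alpha> * b) ` A b)"
            using mb by (auto simp: Bx_def A_def)
        qed
        hence "card ?N \<le> card (\<Union>b\<in>Bx. (\<lambda>m. m ^ \<alpha> * b) ` A b)"
          using finBx by (intro card_mono finite_UN_I finite_imageI) (auto simp: A_def intro: finite_nat_le_real[simplified])
        also have "\<dots> \<le> (\<Sum>b\<in>Bx. card ((\<lambda>m. m ^ \<alpha> * b) ` A b))" by (rule card_UN_le[OF finBx])
        also have "\<dots> \<le> (\<Sum>b\<in>Bx. card (A b))"
          unfolding A_def by (intro sum_mono card_image_le finite_nat_le_real)
        finally have "N x \<le> real (\<Sum>b\<in>Bx. card (A b))" unfolding N_def by (simp only: of_nat_le_iff)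
        also have "\<dots> = (\<Sum>b\<in>Bx. F (w b * y))" by (simp add: F_def A_def almost_prime_count_altdef)
        also have "\<dots> \<le> (\<Sum>b\<in>B0 \<union> (Bx - B0). F (w b * y))"
          using finBx B0 by (intro sum_mono2) (auto simp: F_def)
        also have "\<dots> = (\<Sum>b\<in>B0. F (w b * y)) + (\<Sum>b\<in>Bx - B0. F (w b * y))"
          using finBx B0 by (intro sum.union_disjoint) auto
        also have "(\<Sum>b\<in>Bx - B0. F (w b * y)) \<le> (\<Sum>b\<in>Bx - B0. C * g b * F y)"
        proof (rule sum_mono)
          fix b assume "b \<in> Bx - B0"
          hence b: "b \<in> B" by (auto simp: Bx_def)
          show "F (w b * y) \<le> C * g b * F y"
            using C(2)[OF y(2) w(1,2)[OF b]] w(3)[OF b] by simp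
        qed
        also have "\<dots> = C * F y * (\<Sum>b\<in>Bx - B0. g b)" by (simp add: sum_distrib_left mult_ac)
        also have "(\<Sum>b\<in>Bx - B0. g b) \<le> infsum g (B - B0)"
          using finBx by (intro finite_sum_le_infsum gs0) (auto simp: Bx_def g_def)
        hence "C * F y * (\<Sum>b\<in>Bx - B0. g b) \<le> C * F y * q"
          using gB0 C(1) y by (intro mult_left_mono) auto
        finally have "N x / F y \<le> ((\<Sum>b\<in>B0. F (w b * y)) + C * F y * q) / F y"
          using y by (intro divide_right_mono) auto
        also have "\<dots> = (\<Sum>b\<in>B0. F (w b * y) / F y) + C * q"
          using y by (simp add: add_divide_distrib sum_divide_distrib)
        finally show ?thesis using elim(1) by (simp add: y_def)
      qed
      moreover have "N x / F y > sum w B0 - r / 3"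
      proof -
        have finM: "finite (M b z)" for b z unfolding M_def by (rule finite_nat_le_real)
        have inj: "inj_on (\<lambda>(b,m). m ^ \<alpha> * b) (SIGMA b:B0. M b (w b * y))"
        proof (rule inj_onI, clarify)
          fix b m b' m'
          assume h: "b \<in> B0" "m \<in> M b (w b * y)" "b' \<in> B0" "m' \<in> M b' (w b' * y)" "m ^ \<alpha> * b = m' ^ \<alpha> * b'"
          have bb: "b \<in> B" "b' \<in> B" using h B0 by auto
          have mm: "squarefree m" "coprime m b" "m > 0" "squarefree m'" "coprime m' b'" "m' > 0"
            using h by (auto simp: M_def coprime_almost_primes_def almost_primes_def)
          show "b = b' \<and> m = m'"
            using power_mult_representation_unique[OF a mm B(1)[OF bb(1)] B(2)[OF bb(1)] B(1)[OF bb(2)] B(2)[OF bb(2)] h(5)]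
            by blast
        qed
        have "(\<Sum>b\<in>B0. card (M b (w b * y))) = card (SIGMA b:B0. M b (w b * y))"
          using B0 finM by (intro card_SigmaI[symmetric]) auto
        also have "\<dots> = card ((\<lambda>(b,m). m ^ \<alpha> * b) ` (SIGMA b:B0. M b (w b * y)))"
          by (rule card_image[OF inj, symmetric])
        also have "\<dots> \<le> card ?N"
        proof (rule card_mono[OF finS], safe)
          fix b m assume h: "b \<in> B0" "m \<in> M b (w b * y)"
          hence b: "b \<in> B" using B0 by auto
          show "m ^ \<alpha> * b \<in> S" using lower[OF b] h by (simp add: M_def)
          show "real (m ^ \<alpha> * b) \<le> x" using le_iff[OF b, of m] h by (simp add: M_def)
        qed
        finally have "real (\<Sum>b\<in>B0. card (M b (w b * y))) \<le> N x" unfolding N_def by (simp only: of_nat_le_iff)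
        hence "(\<Sum>b\<in>B0. real (card (M b (w b * y)))) / F y \<le> N x / F y"
          using y by (intro divide_right_mono) auto
        moreover have "sum w B0 - r / 3 < (\<Sum>b\<in>B0. real (card (M b (w b * y))) / F y)"
          using elim(2) by (simp add: y_def)
        ultimately show ?thesis by (simp add: sum_divide_distrib)
      qed
      ultimately show ?case using W d e unfolding dist_real_def y_def[symmetric] by linarith
    qed
  qed
  thus "((\<lambda>x. real (card {n. real n \<le> x \<and> n \<in> S}) / real (almost_prime_count (Suc k) (x powr (1 / real \<alpha>))))
       \<longlongrightarrow> infsum w B) at_top"
    by (simp only: N_def F_def Y_def)
qed

section \<open>Summability over and decomposition of the sets P_sigma and P_pi\<close>

lemma P_sigma_Nil: "P_sigma [] = {1}"
  by (auto simp: P_sigma_def)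

lemma P_sigma_Cons_subset: "P_sigma (a # \<gamma>) \<subseteq> (\<lambda>(p,n). p ^ a * n) ` ({p. prime p} \<times> P_sigma \<gamma>)"
proof
  fix n assume "n \<in> P_sigma (a # \<gamma>)"
  then obtain p :: "nat \<Rightarrow> nat" where p: "\<forall>i<Suc (length \<gamma>). prime (p i)" "n = (\<Prod>i<Suc (length \<gamma>). p i ^ ((a # \<gamma>) ! i))"
    by (auto simp: P_sigma_def)
  have "n = p 0 ^ a * (\<Prod>i<length \<gamma>. p (Suc i) ^ (\<gamma> ! i))"
    unfolding p(2) by (subst prod.lessThan_Suc_shift) simp
  moreover have "(\<Prod>i<length \<gamma>. p (Suc i) ^ (\<gamma> ! i)) \<in> P_sigma \<gamma>"
    using p(1) by (auto simp: P_sigma_def intro!: exI[of _ "\<lambda>i. p (Suc i)"])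
  ultimately show "n \<in> (\<lambda>(p,n). p ^ a * n) ` ({p. prime p} \<times> P_sigma \<gamma>)"
    using p(1) by (intro image_eqI[of _ _ "(p 0, \<Prod>i<length \<gamma>. p (Suc i) ^ (\<gamma> ! i))"]) auto
qed

text \<open>One preimage is selected for each element of \<open>B\<close>. Thus a sum over integers
  is controlled by a sum over their possibly more numerous representations.\<close>

lemma summable_on_subset_image:
  fixes f :: "'b \<Rightarrow> real"
  assumes "(\<lambda>x. f (h x)) summable_on A" "B \<subseteq> h ` A"
  shows "f summable_on B"
proof -
  obtain U where U: "U \<subseteq> A" "inj_on h U" "B = h ` U"
    using assms(2) by (auto simp: subset_image_inj)
  have "(\<lambda>x. f (h x)) summable_on U" by (rule summable_on_subset[OF assms(1) U(1)])
  thus ?thesis unfolding U(3) summable_on_reindex[OF U(2)] by (simp add: o_def)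
qed

lemma summable_on_product_nonneg:
  fixes f :: "'a \<Rightarrow> real" and g :: "'b \<Rightarrow> real"
  assumes "f summable_on A" "g summable_on B" "\<And>x. f x \<ge> 0" "\<And>y. g y \<ge> 0"
  shows "(\<lambda>(x,y). f x * g y) summable_on A \<times> B"
proof (rule Infinite_Sum.abs_summable_summable)
  show "(\<lambda>z. norm (case z of (x,y) \<Rightarrow> f x * g y)) summable_on A \<times> B"
    unfolding Infinite_Sum.abs_summable_on_Sigma_iff using assms
    by (auto simp: infsum_cmult_right abs_mult infsum_nonneg intro!: summable_on_cmult_right summable_on_cmult_left)
qed

text \<open>Summing over tuples of primes instead of integers factorizes the series into sums of
  p^(-a t), one for each entry a, each convergent as a t > 1.\<close>

lemma summable_on_P_sigma:
  assumes "\<And>a. a \<in> set \<gamma> \<Longrightarrow> real a * t > 1"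
  shows "(\<lambda>n. real n powr (-t)) summable_on P_sigma \<gamma>"
  using assms
proof (induction \<gamma>)
  case Nil
  thus ?case by (simp add: P_sigma_Nil)
next
  case (Cons a \<gamma>)
  have IH: "(\<lambda>n. real n powr (-t)) summable_on P_sigma \<gamma>" by (rule Cons.IH) (use Cons.prems in auto)
  have "summable (\<lambda>n. real n powr (-(real a * t)))"
    using Cons.prems[of a] by (subst summable_real_powr_iff) auto
  hence "(\<lambda>n. real n powr (-(real a * t))) summable_on UNIV"
    by (rule summable_nonneg_imp_summable_on) auto
  hence p: "(\<lambda>n. real n powr (-(real a * t))) summable_on {p. prime p}"
    by (rule summable_on_subset) auto
  have "(\<lambda>(p,n). real p powr (-(real a * t)) * real n powr (-t)) summable_on {p. prime p} \<times> P_sigma \<gamma>"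
    by (rule summable_on_product_nonneg[OF p IH]) auto
  also have "?this \<longleftrightarrow> (\<lambda>z. real (case z of (p,n) \<Rightarrow> p ^ a * n) powr (-t)) summable_on {p. prime p} \<times> P_sigma \<gamma>"
    by (rule summable_on_cong)
       (auto simp: powr_mult powr_powr prime_gt_0_nat simp flip: powr_realpow)
  finally show ?case by (rule summable_on_subset_image[OF _ P_sigma_Cons_subset])
qed

lemma P_pi_subset_P_sigma: "P_pi \<gamma> \<subseteq> P_sigma \<gamma>"
  by (auto simp: P_pi_def P_sigma_def)

lemma P_sigma_pos: "n \<in> P_sigma \<gamma> \<Longrightarrow> n > 0"
  by (auto simp: P_sigma_def prime_gt_0_nat intro!: prod_pos)

text \<open>Makes the constants in the theorem positive, so that the ratio limits can be divided by
  them and become asymptotic equivalences.\<close>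

lemma P_pi_nonempty: "P_pi \<gamma> \<noteq> {}"
proof -
  obtain p :: "nat \<Rightarrow> nat" where p: "inj p" "range p \<subseteq> {p. prime p}"
    using infinite_countable_subset[OF primes_infinite] by blast
  have "prime (p i)" for i using p(2) by auto
  hence "(\<Prod>i<length \<gamma>. p i ^ (\<gamma> ! i)) \<in> P_pi \<gamma>"
    unfolding P_pi_def using inj_on_subset[OF p(1)] by (auto intro!: exI[of _ p])
  thus ?thesis by blast
qed

lemma P_sigma_multiplicity:
  assumes "n \<in> P_sigma \<gamma>" "prime p" "p dvd n" "\<forall>i<length \<gamma>. \<alpha> < \<gamma> ! i"
  shows "multiplicity p n > \<alpha>"
proof -
  obtain q :: "nat \<Rightarrow> nat" where q: "\<And>i. i < length \<gamma> \<Longrightarrow> prime (q i)" "n = (\<Prod>i<length \<gamma>. q i ^ (\<gamma> ! i))"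
    using assms(1) by (auto simp: P_sigma_def)
  obtain i where i: "i < length \<gamma>" "p dvd q i ^ (\<gamma> ! i)"
    using assms(2,3) unfolding q(2) by (auto simp: prime_dvd_prod_iff)
  hence "p dvd q i" using assms(2) by (auto dest: prime_dvd_power)
  hence "p = q i" using primes_dvd_imp_eq[OF assms(2) q(1)[OF i(1)]] by simp
  have "q i ^ (\<gamma> ! i) dvd n" unfolding q(2) using i(1) by (intro dvd_prodI) auto
  hence "\<gamma> ! i \<le> multiplicity p n"
    using \<open>p = q i\<close> assms(2) P_sigma_pos[OF assms(1)] by (intro multiplicity_geI) auto
  thus ?thesis using assms(4) i(1) by fastforce
qed

lemma prod_lessThan_add:
  fixes f :: "nat \<Rightarrow> 'a :: comm_monoid_mult"
  shows "(\<Prod>i<k + r. f i) = (\<Prod>i<k. f i) * (\<Prod>i<r. f (k + i))"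
  by (induction r) (simp_all add: mult.assoc)

lemma prod_replicate_append:
  fixes p :: "nat \<Rightarrow> nat"
  shows "(\<Prod>i<length (replicate k \<alpha> @ \<beta>). p i ^ ((replicate k \<alpha> @ \<beta>) ! i))
    = (\<Prod>i<k. p i) ^ \<alpha> * (\<Prod>i<length \<beta>. p (k + i) ^ (\<beta> ! i))"
  by (simp add: prod_lessThan_add nth_append prod_power_distrib)

lemma P_sigma_replicate_append:
  "n \<in> P_sigma (replicate k \<alpha> @ \<beta>) \<longleftrightarrow> (\<exists>m\<in>almost_primes k. \<exists>b\<in>P_sigma \<beta>. n = m ^ \<alpha> * b)"
proof
  assume "n \<in> P_sigma (replicate k \<alpha> @ \<beta>)"
  then obtain p :: "nat \<Rightarrow> nat" where p: "\<forall>i<k + length \<beta>. prime (p i)"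
    "n = (\<Prod>i<k. p i) ^ \<alpha> * (\<Prod>i<length \<beta>. p (k + i) ^ (\<beta> ! i))"
    unfolding P_sigma_def prod_replicate_append by auto
  have "(\<Prod>i<k. p i) \<in> almost_primes k" unfolding almost_primes_altdef using p(1) by (intro exI[of _ p]) auto
  moreover have "(\<Prod>i<length \<beta>. p (k + i) ^ (\<beta> ! i)) \<in> P_sigma \<beta>"
    unfolding P_sigma_def using p(1) by (auto intro!: exI[of _ "\<lambda>i. p (k + i)"])
  ultimately show "\<exists>m\<in>almost_primes k. \<exists>b\<in>P_sigma \<beta>. n = m ^ \<alpha> * b" using p(2) by blast
next
  assume "\<exists>m\<in>almost_primes k. \<exists>b\<in>P_sigma \<beta>. n = m ^ \<alpha> * b"
  then obtain m b where mb: "m \<in> almost_primes k" "b \<in> P_sigma \<beta>" "n = m ^ \<alpha> * b" by blast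
  from mb(1) obtain p :: "nat \<Rightarrow> nat" where p: "\<forall>i<k. prime (p i)" "m = (\<Prod>i<k. p i)"
    by (auto simp: almost_primes_altdef)
  from mb(2) obtain q :: "nat \<Rightarrow> nat" where q: "\<forall>i<length \<beta>. prime (q i)" "b = (\<Prod>i<length \<beta>. q i ^ (\<beta> ! i))"
    by (auto simp: P_sigma_def)
  define h where "h = (\<lambda>i. if i < k then p i else q (i - k))"
  have "(\<Prod>i<k. h i) ^ \<alpha> * (\<Prod>i<length \<beta>. h (k + i) ^ (\<beta> ! i)) = n"
    unfolding mb(3) p(2) q(2) by (simp add: h_def)
  moreover have "\<forall>i<length (replicate k \<alpha> @ \<beta>). prime (h i)" using p(1) q(1) by (auto simp: h_def)
  ultimately show "n \<in> P_sigma (replicate k \<alpha> @ \<beta>)"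
    unfolding P_sigma_def prod_replicate_append by blast
qed

lemma P_pi_replicate_append_upper:
  assumes "n \<in> P_pi (replicate k \<alpha> @ \<beta>)"
  shows "\<exists>m\<in>almost_primes k. \<exists>b\<in>P_pi \<beta>. n = m ^ \<alpha> * b"
proof -
  obtain p :: "nat \<Rightarrow> nat" where p: "\<forall>i<k + length \<beta>. prime (p i)" "inj_on p {..<k + length \<beta>}"
    "n = (\<Prod>i<k. p i) ^ \<alpha> * (\<Prod>i<length \<beta>. p (k + i) ^ (\<beta> ! i))"
    using assms unfolding P_pi_def prod_replicate_append by auto
  have "(\<Prod>i<k. p i) \<in> almost_primes k" unfolding almost_primes_altdef using p(1) by (intro exI[of _ p]) auto
  moreover have "inj_on (\<lambda>i. p (k + i)) {..<length \<beta>}"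
  proof (rule inj_onI)
    fix i j assume "i \<in> {..<length \<beta>}" "j \<in> {..<length \<beta>}" "p (k + i) = p (k + j)"
    thus "i = j" using inj_onD[OF p(2), of "k + i" "k + j"] by simp
  qed
  hence "(\<Prod>i<length \<beta>. p (k + i) ^ (\<beta> ! i)) \<in> P_pi \<beta>"
    unfolding P_pi_def using p(1) by (auto intro!: exI[of _ "\<lambda>i. p (k + i)"])
  ultimately show ?thesis using p(3) by blast
qed

text \<open>Squarefreeness of m makes its primes distinct from each other. Since the exponents are
  positive, every q_j divides b, so coprimality keeps the primes of m apart from the q_j.\<close>

lemma P_pi_replicate_append_lower:
  assumes m: "m \<in> coprime_almost_primes k b" and b: "b \<in> P_pi \<beta>" and pos: "\<forall>i<length \<beta>. 0 < \<beta> ! i"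
  shows "m ^ \<alpha> * b \<in> P_pi (replicate k \<alpha> @ \<beta>)"
proof -
  from m obtain p :: "nat \<Rightarrow> nat" where p: "\<forall>i<k. prime (p i)" "m = (\<Prod>i<k. p i)"
    by (auto simp: coprime_almost_primes_def almost_primes_altdef)
  from b obtain q :: "nat \<Rightarrow> nat" where q: "\<forall>i<length \<beta>. prime (q i)" "inj_on q {..<length \<beta>}"
    "b = (\<Prod>i<length \<beta>. q i ^ (\<beta> ! i))" by (auto simp: P_pi_def)
  have sf: "squarefree m" "coprime m b" using m by (auto simp: coprime_almost_primes_def)
  have p_inj: "p i \<noteq> p j" if ij: "i < k" "j < k" "i \<noteq> j" for i j
  proof
    assume eq: "p i = p j"
    have "(\<Prod>l\<in>{i,j}. p l) dvd m" unfolding p(2) using ij by (intro prod_dvd_prod_subset) auto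
    hence "p i ^ 2 dvd m" using ij eq by (simp add: power2_eq_square)
    hence "p i dvd 1" using sf(1) by (rule squarefreeD[rotated])
    thus False using p(1) ij by (metis not_prime_unit)
  qed
  have pq: "p i \<noteq> q j" if ij: "i < k" "j < length \<beta>" for i j
  proof
    assume eq: "p i = q j"
    have "p i dvd m" unfolding p(2) using ij by (intro dvd_prodI) auto
    moreover have "q j ^ (\<beta> ! j) dvd b" unfolding q(3) using ij by (intro dvd_prodI) auto
    hence "q j dvd b" using pos ij dvd_power[of "\<beta> ! j" "q j"] dvd_trans by blast
    ultimately have "is_unit (p i)" using sf(2) eq by (metis coprime_common_divisor)
    thus False using p(1) ij by (metis not_prime_unit)
  qed
  define h where "h = (\<lambda>i. if i < k then p i else q (i - k))"
  have "(\<Prod>i<k. h i) ^ \<alpha> * (\<Prod>i<length \<beta>. h (k + i) ^ (\<beta> ! i)) = m ^ \<alpha> * b"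
    unfolding p(2) q(3) by (simp add: h_def)
  moreover have "\<forall>i<length (replicate k \<alpha> @ \<beta>). prime (h i)" using p(1) q(1) by (auto simp: h_def)
  moreover have "inj_on h {..<length (replicate k \<alpha> @ \<beta>)}"
  proof (rule inj_onI)
    fix i j assume ij: "i \<in> {..<length (replicate k \<alpha> @ \<beta>)}" "j \<in> {..<length (replicate k \<alpha> @ \<beta>)}" "h i = h j"
    consider "i < k" "j < k" | "i < k" "\<not> j < k" | "\<not> i < k" "j < k" | "\<not> i < k" "\<not> j < k" by blast
    thus "i = j"
    proof cases
      case 1 thus ?thesis using ij(3) p_inj by (auto simp: h_def)
    next
      case 2
      hence "j - k < length \<beta>" using ij(2) by auto
      thus ?thesis using 2 ij(3) pq[of i "j - k"] by (simp add: h_def)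
    next
      case 3
      hence "i - k < length \<beta>" using ij(1) by auto
      thus ?thesis using 3 ij(3) pq[of j "i - k"] by (simp add: h_def)
    next
      case 4
      hence "i - k = j - k" using ij inj_onD[OF q(2), of "i - k" "j - k"] by (auto simp: h_def)
      thus ?thesis using 4 by simp
    qed
  qed
  ultimately show ?thesis
    unfolding P_pi_def prod_replicate_append by (intro CollectI exI[of _ h] conjI) (simp_all only:)
qed

theorem theorem1:
  fixes k r \<alpha> :: nat and \<beta> :: "nat list"
  assumes "k > 0" and "r > 0" and "\<alpha> > 0"
    and "length \<beta> = r"
    and "\<forall>i<r. \<alpha> < \<beta> ! i"
  shows "(\<lambda>n. real n powr (- 1 / real \<alpha>)) summable_on P_sigma \<beta> \<and>
      (\<lambda>n. real n powr (- 1 / real \<alpha>)) summable_on P_pi \<beta> \<and>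
      ((\<lambda>x. real (sigma_count (replicate k \<alpha> @ \<beta>) x)) \<sim>[at_top]
           (\<lambda>x. real (almost_prime_count k (x powr (1 / real \<alpha>))) *
                (\<Sum>\<^sub>\<infinity>n\<in>P_sigma \<beta>. real n powr (- 1 / real \<alpha>)))) \<and>
      ((\<lambda>x. real (pi_count (replicate k \<alpha> @ \<beta>) x)) \<sim>[at_top]
           (\<lambda>x. real (almost_prime_count k (x powr (1 / real \<alpha>))) *
                (\<Sum>\<^sub>\<infinity>n\<in>P_pi \<beta>. real n powr (- 1 / real \<alpha>))))"
proof -
  obtain j where k: "k = Suc j" using assms(1) by (cases k) auto
  have gt: "\<forall>i<length \<beta>. \<alpha> < \<beta> ! i" using assms by simp
  \<comment> \<open>The midpoint of \<alpha>/(\<alpha>+1) and 1: above the former for summability,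
    below the latter for Potter's bound.\<close>
  define s where "s = (2 * real \<alpha> + 1) / (2 * real \<alpha> + 2)"
  have s: "0 < s" "s < 1" by (auto simp: s_def field_simps)
  have summ: "(\<lambda>n. real n powr (- s / real \<alpha>)) summable_on P_sigma \<beta>"
  proof -
    have "real a * (s / real \<alpha>) > 1" if "a \<in> set \<beta>" for a
    proof -
      have "a \<ge> Suc \<alpha>" using that gt by (auto simp: in_set_conv_nth Suc_le_eq)
      hence "real a \<ge> real \<alpha> + 1" by linarith
      hence "(real \<alpha> + 1) * (s / real \<alpha>) \<le> real a * (s / real \<alpha>)"
        using s assms(3) by (intro mult_right_mono) auto
      moreover have "(real \<alpha> + 1) * (s / real \<alpha>) > 1"
        using assms(3) by (simp add: s_def divide_simps) (simp add: algebra_simps)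
      ultimately show ?thesis by linarith
    qed
    from summable_on_P_sigma[OF this] show ?thesis by simp
  qed
  have asymp: "(\<lambda>n. real n powr (- 1 / real \<alpha>)) summable_on B \<and>
     (\<lambda>x. real (card {n. real n \<le> x \<and> n \<in> S})) \<sim>[at_top]
     (\<lambda>x. real (almost_prime_count k (x powr (1 / real \<alpha>))) * (\<Sum>\<^sub>\<infinity>n\<in>B. real n powr (- 1 / real \<alpha>)))"
    if B: "B \<subseteq> P_sigma \<beta>" "B \<noteq> {}"
      and upper: "\<And>n. n \<in> S \<Longrightarrow> \<exists>m\<in>almost_primes k. \<exists>b\<in>B. n = m ^ \<alpha> * b"
      and lower: "\<And>m b. b \<in> B \<Longrightarrow> m \<in> coprime_almost_primes k b \<Longrightarrow> m ^ \<alpha> * b \<in> S"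
    for B S
  proof -
    have pos: "b > 0" if "b \<in> B" for b using that B(1) P_sigma_pos by blast
    have mult: "multiplicity p b > \<alpha>" if "b \<in> B" "prime p" "p dvd b" for b p
      using that B(1) P_sigma_multiplicity[OF _ _ _ gt] by blast
    note main = power_product_count_asymp[OF assms(3) s pos mult summable_on_subset[OF summ B(1)]
      upper[unfolded k] lower[unfolded k], folded k]
    define W where "W = (\<Sum>\<^sub>\<infinity>n\<in>B. real n powr (- 1 / real \<alpha>))"
    obtain b where b: "b \<in> B" using B(2) by blast
    have "0 < real b powr (- 1 / real \<alpha>)" using pos[OF b] by simp
    also have "\<dots> = (\<Sum>n\<in>{b}. real n powr (- 1 / real \<alpha>))" by simp
    also have "\<dots> \<le> W" unfolding W_def using b by (intro finite_sum_le_infsum main(1)) auto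
    finally have W: "W > 0" .
    have "(\<lambda>x. real (card {n. real n \<le> x \<and> n \<in> S})) \<sim>[at_top] (\<lambda>x. real (almost_prime_count k (x powr (1 / real \<alpha>))) * W)"
    proof (rule asymp_equivI')
      have "((\<lambda>x. real (card {n. real n \<le> x \<and> n \<in> S}) / real (almost_prime_count k (x powr (1 / real \<alpha>))) / W) \<longlongrightarrow> W / W) at_top"
        using W main(2) by (intro tendsto_divide tendsto_const) (auto simp: W_def)
      thus "((\<lambda>x. real (card {n. real n \<le> x \<and> n \<in> S}) / (real (almost_prime_count k (x powr (1 / real \<alpha>))) * W)) \<longlongrightarrow> 1) at_top"
        using W by (simp add: divide_divide_eq_left)
    qed
    thus ?thesis using main(1) by (simp add: W_def)
  qed
  have sigma: "m ^ \<alpha> * b \<in> P_sigma (replicate k \<alpha> @ \<beta>)" if "b \<in> P_sigma \<beta>" "m \<in> coprime_almost_primes k b" for m b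
    unfolding P_sigma_replicate_append using that by (auto simp: coprime_almost_primes_def)
  have pi: "m ^ \<alpha> * b \<in> P_pi (replicate k \<alpha> @ \<beta>)" if "b \<in> P_pi \<beta>" "m \<in> coprime_almost_primes k b" for m b
    using that gt by (intro P_pi_replicate_append_lower) auto
  have "P_sigma \<beta> \<noteq> {}" using P_pi_nonempty[of \<beta>] P_pi_subset_P_sigma[of \<beta>] by blast
  note 1 = asymp[OF order.refl this P_sigma_replicate_append[THEN iffD1] sigma]
  note 2 = asymp[OF P_pi_subset_P_sigma P_pi_nonempty P_pi_replicate_append_upper pi]
  show ?thesis unfolding sigma_count_def pi_count_def using 1 2 by blast
qed

end
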